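(* For every $m\in\mathbb{Z}_{\ge0}$, $\mathcal{R}^{\mathrm{f.r.}}_m=\mathcal{P}_m$ as subspaces of $\mathcal{CF}_q$, with a change of basis given by the following formulas, valid in $\mathcal{CF}_q$: for every $\chi\in\mathrm{IrrChar}(G_m)$, $$\chi\circ1=\frac{1}{|G_m|}\sum_{B\in G_m}\chi(B)\cdot\tilde B^{\mathrm{f.r.}},$$ and for every $B\in G_m$, $$\tilde B^{\mathrm{f.r.}}=\sum_{\chi\in\mathrm{IrrChar}(G_m)}\overline{\chi(B)}\cdot(\chi\circ1).$$
   Context: Fix a prime power $q$. For $N\in\mathbb{Z}_{\ge0}$ let $G_N=\mathrm{GL}_N(q)$ be the general linear group over the field $\mathbb{F}_q$ with $q$ elements ($G_0$ is the trivial group). $\mathcal{CF}_q$ is the $\mathbb{C}$-algebra whose elements are equivalence classes of families of complex class functions, one on $G_N$ for every large enough $N$, where two families are equivalent if they coincide for every large enough $N$; operations are pointwise. For $B\in G_m$ define, for every $N\ge0$ and $g\in G_N$, $\tilde B^{\mathrm{f.r.}}(g)=\#\{M\in \mathrm{Mat}_{m\times N}(\mathbb{F}_q): Mg=BM,\ \mathrm{rank}(M)=m\}$. This defines an element of $\mathcal{CF}_q$. Put $\mathcal{R}^{\mathrm{f.r.}}_m=\mathrm{span}_{\mathbb{C}}\{\tilde B^{\mathrm{f.r.}}: B\in G_m\}$. For $N=m+r$ let $P_{m,r}\le G_N$ be the subgroup of matrices $\begin{pmatrix}g_{11}&g_{12}\\0&g_{22}\end{pmatrix}$ with $g_{11}\in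 G_m$, $g_{22}\in G_r$. For characters $\chi_1$ of $G_m$ and $\chi_2$ of $G_r$, $\chi_1\circ\chi_2$ is the character of $G_N$ induced from the character $\begin{pmatrix}g_{11}&g_{12}\\0&g_{22}\end{pmatrix}\mapsto\chi_1(g_{11})\chi_2(g_{22})$ of $P_{m,r}$. For a character $\chi$ of $G_m$, $\chi\circ1\in\mathcal{CF}_q$ is the class function equal on $G_N$, $N\ge m$, to $\chi\circ1_{N-m}$, where $1_{N-m}$ is the trivial character of $G_{N-m}$. $\mathrm{IrrChar}(G_m)$ is the set of irreducible complex characters of $G_m$, and $\mathcal{P}_m=\mathrm{span}_{\mathbb{C}}\{\chi\circ1:\chi\in\mathrm{IrrChar}(G_m)\}$. *)

theory Defs
  imports Complex_Main "Jordan_Normal_Form.DL_Rank"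
begin

section \<open>General linear groups\<close>

definition GL :: "nat \<Rightarrow> 'k::field mat monoid" where
  "GL n = units_of (ring_mat TYPE('k) n ())"

lemma group_GL: "group (GL n)"
  unfolding GL_def
  by (rule monoid.units_group) (simp add: ring.is_monoid ring_mat)

lemma mult_GL [simp]: "x \<otimes>\<^bsub>GL n\<^esub> y = x * y"
  by (simp add: GL_def units_of_def ring_mat_def)

lemma one_GL [simp]: "\<one>\<^bsub>GL n\<^esub> = 1\<^sub>m n"
  by (simp add: GL_def units_of_def ring_mat_def)

lemma carrier_GL:
  "carrier (GL n) = {A \<in> carrier_mat n n. invertible_mat A}"
proof (intro equalityI subsetI)
  fix A :: "'a mat" assume "A \<in> carrier (GL n)"
  thus "A \<in> {A \<in> carrier_mat n n. invertible_mat A}"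
    by (auto simp: GL_def units_of_def Units_def ring_mat_def invertible_mat_def inverts_mat_def)
next
  fix A :: "'a mat" assume "A \<in> {A \<in> carrier_mat n n. invertible_mat A}"
  then obtain B where A: "A \<in> carrier_mat n n" and AB: "A * B = 1\<^sub>m n"
      and BA: "B * A = 1\<^sub>m (dim_row B)"
    by (auto simp: invertible_mat_def inverts_mat_def)
  have "dim_col B = n" using arg_cong [OF AB, of dim_col] by simp
  moreover have "dim_row B = n" using arg_cong [OF BA, of dim_col] A by simp
  ultimately show "A \<in> carrier (GL n)"
    using A AB BA by (auto simp: GL_def units_of_def Units_def ring_mat_def intro!: bexI [of _ B])
qed

lemma carrier_GL_mat: "A \<in> carrier (GL n) \<Longrightarrow> A \<in> carrier_mat n n"
  by (simp add: carrier_GL)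

section \<open>Complex representations and characters of a group\<close>

definition class_function :: "('g, 'x) monoid_scheme \<Rightarrow> ('g \<Rightarrow> complex) \<Rightarrow> bool" where
  "class_function G f \<longleftrightarrow>
     (\<forall>g\<in>carrier G. \<forall>h\<in>carrier G. f (h \<otimes>\<^bsub>G\<^esub> g \<otimes>\<^bsub>G\<^esub> inv\<^bsub>G\<^esub> h) = f g)"

definition irreducible_rep ::
    "('g, 'x) monoid_scheme \<Rightarrow> nat \<Rightarrow> ('g \<Rightarrow> complex mat) \<Rightarrow> bool" where
  "irreducible_rep G d \<rho> \<longleftrightarrow>
     \<rho> \<in> hom G (GL d) \<and> 0 < d \<and>
     (\<forall>W. VectorSpace.subspace class_ring W (module_vec TYPE(complex) d) \<longrightarrow>
          (\<forall>g\<in>carrier G. \<forall>w\<in>W. \<rho> g *\<^sub>v w \<in> W) \<longrightarrow>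
          W = {0\<^sub>v d} \<or> W = carrier_vec d)"

text \<open>The value \<open>0\<close> outside the group makes a character a single function, so that
  \<open>IrrChar G\<close> does not contain several extensions of the same character.\<close>

definition character ::
    "('g, 'x) monoid_scheme \<Rightarrow> nat \<Rightarrow> ('g \<Rightarrow> complex mat) \<Rightarrow> 'g \<Rightarrow> complex" where
  "character G d \<rho> g = (if g \<in> carrier G then \<Sum>i<d. \<rho> g $$ (i, i) else 0)"

definition IrrChar :: "('g, 'x) monoid_scheme \<Rightarrow> ('g \<Rightarrow> complex) set" where
  "IrrChar G = {character G d \<rho> | d \<rho>. irreducible_rep G d \<rho>}"

definition induced ::
    "('g, 'x) monoid_scheme \<Rightarrow> 'g set \<Rightarrow> ('g \<Rightarrow> complex) \<Rightarrow> 'g \<Rightarrow> complex" where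
  "induced G H \<phi> g =
     (\<Sum>x | x \<in> carrier G \<and> inv\<^bsub>G\<^esub> x \<otimes>\<^bsub>G\<^esub> g \<otimes>\<^bsub>G\<^esub> x \<in> H.
        \<phi> (inv\<^bsub>G\<^esub> x \<otimes>\<^bsub>G\<^esub> g \<otimes>\<^bsub>G\<^esub> x)) / of_nat (card H)"

lemma class_function_induced:
  fixes G (structure)
  assumes "group G"
  shows "class_function G (induced G H \<phi>)"
  unfolding class_function_def
proof (intro ballI)
  interpret group G by fact
  fix g h assume g: "g \<in> carrier G" and h: "h \<in> carrier G"
  have conj: "inv (h \<otimes> x) \<otimes> (h \<otimes> g \<otimes> inv h) \<otimes> (h \<otimes> x) = inv x \<otimes> g \<otimes> x"
    if "x \<in> carrier G" for x
  proof -
    have "inv (h \<otimes> x) \<otimes> (h \<otimes> g \<otimes> inv h) \<otimes> (h \<otimes> x)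
        = inv x \<otimes> (inv h \<otimes> (h \<otimes> (g \<otimes> (inv h \<otimes> (h \<otimes> x)))))"
      using g h that by (simp add: inv_mult_group m_assoc)
    also have "inv h \<otimes> (h \<otimes> x) = x"
      using h that by (simp add: m_assoc [symmetric])
    also have "inv h \<otimes> (h \<otimes> (g \<otimes> x)) = g \<otimes> x"
      using g h that by (simp add: m_assoc [symmetric])
    finally show ?thesis using g h that by (simp add: m_assoc)
  qed
  have cancel: "h \<otimes> (inv h \<otimes> x) = x" "inv h \<otimes> (h \<otimes> x) = x" if "x \<in> carrier G" for x
    using h that by (simp_all add: m_assoc [symmetric])
  have "(\<Sum>x | x \<in> carrier G \<and> inv x \<otimes> (h \<otimes> g \<otimes> inv h) \<otimes> x \<in> H.
           \<phi> (inv x \<otimes> (h \<otimes> g \<otimes> inv h) \<otimes> x)) =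
        (\<Sum>x | x \<in> carrier G \<and> inv x \<otimes> g \<otimes> x \<in> H. \<phi> (inv x \<otimes> g \<otimes> x))"
  proof (rule sum.reindex_bij_witness [where i = "\<lambda>x. h \<otimes> x" and j = "\<lambda>x. inv h \<otimes> x"])
    fix x assume x: "x \<in> {x \<in> carrier G. inv x \<otimes> (h \<otimes> g \<otimes> inv h) \<otimes> x \<in> H}"
    hence "inv (inv h \<otimes> x) \<otimes> g \<otimes> (inv h \<otimes> x) = inv x \<otimes> (h \<otimes> g \<otimes> inv h) \<otimes> x"
      using conj [of "inv h \<otimes> x"] h by (simp add: cancel)
    with x h show "inv h \<otimes> x \<in> {x \<in> carrier G. inv x \<otimes> g \<otimes> x \<in> H}"
      and "\<phi> (inv (inv h \<otimes> x) \<otimes> g \<otimes> (inv h \<otimes> x)) = \<phi> (inv x \<otimes> (h \<otimes> g \<otimes> inv h) \<otimes> x)"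
      by simp_all
  qed (use h conj cancel in auto)
  thus "induced G H \<phi> (h \<otimes> g \<otimes> inv h) = induced G H \<phi> g"
    by (simp add: induced_def)
qed

section \<open>The algebra of stable class functions\<close>

text \<open>Families are total functions of \<open>N\<close> and of the matrix; the relation looks only at
  their restrictions to \<open>GL N\<close> for large \<open>N\<close>, and it is reflexive exactly on the families that
  are class functions there.\<close>

definition cf_rel ::
    "(nat \<Rightarrow> 'a::{finite,field} mat \<Rightarrow> complex) \<Rightarrow> (nat \<Rightarrow> 'a mat \<Rightarrow> complex) \<Rightarrow> bool" where
  "cf_rel f f' \<longleftrightarrow>
     (\<forall>\<^sub>F N in sequentially. class_function (GL N) (f N) \<and> class_function (GL N) (f' N) \<and>
        (\<forall>g\<in>carrier (GL N). f N g = f' N g))"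

quotient_type (overloaded) 'a cf =
    "nat \<Rightarrow> 'a::{finite,field} mat \<Rightarrow> complex" / partial: cf_rel
proof (rule part_equivpI)
  show "\<exists>f. cf_rel f f"
    by (rule exI [of _ "\<lambda>_ _. 0"]) (simp add: cf_rel_def class_function_def)
  show "symp cf_rel"
    by (rule sympI) (auto simp: cf_rel_def elim: eventually_mono)
  show "transp cf_rel"
    by (rule transpI, unfold cf_rel_def, erule (1) eventually_elim2) auto
qed

instantiation cf :: ("{finite,field}") comm_ring_1
begin

lift_definition zero_cf :: "'a cf" is "\<lambda>_ _. 0"
  by (simp add: cf_rel_def class_function_def)

lift_definition one_cf :: "'a cf" is "\<lambda>_ _. 1"
  by (simp add: cf_rel_def class_function_def)

lift_definition plus_cf :: "'a cf \<Rightarrow> 'a cf \<Rightarrow> 'a cf" is "\<lambda>f f' N g. f N g + f' N g"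
  unfolding cf_rel_def
  by (erule (1) eventually_elim2) (auto simp: class_function_def)

lift_definition minus_cf :: "'a cf \<Rightarrow> 'a cf \<Rightarrow> 'a cf" is "\<lambda>f f' N g. f N g - f' N g"
  unfolding cf_rel_def
  by (erule (1) eventually_elim2) (auto simp: class_function_def)

lift_definition times_cf :: "'a cf \<Rightarrow> 'a cf \<Rightarrow> 'a cf" is "\<lambda>f f' N g. f N g * f' N g"
  unfolding cf_rel_def
  by (erule (1) eventually_elim2) (auto simp: class_function_def)

lift_definition uminus_cf :: "'a cf \<Rightarrow> 'a cf" is "\<lambda>f N g. - f N g"
  unfolding cf_rel_def
  by (erule eventually_mono) (auto simp: class_function_def)

instance
proof
  show "(0 :: 'a cf) \<noteq> 1"
  proof transfer
    have "1\<^sub>m N \<in> carrier (GL N :: 'a mat monoid)" for N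
      using group.is_monoid [OF group_GL, THEN monoid.one_closed, of N] by simp
    hence "carrier (GL N :: 'a mat monoid) \<noteq> {}" for N
      by blast
    thus "\<not> cf_rel (\<lambda>_ _. 0) (\<lambda>_ (_ :: 'a mat). 1)"
      by (simp add: cf_rel_def)
  qed
qed (transfer, unfold cf_rel_def, (elim eventually_rev_mp)?, rule always_eventually,
    auto simp: class_function_def algebra_simps)+

end

lift_definition scale_cf :: "complex \<Rightarrow> 'a::{finite,field} cf \<Rightarrow> 'a cf" is
    "\<lambda>c f N g. c * f N g"
  unfolding cf_rel_def
  by (erule eventually_mono) (auto simp: class_function_def)

interpretation cf: vector_space "scale_cf :: complex \<Rightarrow> 'a::{finite,field} cf \<Rightarrow> 'a cf"
  by unfold_locales
    (transfer, unfold cf_rel_def, (elim eventually_rev_mp)?, rule always_eventually,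
    auto simp: class_function_def algebra_simps)+

lemma scale_cf_mult:
  fixes x y :: "'a::{finite,field} cf"
  shows "scale_cf c (x * y) = scale_cf c x * y" "scale_cf c (x * y) = x * scale_cf c y"
  by (transfer, unfold cf_rel_def, elim eventually_rev_mp, rule always_eventually,
    auto simp: class_function_def)+

section \<open>Counting full rank intertwiners\<close>

definition fr_count :: "nat \<Rightarrow> 'a::{finite,field} mat \<Rightarrow> nat \<Rightarrow> 'a mat \<Rightarrow> complex" where
  "fr_count m B N g =
     of_nat (card {M \<in> carrier_mat m N. M * g = B * M \<and> vec_space.rank m M = m})"

lemma rank_mult_GL:
  fixes M :: "'a::field mat"
  assumes M: "M \<in> carrier_mat m N" and h: "h \<in> carrier (GL N)"
  shows "vec_space.rank m (M * h) = vec_space.rank m M"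
proof -
  interpret vec_space "TYPE('a)" m .
  interpret GLN: group "GL N :: 'a mat monoid" by (rule group_GL)
  have le: "col_space (A * k) \<subseteq> col_space A"
    if A: "A \<in> carrier_mat m N" and k: "k \<in> carrier_mat N N" for A k :: "'a mat"
  proof -
    have Ak: "A * k \<in> carrier_mat m N" using A k by simp
    show ?thesis
      unfolding col_space_eq [OF A] col_space_eq [OF Ak]
      using A k by (auto intro!: bexI [of _ "k *\<^sub>v _"])
  qed
  have hm: "h \<in> carrier_mat N N" and hi: "inv\<^bsub>GL N\<^esub> h \<in> carrier_mat N N"
    using h by (auto intro: carrier_GL_mat)
  have "M * h * inv\<^bsub>GL N\<^esub> h = M * (h * inv\<^bsub>GL N\<^esub> h)"
    using M hm hi by (rule assoc_mult_mat)
  also have "h * inv\<^bsub>GL N\<^esub> h = 1\<^sub>m N" using GLN.r_inv [OF h] by simp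
  finally have "M * h * inv\<^bsub>GL N\<^esub> h = M" using M by simp
  with le [of "M * h" "inv\<^bsub>GL N\<^esub> h"] le [of M h] M hm hi
  have "col_space (M * h) = col_space M" by auto
  thus ?thesis by (simp add: rank_def col_space_def)
qed

lemma class_function_fr_count:
  fixes B :: "'a::{finite,field} mat"
  assumes B: "B \<in> carrier_mat m m"
  shows "class_function (GL N) (fr_count m B N)"
  unfolding class_function_def
proof (intro ballI)
  interpret GLN: group "GL N :: 'a mat monoid" by (rule group_GL)
  fix g h :: "'a mat" assume g: "g \<in> carrier (GL N)" and h: "h \<in> carrier (GL N)"
  define k where "k = inv\<^bsub>GL N\<^esub> h"
  have kG: "k \<in> carrier (GL N)" using h by (simp add: k_def)
  have hk: "h * k = 1\<^sub>m N" and kh: "k * h = 1\<^sub>m N"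
    using GLN.r_inv [OF h] GLN.l_inv [OF h] by (simp_all add: k_def)
  note c = carrier_GL_mat [OF g] carrier_GL_mat [OF h] carrier_GL_mat [OF kG]
  have Mhk: "M * h * k = M" "M * k * h = M" if "M \<in> carrier_mat m N" for M
    using that c hk kh by (simp_all add: assoc_mult_mat [of _ m N _ N _ N])
  let ?S = "\<lambda>x. {M \<in> carrier_mat m N. M * x = B * M \<and> vec_space.rank m M = m}"
  have "bij_betw (\<lambda>M. M * h) (?S (h * g * k)) (?S g)"
  proof (rule bij_betw_byWitness [where f' = "\<lambda>M. M * k"])
    show "(\<lambda>M. M * h) ` ?S (h * g * k) \<subseteq> ?S g"
    proof clarify
      fix M assume M: "M \<in> carrier_mat m N" and eq: "M * (h * g * k) = B * M"
        and r: "vec_space.rank m M = m"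
      have "M * h * g = M * h * g * k * h"
        using M c kh by (simp add: assoc_mult_mat [of _ m N k N h N])
      also have "\<dots> = M * (h * g * k) * h"
        using M c by (simp add: assoc_mult_mat [of _ m N _ N _ N] assoc_mult_mat [of _ N N _ N _ N])
      also have "\<dots> = B * (M * h)"
        unfolding eq using M B c by (simp add: assoc_mult_mat [of B m m])
      finally show "M * h \<in> carrier_mat m N \<and> M * h * g = B * (M * h) \<and> vec_space.rank m (M * h) = m"
        using M c r by (simp add: rank_mult_GL [OF M h])
    qed
    show "(\<lambda>M. M * k) ` ?S g \<subseteq> ?S (h * g * k)"
    proof clarify
      fix M assume M: "M \<in> carrier_mat m N" and eq: "M * g = B * M"
        and r: "vec_space.rank m M = m"
      have "M * k * (h * g * k) = M * k * h * (g * k)"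
        using M c by (simp add: assoc_mult_mat [of _ m N _ N _ N] assoc_mult_mat [of _ N N _ N _ N])
      also have "\<dots> = M * g * k"
        using M c by (simp add: Mhk kh assoc_mult_mat [of _ m N _ N _ N])
      also have "\<dots> = B * (M * k)"
        using M B c by (simp add: eq assoc_mult_mat [of B m m])
      finally show "M * k \<in> carrier_mat m N \<and> M * k * (h * g * k) = B * (M * k) \<and> vec_space.rank m (M * k) = m"
        using M c r by (simp add: rank_mult_GL [OF M kG])
    qed
  qed (use Mhk in auto)
  hence "card (?S (h * g * k)) = card (?S g)" by (rule bij_betw_same_card)
  thus "fr_count m B N (h \<otimes>\<^bsub>GL N\<^esub> g \<otimes>\<^bsub>GL N\<^esub> inv\<^bsub>GL N\<^esub> h) = fr_count m B N g"
    by (simp add: fr_count_def k_def)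
qed

lemma cf_rel_fr_count: "B \<in> carrier_mat m m \<Longrightarrow> cf_rel (fr_count m B) (fr_count m B)"
  by (simp add: cf_rel_def class_function_fr_count)

text \<open>\<open>abs_cf\<close> is meaningful only on families that are \<open>cf_rel\<close>-related to themselves,
  which the preceding lemma guarantees for \<open>B\<close> in \<open>GL m\<close>.\<close>

definition fr :: "nat \<Rightarrow> 'a::{finite,field} mat \<Rightarrow> 'a cf" where
  "fr m B = abs_cf (fr_count m B)"

definition Rfr :: "nat \<Rightarrow> 'a::{finite,field} cf set" where
  "Rfr m = cf.span (fr m ` carrier (GL m))"

section \<open>Parabolic induction\<close>

definition parabolic :: "nat \<Rightarrow> nat \<Rightarrow> 'a::field mat set" where
  "parabolic m r =
     {four_block_mat g11 g12 (0\<^sub>m r m) g22 | g11 g12 g22.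
        g11 \<in> carrier (GL m) \<and> g12 \<in> carrier_mat m r \<and> g22 \<in> carrier (GL r)}"

definition parabolic_ind ::
    "nat \<Rightarrow> nat \<Rightarrow> ('a::field mat \<Rightarrow> complex) \<Rightarrow> ('a mat \<Rightarrow> complex) \<Rightarrow> 'a mat \<Rightarrow> complex" where
  "parabolic_ind m r \<chi>1 \<chi>2 =
     induced (GL (m + r)) (parabolic m r)
       (\<lambda>A. case split_block A m m of (g11, g12, g21, g22) \<Rightarrow> \<chi>1 g11 * \<chi>2 g22)"

text \<open>The value for \<open>N < m\<close> does not affect the class in \<open>'a cf\<close>.\<close>

definition circ_one_fun ::
    "nat \<Rightarrow> ('a::{finite,field} mat \<Rightarrow> complex) \<Rightarrow> nat \<Rightarrow> 'a mat \<Rightarrow> complex" where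
  "circ_one_fun m \<chi> N g = (if m \<le> N then parabolic_ind m (N - m) \<chi> (\<lambda>_. 1) g else 0)"

lemma class_function_circ_one_fun: "class_function (GL N) (circ_one_fun m \<chi> N)"
proof (cases "m \<le> N")
  case True
  thus ?thesis
    using class_function_induced [OF group_GL, of N]
    by (simp add: circ_one_fun_def [abs_def] parabolic_ind_def [abs_def])
qed (simp add: circ_one_fun_def [abs_def] class_function_def)

lemma cf_rel_circ_one_fun: "cf_rel (circ_one_fun m \<chi>) (circ_one_fun m \<chi>)"
  by (simp add: cf_rel_def class_function_circ_one_fun)

definition circ_one :: "nat \<Rightarrow> ('a::{finite,field} mat \<Rightarrow> complex) \<Rightarrow> 'a cf" where
  "circ_one m \<chi> = abs_cf (circ_one_fun m \<chi>)"

definition Pspan :: "nat \<Rightarrow> 'a::{finite,field} cf set" where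
  "Pspan m = cf.span (circ_one m ` IrrChar (GL m :: 'a mat monoid))"

end

theory Submission
  imports Defs "Jordan_Normal_Form.Schur_Decomposition" "HOL-Algebra.Multiplicative_Group"
begin

text \<open>Everything is expressed through numbers of intertwiners, that is, of matrices \<open>M\<close> with
\<open>M * C = B * M\<close>.

\<^bold>\<open>The first formula.\<close> The value of \<open>\<chi> \<circ> 1\<close> at \<open>g\<close> is a sum over those \<open>x\<close> in \<open>GL N\<close> for which
\<open>x\<inverse> g x\<close> is parabolic. This condition, and the upper left corner \<open>B\<close> at which \<open>\<chi>\<close> is evaluated,
depend only on the matrix \<open>X\<close> of the first \<open>m\<close> columns of \<open>x\<close>: they say that \<open>g X = X B\<close>. Every
injective \<open>X\<close> extends to an invertible \<open>x\<close> in the same number of ways (\<open>card_frames\<close>), so that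
\<open>\<chi> \<circ> 1\<close> is the average of \<open>\<chi> B\<close> times the number of injective \<open>X\<close> with \<open>g X = X B\<close>. In contrast, \<open>fr_count\<close>
counts the surjective \<open>M\<close> with \<open>M g = B M\<close>. The two numbers agree (\<open>card_surj_eq_card_inj\<close>).
Without the rank condition, the two sets are the kernels of
\<open>M \<mapsto> M g - B M\<close> and \<open>X \<mapsto> g X - X B\<close>, which are adjoint for the trace form and therefore have kernels of
the same size. An intertwiner of rank \<open>j\<close> is the product of a surjective and an injective intertwiner
through some \<open>j\<close> by \<open>j\<close> matrix \<open>D\<close>, so induction on the size of \<open>B\<close> shows that all smaller ranks
contribute equally on both sides; hence so does the full rank. This gives the first formula, for
arbitrary functions \<open>\<chi>\<close> (\<open>circ_one_eq_sum_fr\<close>).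

\<^bold>\<open>The second formula.\<close> It inverts the first one by the column orthogonality of irreducible characters.
Row orthogonality is Schur's lemma. Column orthogonality follows from completeness
(\<open>class_function_eq_0\<close>): a class function \<open>f\<close> that is orthogonal to all irreducible characters acts as
zero in every irreducible representation. If \<open>f\<close> were not zero, the convolution of \<open>f\<close> with its adjoint
would act on the regular representation with nonzero trace, hence with a nonzero eigenvalue; a
nonzero invariant subspace of least dimension in the eigenspace is an irreducible representation on which
the action is not zero, a contradiction.

\<^bold>\<open>Independence.\<close> For infinitely many \<open>r\<close> there is \<open>h\<close> in \<open>GL r\<close> that has no nonzero intertwiner with any
element of \<open>GL m\<close> (\<open>generic_no_intertwiner\<close>). At the block sum of \<open>B'\<close> and \<open>h\<close>, \<open>fr m B\<close> counts the
\<open>x\<close> in \<open>GL m\<close> with \<open>x B' = B x\<close>, and \<open>\<chi> \<circ> 1\<close> takes the value \<open>\<chi> B'\<close>. Both families are then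
independent because conjugacy classes are disjoint and irreducible characters are independent.\<close>

section \<open>Matrices with a one-sided inverse\<close>

text \<open>Injectivity and surjectivity are recorded by one-sided inverses, which makes all later
cancellations equational and works for every field.\<close>

definition inj_mats :: "nat \<Rightarrow> nat \<Rightarrow> 'k::field mat set" where
  "inj_mats n k = {X \<in> carrier_mat n k. \<exists>L\<in>carrier_mat k n. L * X = 1\<^sub>m k}"

definition surj_mats :: "nat \<Rightarrow> nat \<Rightarrow> 'k::field mat set" where
  "surj_mats k n = {Y \<in> carrier_mat k n. \<exists>R\<in>carrier_mat n k. Y * R = 1\<^sub>m k}"

lemma carrier_GL_iff_left_inverse:
  "A \<in> carrier (GL n) \<longleftrightarrow> A \<in> carrier_mat n n \<and> (\<exists>B\<in>carrier_mat n n. B * A = 1\<^sub>m n)"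
proof
  assume A: "A \<in> carrier (GL n)"
  interpret group "GL n :: 'a mat monoid" by (rule group_GL)
  show "A \<in> carrier_mat n n \<and> (\<exists>B\<in>carrier_mat n n. B * A = 1\<^sub>m n)"
    using A l_inv [OF A] carrier_GL_mat [OF inv_closed [OF A]] carrier_GL_mat [OF A] by auto
next
  assume A: "A \<in> carrier_mat n n \<and> (\<exists>B\<in>carrier_mat n n. B * A = 1\<^sub>m n)"
  then obtain B where B: "B \<in> carrier_mat n n" and BA: "B * A = 1\<^sub>m n" by blast
  have "A * B = 1\<^sub>m n" using mat_mult_left_right_inverse [OF B _ BA] A by blast
  thus "A \<in> carrier (GL n)"
    using A B BA unfolding carrier_GL invertible_mat_def inverts_mat_def by auto
qed

lemma inj_mats_square: "inj_mats n n = carrier (GL n)"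
  by (auto simp: inj_mats_def carrier_GL_iff_left_inverse)

lemma surj_mats_square: "(surj_mats n n :: 'k::field mat set) = carrier (GL n)"
proof (intro equalityI subsetI)
  fix A :: "'k mat" assume "A \<in> surj_mats n n"
  then obtain R where "A \<in> carrier_mat n n" "R \<in> carrier_mat n n" "A * R = 1\<^sub>m n"
    by (auto simp: surj_mats_def)
  thus "A \<in> carrier (GL n)"
    using mat_mult_left_right_inverse by (auto simp: carrier_GL_iff_left_inverse)
next
  fix A :: "'k mat" assume "A \<in> carrier (GL n)"
  then obtain B where "A \<in> carrier_mat n n" "B \<in> carrier_mat n n" "B * A = 1\<^sub>m n"
    by (auto simp: carrier_GL_iff_left_inverse)
  thus "A \<in> surj_mats n n"
    using mat_mult_left_right_inverse [of B n A] by (auto simp: surj_mats_def)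
qed

lemma inj_mats_le:
  assumes "X \<in> inj_mats n k"
  shows "k \<le> n"
proof (rule ccontr)
  assume "\<not> k \<le> n"
  hence nk: "n < k" by simp
  from assms obtain L where X: "X \<in> carrier_mat n k" and L: "L \<in> carrier_mat k n"
    and LX: "L * X = 1\<^sub>m k" by (auto simp: inj_mats_def)
  \<comment> \<open>Padding both factors to square matrices makes \<open>L' X' = 1\<close> but leaves a zero row in \<open>X'\<close>.\<close>
  define X' where "X' = mat k k (\<lambda>(i, j). if i < n then X $$ (i, j) else 0)"
  define L' where "L' = mat k k (\<lambda>(i, j). if j < n then L $$ (i, j) else 0)"
  have dims: "X' \<in> carrier_mat k k" "L' \<in> carrier_mat k k" by (simp_all add: X'_def L'_def)
  have "L' * X' = L * X"
  proof (rule eq_matI)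
    fix i j assume "i < dim_row (L * X)" and "j < dim_col (L * X)"
    hence i: "i < k" and j: "j < k" using L X by auto
    have "(L' * X') $$ (i, j) = (\<Sum>p = 0..<k. L' $$ (i, p) * X' $$ (p, j))"
      using i j dims by (simp add: scalar_prod_def)
    also have "\<dots> = (\<Sum>p = 0..<n. L $$ (i, p) * X $$ (p, j))"
      using i j nk by (intro sum.mono_neutral_cong_right) (auto simp: X'_def L'_def)
    also have "\<dots> = (L * X) $$ (i, j)"
      using i j L X by (simp add: scalar_prod_def)
    finally show "(L' * X') $$ (i, j) = (L * X) $$ (i, j)" .
  qed (use L X dims in auto)
  hence "X' * L' = 1\<^sub>m k"
    using mat_mult_left_right_inverse dims LX by metis
  hence "(X' * L') $$ (n, n) = 1" using nk by simp
  moreover have "row X' n = 0\<^sub>v k" using nk by (auto simp: X'_def)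
  ultimately show False using nk dims by simp
qed

lemma transpose_inj_mats: "X \<in> inj_mats n k \<longleftrightarrow> X\<^sup>T \<in> surj_mats k n"
proof
  assume "X \<in> inj_mats n k"
  then obtain L where "X \<in> carrier_mat n k" "L \<in> carrier_mat k n" "L * X = 1\<^sub>m k"
    by (auto simp: inj_mats_def)
  thus "X\<^sup>T \<in> surj_mats k n"
    unfolding surj_mats_def by (auto simp flip: transpose_mult intro!: bexI [of _ "L\<^sup>T"])
next
  assume "X\<^sup>T \<in> surj_mats k n"
  then obtain R
    where X: "X\<^sup>T \<in> carrier_mat k n" and R: "R \<in> carrier_mat n k"
      and XR: "X\<^sup>T * R = 1\<^sub>m k"
    by (auto simp: surj_mats_def)
  hence X': "X \<in> carrier_mat n k" by (metis transpose_carrier_mat)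
  have "R\<^sup>T * X = (X\<^sup>T * R)\<^sup>T" using X R by (simp add: transpose_mult)
  with XR X' R show "X \<in> inj_mats n k"
    unfolding inj_mats_def by (auto intro!: bexI [of _ "R\<^sup>T"])
qed

lemma left_inverse_cancel:
  assumes X: "(X :: 'k::field mat) \<in> carrier_mat n k" and L: "L \<in> carrier_mat k n"
    and LX: "L * X = 1\<^sub>m k"
    and A: "A \<in> carrier_mat k m"
  shows "L * (X * A) = A"
  by (simp only: assoc_mult_mat [OF L X A, symmetric] LX left_mult_one_mat [OF A])

lemma inj_mats_left_cancel:
  assumes X: "X \<in> inj_mats n k" and A: "A \<in> carrier_mat k m" and B: "B \<in> carrier_mat k m"
    and eq: "X * A = X * B"
  shows "A = B"
proof -
  from X obtain L where L: "X \<in> carrier_mat n k" "L \<in> carrier_mat k n" "L * X = 1\<^sub>m k"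
    by (auto simp: inj_mats_def)
  have "A = L * (X * A)" by (rule left_inverse_cancel [OF L A, symmetric])
  also have "\<dots> = B" unfolding eq by (rule left_inverse_cancel [OF L B])
  finally show ?thesis .
qed

lemma inj_mats_mult:
  assumes X: "X \<in> inj_mats n d" and Y: "Y \<in> inj_mats d k"
  shows "X * Y \<in> inj_mats n k"
proof -
  from X obtain L where L: "X \<in> carrier_mat n d" "L \<in> carrier_mat d n" "L * X = 1\<^sub>m d"
    by (auto simp: inj_mats_def)
  from Y obtain K where K: "Y \<in> carrier_mat d k" "K \<in> carrier_mat k d" "K * Y = 1\<^sub>m k"
    by (auto simp: inj_mats_def)
  have "(K * L) * (X * Y) = K * (L * (X * Y))"
    by (rule assoc_mult_mat [OF K(2) L(2) mult_carrier_mat [OF L(1) K(1)]])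
  also have "\<dots> = 1\<^sub>m k" unfolding left_inverse_cancel [OF L K(1)] by (rule K(3))
  finally show ?thesis
    unfolding inj_mats_def using mult_carrier_mat [OF L(1) K(1)] mult_carrier_mat [OF K(2) L(2)] by blast
qed

lemma surj_mats_transpose: "Y \<in> surj_mats k n \<longleftrightarrow> Y\<^sup>T \<in> inj_mats n k"
  using transpose_inj_mats [of "Y\<^sup>T" n k] by simp

lemma inj_matsD: "X \<in> inj_mats n k \<Longrightarrow> X \<in> carrier_mat n k"
  by (simp add: inj_mats_def)

lemma surj_matsD: "Y \<in> surj_mats k n \<Longrightarrow> Y \<in> carrier_mat k n"
  by (simp add: surj_mats_def)

lemma surj_mats_mult:
  assumes X: "X \<in> surj_mats n d" and Y: "Y \<in> surj_mats d k"
  shows "X * Y \<in> surj_mats n k"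
  unfolding surj_mats_transpose transpose_mult [OF surj_matsD [OF X] surj_matsD [OF Y]]
  using Y X unfolding surj_mats_transpose by (rule inj_mats_mult)

lemma surj_mats_right_cancel:
  assumes Y: "Y \<in> surj_mats k n" and A: "A \<in> carrier_mat m k" and B: "B \<in> carrier_mat m k"
    and eq: "A * Y = B * Y"
  shows "A = B"
proof -
  have "Y\<^sup>T * A\<^sup>T = Y\<^sup>T * B\<^sup>T"
    using arg_cong [OF eq, of transpose_mat]
    by (simp only: transpose_mult [OF A surj_matsD [OF Y]] transpose_mult [OF B surj_matsD [OF Y]])
  moreover have "Y\<^sup>T \<in> inj_mats n k" using Y unfolding surj_mats_transpose .
  moreover have "A\<^sup>T \<in> carrier_mat k m" "B\<^sup>T \<in> carrier_mat k m" using A B by auto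
  ultimately have "A\<^sup>T = B\<^sup>T" using inj_mats_left_cancel by blast
  from arg_cong [OF this, of transpose_mat] show ?thesis by simp
qed

lemma surj_mats_le: "Y \<in> surj_mats k n \<Longrightarrow> k \<le> n"
  unfolding surj_mats_transpose by (rule inj_mats_le)

section \<open>Bases of subspaces as matrices\<close>

text \<open>Subspaces of \<open>K\<^sup>n\<close> spelled out in terms of vectors, to avoid the records of the abstract theory
of modules.\<close>

definition lin_closed :: "nat \<Rightarrow> 'k::field vec set \<Rightarrow> bool" where
  "lin_closed n W \<longleftrightarrow> W \<subseteq> carrier_vec n \<and> 0\<^sub>v n \<in> W \<and>
     (\<forall>v\<in>W. \<forall>w\<in>W. v + w \<in> W) \<and> (\<forall>c. \<forall>v\<in>W. c \<cdot>\<^sub>v v \<in> W)"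

lemma subspace_iff_lin_closed:
  "VectorSpace.subspace class_ring W (module_vec TYPE('k::field) n) \<longleftrightarrow> lin_closed n W"
proof -
  interpret V: vec_space "TYPE('k)" n .
  show ?thesis
    unfolding VectorSpace.subspace_def submodule_def lin_closed_def
    using V.vectorspace_axioms V.module_axioms
    by (auto simp: module_vec_simps class_ring_simps)
qed

lemma lin_closed_image:
  assumes "A \<in> carrier_mat n k"
  shows "lin_closed n {A *\<^sub>v v | v. v \<in> carrier_vec k}"
  unfolding lin_closed_def
proof (intro conjI ballI allI)
  show "0\<^sub>v n \<in> {A *\<^sub>v v | v. v \<in> carrier_vec k}"
    using assms by (auto intro!: exI [of _ "0\<^sub>v k"])
next
  fix v w assume "v \<in> {A *\<^sub>v v | v. v \<in> carrier_vec k}" "w \<in> {A *\<^sub>v v | v. v \<in> carrier_vec k}"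
  then obtain v' w'
    where "v = A *\<^sub>v v'" "w = A *\<^sub>v w'" "v' \<in> carrier_vec k" "w' \<in> carrier_vec k"
    by blast
  thus "v + w \<in> {A *\<^sub>v v | v. v \<in> carrier_vec k}"
    using mult_add_distrib_mat_vec [OF assms, of v' w'] by (auto intro!: exI [of _ "v' + w'"])
next
  fix c v assume "v \<in> {A *\<^sub>v v | v. v \<in> carrier_vec k}"
  then obtain v' where "v = A *\<^sub>v v'" "v' \<in> carrier_vec k" by blast
  thus "c \<cdot>\<^sub>v v \<in> {A *\<^sub>v v | v. v \<in> carrier_vec k}"
    using mult_mat_vec [OF assms, of v' c] by (auto intro!: exI [of _ "c \<cdot>\<^sub>v v'"])
qed (use assms in auto)

lemma lin_closed_kernel:
  assumes A: "A \<in> carrier_mat n k"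
  shows "lin_closed k {v \<in> carrier_vec k. A *\<^sub>v v = 0\<^sub>v n}"
  unfolding lin_closed_def
proof (intro conjI ballI allI)
  show "0\<^sub>v k \<in> {v \<in> carrier_vec k. A *\<^sub>v v = 0\<^sub>v n}" using A by auto
next
  fix v w assume "v \<in> {v \<in> carrier_vec k. A *\<^sub>v v = 0\<^sub>v n}" "w \<in> {v \<in> carrier_vec k. A *\<^sub>v v = 0\<^sub>v n}"
  thus "v + w \<in> {v \<in> carrier_vec k. A *\<^sub>v v = 0\<^sub>v n}"
    using mult_add_distrib_mat_vec [OF A, of v w] by simp
next
  fix c v assume "v \<in> {v \<in> carrier_vec k. A *\<^sub>v v = 0\<^sub>v n}"
  thus "c \<cdot>\<^sub>v v \<in> {v \<in> carrier_vec k. A *\<^sub>v v = 0\<^sub>v n}"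
    using mult_mat_vec [OF A, of v c] by auto
qed auto

lemma inj_mats_kernel:
  assumes X: "X \<in> inj_mats n k" and v: "v \<in> carrier_vec k" and 0: "X *\<^sub>v v = 0\<^sub>v n"
  shows "v = 0\<^sub>v k"
proof -
  from X obtain L where "X \<in> carrier_mat n k" "L \<in> carrier_mat k n" "L * X = 1\<^sub>m k"
    by (auto simp: inj_mats_def)
  hence "v = L *\<^sub>v (X *\<^sub>v v)" using v by (metis assoc_mult_mat_vec one_mult_mat_vec)
  also have "\<dots> = 0\<^sub>v k" using \<open>L \<in> carrier_mat k n\<close> by (auto simp: 0)
  finally show ?thesis .
qed

text \<open>How a matrix with a left inverse is enlarged by one column: the new row \<open>u\<close> of the left inverse
has to be dual to the new column \<open>w\<close> and orthogonal to the old ones.\<close>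

lemma mat_of_cols_snoc_mult:
  assumes Y: "(Y :: 'k::field mat) \<in> carrier_mat n d" and L: "L \<in> carrier_mat d n"
    and u: "u \<in> carrier_vec n"
    and w: "w \<in> carrier_vec n"
    and LY: "L * Y = 1\<^sub>m d" and Lw: "L *\<^sub>v w = 0\<^sub>v d"
      and uY: "Y\<^sup>T *\<^sub>v u = 0\<^sub>v d" and uw: "u \<bullet> w = 1"
  shows "mat_of_rows n (rows L @ [u]) * mat_of_cols n (cols Y @ [w]) = 1\<^sub>m (Suc d)"
proof (rule eq_matI)
  fix i j assume "i < dim_row (1\<^sub>m (Suc d) :: 'k mat)" "j < dim_col (1\<^sub>m (Suc d) :: 'k mat)"
  hence i: "i < Suc d" and j: "j < Suc d" by simp_all
  have r: "row (mat_of_rows n (rows L @ [u])) i = (if i < d then row L i else u)"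
    using i L u by (subst mat_of_rows_row) (auto simp: nth_append rows_def)
  have c: "col (mat_of_cols n (cols Y @ [w])) j = (if j < d then col Y j else w)"
    using j Y w by (subst col_mat_of_cols) (auto simp: nth_append cols_def)
  have 1: "row L i \<bullet> col Y j = 1\<^sub>m d $$ (i, j)" if "i < d" "j < d"
    using that L Y LY by (metis index_mult_mat(1) carrier_matD)
  have 2: "row L i \<bullet> w = 0" if "i < d"
    using that L Lw by (metis index_mult_mat_vec carrier_matD(1) index_zero_vec(1))
  have 3: "u \<bullet> col Y j = 0" if "j < d"
  proof -
    have "col Y j \<bullet> u = (Y\<^sup>T *\<^sub>v u) $ j" using that Y by simp
    thus ?thesis using that Y u by (simp add: uY comm_scalar_prod [of u n])
  qed
  show "(mat_of_rows n (rows L @ [u]) * mat_of_cols n (cols Y @ [w])) $$ (i, j) = 1\<^sub>m (Suc d) $$ (i, j)"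
    using i j L Y by (cases "i < d"; cases "j < d") (simp_all add: r c 1 2 3 uw)
qed (use L Y in auto)

lemma exists_dual_vector:
  assumes w: "w \<in> carrier_vec n" and "w \<noteq> 0\<^sub>v n"
  shows "\<exists>u\<in>carrier_vec n. u \<bullet> w = (1::'k::field)"
proof -
  from assms obtain i
    where i: "i < n" and wi: "w $ i \<noteq> 0" by (metis eq_vecI carrier_vecD index_zero_vec)
  have "((1 / w $ i) \<cdot>\<^sub>v unit_vec n i) \<bullet> w = 1"
    using i w wi by simp
  thus ?thesis by (intro bexI) auto
qed

text \<open>Basis extension. The columns of \<open>Y\<close> are independent vectors in \<open>W\<close>; as long as they do not span
\<open>W\<close>, a vector of \<open>W\<close> outside the image supplies one more column. The bound on the number of columns
of an injective matrix makes this process stop.\<close>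

lemma extend_basis_matrix:
  fixes W :: "'k::field vec set"
  assumes W: "lin_closed n W" and Y: "Y \<in> inj_mats n d"
    and YW: "\<And>v. v \<in> carrier_vec d \<Longrightarrow> Y *\<^sub>v v \<in> W"
  shows "\<exists>d'\<ge>d. \<exists>Y'\<in>inj_mats n d'. W = {Y' *\<^sub>v v | v. v \<in> carrier_vec d'} \<and>
    (\<forall>j<d. col Y' j = col Y j)"
  using Y YW
proof (induction "n - d" arbitrary: d Y rule: less_induct)
  case less
  from less.prems(1) obtain L where Yc: "Y \<in> carrier_mat n d" and L: "L \<in> carrier_mat d n"
    and LY: "L * Y = 1\<^sub>m d" by (auto simp: inj_mats_def)
  note YW = less.prems(2)
  show ?case
  proof (cases "W = {Y *\<^sub>v v | v. v \<in> carrier_vec d}")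
    case True
    thus ?thesis using less.prems(1) by (intro exI [of _ d] conjI bexI [of _ Y]) auto
  next
    case False
    then obtain w
      where w: "w \<in> W" and nw: "\<And>v. v \<in> carrier_vec d \<Longrightarrow> w \<noteq> Y *\<^sub>v v"
        using YW by blast
    have wc: "w \<in> carrier_vec n" using w W by (auto simp: lin_closed_def)
    \<comment> \<open>Subtracting from \<open>w\<close> its projection to the image of \<open>Y\<close> keeps the left inverse simple.\<close>
    define w' where "w' = w - Y *\<^sub>v (L *\<^sub>v w)"
    have Lw: "L *\<^sub>v w \<in> carrier_vec d" using L wc by simp
    have w'c: "w' \<in> carrier_vec n" using wc Yc Lw by (simp add: w'_def)
    have "w' = w + (-1) \<cdot>\<^sub>v (Y *\<^sub>v (L *\<^sub>v w))" using wc Yc Lw by (auto simp: w'_def)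
    hence w'W: "w' \<in> W" using w YW [OF Lw] W by (simp add: lin_closed_def)
    have Lw': "L *\<^sub>v w' = 0\<^sub>v d"
    proof -
      have "L *\<^sub>v w' = L *\<^sub>v w - L *\<^sub>v (Y *\<^sub>v (L *\<^sub>v w))"
        using L wc Yc by (simp add: w'_def mult_minus_distrib_mat_vec)
      also have "L *\<^sub>v (Y *\<^sub>v (L *\<^sub>v w)) = (L * Y) *\<^sub>v (L *\<^sub>v w)"
        using L wc Yc by simp
      also have "\<dots> = L *\<^sub>v w" using Lw by (simp add: LY)
      finally show ?thesis using Lw by simp
    qed
    have "w = Y *\<^sub>v (L *\<^sub>v w) + w'" using wc Yc Lw by (auto simp: w'_def)
    hence "w' \<noteq> 0\<^sub>v n"
      using nw [OF Lw] right_zero_vec [OF mult_mat_vec_carrier [OF Yc Lw]] by auto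
    then obtain u where u: "u \<in> carrier_vec n" and uw: "u \<bullet> w' = 1"
      using exists_dual_vector [OF w'c] by blast
    \<comment> \<open>Removing from \<open>u\<close> its part on the image of \<open>Y\<close> makes it vanish there and keeps its value at \<open>w'\<close>.\<close>
    define u' where "u' = u - L\<^sup>T *\<^sub>v (Y\<^sup>T *\<^sub>v u)"
    have Yu: "Y\<^sup>T *\<^sub>v u \<in> carrier_vec d" using Yc u by simp
    have u'c: "u' \<in> carrier_vec n" using u L Yu by (simp add: u'_def)
    have "Y\<^sup>T *\<^sub>v u' = Y\<^sup>T *\<^sub>v u - (Y\<^sup>T * L\<^sup>T) *\<^sub>v (Y\<^sup>T *\<^sub>v u)"
      using L Yc u by (simp add: u'_def mult_minus_distrib_mat_vec)
    also have "Y\<^sup>T * L\<^sup>T = 1\<^sub>m d" using L Yc LY by (metis transpose_mult transpose_one)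
    finally have Yu': "Y\<^sup>T *\<^sub>v u' = 0\<^sub>v d" using Yu by simp
    have "(L\<^sup>T *\<^sub>v (Y\<^sup>T *\<^sub>v u)) \<bullet> w' = (Y\<^sup>T *\<^sub>v u) \<bullet> (L *\<^sub>v w')"
      using L Yu w'c by (simp add: transpose_vec_mult_scalar)
    hence u'w': "u' \<bullet> w' = 1"
      using u L Yu w'c uw Lw' by (simp add: u'_def minus_scalar_prod_distrib)
    define Y1 where "Y1 = mat_of_cols n (cols Y @ [w'])"
    have Y1c: "Y1 \<in> carrier_mat n (Suc d)" unfolding Y1_def using Yc by (intro carrier_matI) auto
    have "mat_of_rows n (rows L @ [u']) \<in> carrier_mat (Suc d) n" using L by (intro carrier_matI) auto
    moreover have "mat_of_rows n (rows L @ [u']) * Y1 = 1\<^sub>m (Suc d)"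
      unfolding Y1_def by (rule mat_of_cols_snoc_mult) fact+
    ultimately have Y1: "Y1 \<in> inj_mats n (Suc d)"
      using Y1c unfolding inj_mats_def by blast
    have cols: "col Y1 j = (if j < d then col Y j else w')" if "j < Suc d" for j
      using that Yc w'c unfolding Y1_def by (subst col_mat_of_cols) (auto simp: nth_append cols_def)
    have "Y1 *\<^sub>v v \<in> W" if v: "v \<in> carrier_vec (Suc d)" for v
    proof -
      have "Y1 *\<^sub>v v = Y *\<^sub>v (vec d (\<lambda>i. v $ i)) + v $ d \<cdot>\<^sub>v w'"
      proof (rule eq_vecI)
        fix i assume "i < dim_vec (Y *\<^sub>v (vec d (\<lambda>i. v $ i)) + v $ d \<cdot>\<^sub>v w')"
        hence i: "i < n" using w'c by simp
        have e: "Y1 $$ (i, j) = (if j < d then Y $$ (i, j) else w' $ i)" if "j < Suc d" for j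
        proof -
          have "Y1 $$ (i, j) = col Y1 j $ i" using that i Y1c by simp
          thus ?thesis using cols [OF that] that i Yc by simp
        qed
        have "(Y1 *\<^sub>v v) $ i = (\<Sum>j = 0..<Suc d. Y1 $$ (i, j) * v $ j)"
          using i v Y1c by (simp add: scalar_prod_def)
        also have "\<dots> = (\<Sum>j = 0..<d. Y $$ (i, j) * v $ j) + w' $ i * v $ d"
          by (simp add: e)
        finally show "(Y1 *\<^sub>v v) $ i = (Y *\<^sub>v (vec d (\<lambda>i. v $ i)) + v $ d \<cdot>\<^sub>v w') $ i"
          using i Yc w'c by (simp add: scalar_prod_def)
      qed (use Y1c w'c in auto)
      thus ?thesis using W w'W YW [of "vec d (\<lambda>i. v $ i)"] by (simp add: lin_closed_def)
    qed
    moreover have "n - Suc d < n - d" using inj_mats_le [OF Y1] by simp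
    ultimately have "\<exists>d'\<ge>Suc d. \<exists>Y'\<in>inj_mats n d'. W = {Y' *\<^sub>v v | v. v \<in> carrier_vec d'} \<and>
        (\<forall>j<Suc d. col Y' j = col Y1 j)"
      using less.hyps [OF _ Y1] by simp
    then obtain d' Y' where "d' \<ge> Suc d" "Y' \<in> inj_mats n d'"
      "W = {Y' *\<^sub>v v | v. v \<in> carrier_vec d'}" "\<forall>j<Suc d. col Y' j = col Y1 j"
      by (elim exE conjE bexE)
    thus ?thesis using cols by (intro exI [of _ d'] conjI bexI [of _ Y']) simp_all
  qed
qed

lemma obtain_basis_matrix:
  fixes W :: "'k::field vec set"
  assumes "lin_closed n W"
  obtains d Y where "Y \<in> inj_mats n d" "W = {Y *\<^sub>v v | v. v \<in> carrier_vec d}"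
proof -
  have 0: "0\<^sub>m n 0 \<in> inj_mats n 0"
    by (auto simp: inj_mats_def intro!: bexI [of _ "0\<^sub>m 0 n"] eq_matI)
  have 1: "0\<^sub>m n 0 *\<^sub>v v \<in> W" if "v \<in> carrier_vec 0" for v
  proof -
    have "0\<^sub>m n 0 *\<^sub>v v = 0\<^sub>v n" using that by (auto simp: scalar_prod_def)
    thus ?thesis using assms by (simp add: lin_closed_def)
  qed
  show ?thesis
    using extend_basis_matrix [OF assms 0 1, simplified] by (elim exE conjE bexE) (rule that)
qed

lemma surj_mats_iff:
  assumes A: "(A :: 'k::field mat) \<in> carrier_mat n k"
  shows "A \<in> surj_mats n k \<longleftrightarrow> {A *\<^sub>v v | v. v \<in> carrier_vec k} = carrier_vec n"
proof
  assume "A \<in> surj_mats n k"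
  then obtain R where R: "R \<in> carrier_mat k n" and AR: "A * R = 1\<^sub>m n" by (auto simp: surj_mats_def)
  have "w = A *\<^sub>v (R *\<^sub>v w)" if "w \<in> carrier_vec n" for w
    using that A R AR by (metis assoc_mult_mat_vec one_mult_mat_vec)
  thus "{A *\<^sub>v v | v. v \<in> carrier_vec k} = carrier_vec n"
    using A R by (auto intro!: exI [of _ "R *\<^sub>v _"])
next
  assume *: "{A *\<^sub>v v | v. v \<in> carrier_vec k} = carrier_vec n"
  have "\<exists>v. v \<in> carrier_vec k \<and> A *\<^sub>v v = unit_vec n i" for i
  proof -
    have "unit_vec n i \<in> {A *\<^sub>v v | v. v \<in> carrier_vec k}" unfolding * by simp
    thus ?thesis by auto
  qed
  then obtain r where r: "\<And>i. r i \<in> carrier_vec k" "\<And>i. A *\<^sub>v r i = unit_vec n i" by metis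
  define R where "R = mat_of_cols k (map r [0..<n])"
  have R: "R \<in> carrier_mat k n" unfolding R_def by (intro carrier_matI) auto
  have "A * R = 1\<^sub>m n"
  proof (rule mat_col_eqI)
    fix i assume "i < dim_col (1\<^sub>m n :: 'k mat)"
    hence i: "i < n" by simp
    have "col R i = r i" using i r unfolding R_def by (subst col_mat_of_cols) auto
    thus "col (A * R) i = col (1\<^sub>m n) i" unfolding col_mult2 [OF A R i] using i r by simp
  qed (use A R in auto)
  with A R show "A \<in> surj_mats n k" by (auto simp: surj_mats_def)
qed

text \<open>Both sides say that the columns of \<open>M\<close> span the whole space.\<close>

lemma full_rank_iff_surj_mats:
  fixes M :: "'k::field mat"
  assumes M: "M \<in> carrier_mat m N"
  shows "vec_space.rank m M = m \<longleftrightarrow> M \<in> surj_mats m N"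
proof -
  interpret V: vec_space "TYPE('k)" m .
  have cM: "set (cols M) \<subseteq> carrier_vec m" using M cols_dim by blast
  have sp: "V.span (set (cols M)) = {M *\<^sub>v v | v. v \<in> carrier_vec N}"
    using V.col_space_eq [OF M] M unfolding V.col_space_def by auto
  show ?thesis unfolding surj_mats_iff [OF M] sp [symmetric]
  proof
    assume r: "V.rank M = m"
    obtain S where S: "maximal S (\<lambda>T. T \<subseteq> set (cols M) \<and> V.lin_indpt T)"
      using maximal_exists_superset [of "set (cols M)" "\<lambda>T. T \<subseteq> set (cols M) \<and> V.lin_indpt T" "{}"]
        V.finite_lin_indpt2 [of "{}"]
          by (metis (no_types, lifting) List.finite_set empty_subsetI V.lin_dep_def empty_iff subset_empty)
    have cS: "card S = m" using V.rank_card_indpt [OF M S] r by simp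
    have S': "S \<subseteq> set (cols M)" "V.lin_indpt S" using S by (auto simp: maximal_def)
    have "V.basis S"
      by (rule V.dim_li_is_basis) (use S' cS cM V.dim_is_n finite_subset in \<open>auto intro: V.fin_dim\<close>)
    hence "V.span S = carrier_vec m" by (simp add: V.basis_def)
    thus "V.span (set (cols M)) = carrier_vec m"
      using V.span_is_monotone [OF S'(1)] V.span_is_subset2 [OF cM] by auto
  next
    assume "V.span (set (cols M)) = carrier_vec m"
    thus "V.rank M = m" using V.dim_is_n unfolding V.rank_def by (simp add: module_vec_def)
  qed
qed

lemma extend_to_GL:
  fixes X :: "'k::field mat"
  assumes X: "X \<in> inj_mats N m"
  shows "\<exists>x\<in>carrier (GL N). \<forall>j<m. col x j = col X j"
proof -
  have "lin_closed N (carrier_vec N :: 'k vec set)" by (simp add: lin_closed_def)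
  moreover have "X *\<^sub>v v \<in> carrier_vec N" if "v \<in> carrier_vec m" for v
    using that X by (auto simp: inj_mats_def)
  ultimately obtain d x
    where x: "x \<in> inj_mats N d" and im: "carrier_vec N = {x *\<^sub>v v | v. v \<in> carrier_vec d}"
    and c: "\<forall>j<m. col x j = col X j" using extend_basis_matrix [OF _ X] by blast
  have xc: "x \<in> carrier_mat N d" using x by (simp add: inj_mats_def)
  have "x \<in> surj_mats N d" using im surj_mats_iff [OF xc] by simp
  hence "x\<^sup>T \<in> inj_mats d N" using transpose_inj_mats [of "x\<^sup>T"] by simp
  with x have "d = N" using inj_mats_le by (metis le_antisym)
  with x c show ?thesis by (auto simp: inj_mats_square)
qed

text \<open>The columns of \<open>X\<close> are a basis of the image of \<open>M\<close>.\<close>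

lemma rank_factorization:
  fixes M :: "'k::field mat"
  assumes M: "M \<in> carrier_mat k n"
  obtains j X Y where "X \<in> inj_mats k j" "Y \<in> surj_mats j n" "M = X * Y"
proof -
  obtain j X where X: "X \<in> inj_mats k j"
    and im: "{M *\<^sub>v v | v. v \<in> carrier_vec n} = {X *\<^sub>v v | v. v \<in> carrier_vec j}"
    by (rule obtain_basis_matrix [OF lin_closed_image [OF M]])
  from X obtain L
    where Xc: "X \<in> carrier_mat k j" and L: "L \<in> carrier_mat j k" and LX: "L * X = 1\<^sub>m j"
    by (auto simp: inj_mats_def)
  have XLw: "X *\<^sub>v (L *\<^sub>v w) = w" if "w \<in> {X *\<^sub>v v | v. v \<in> carrier_vec j}" for w
  proof -
    from that obtain v where v: "v \<in> carrier_vec j" and w: "w = X *\<^sub>v v" by blast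
    have "L *\<^sub>v w = (L * X) *\<^sub>v v" using v L Xc by (simp add: w)
    thus ?thesis using v by (simp add: LX w)
  qed
  have eq: "M = X * (L * M)"
  proof (rule mat_col_eqI)
    fix i assume "i < dim_col (X * (L * M))"
    hence i: "i < n" using M by simp
    have "col M i = M *\<^sub>v unit_vec n i" using col_mult2 [OF M one_carrier_mat i] M i by simp
    hence "col M i \<in> {M *\<^sub>v v | v. v \<in> carrier_vec n}" using unit_vec_carrier by blast
    hence "X *\<^sub>v (L *\<^sub>v col M i) = col M i" unfolding im by (rule XLw)
    thus "col M i = col (X * (L * M)) i"
      by (simp only: col_mult2 [OF Xc mult_carrier_mat [OF L M] i] col_mult2 [OF L M i])
  qed (use M Xc in auto)
  have "L * M \<in> surj_mats j n"
    unfolding surj_mats_iff [OF mult_carrier_mat [OF L M]]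
  proof (intro equalityI subsetI)
    fix v :: "'k vec" assume v: "v \<in> carrier_vec j"
    then obtain u where u: "u \<in> carrier_vec n" "X *\<^sub>v v = M *\<^sub>v u" using im by blast
    have "v = (L * X) *\<^sub>v v" using v by (simp add: LX)
    also have "\<dots> = (L * M) *\<^sub>v u" using v L Xc M u by simp
    finally show "v \<in> {(L * M) *\<^sub>v v | v. v \<in> carrier_vec n}" using u by blast
  qed (use L M in auto)
  thus ?thesis by (rule that [OF X _ eq])
qed

lemma mat_eqI_mult_vec:
  fixes A :: "'k::field mat"
  assumes A: "A \<in> carrier_mat n k" and B: "B \<in> carrier_mat n k"
    and eq: "\<And>v. v \<in> carrier_vec k \<Longrightarrow> A *\<^sub>v v = B *\<^sub>v v"
  shows "A = B"
proof (rule mat_col_eqI)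
  fix i assume "i < dim_col B"
  hence i: "i < k" using B by simp
  have "A *\<^sub>v unit_vec k i = col A i" "B *\<^sub>v unit_vec k i = col B i"
    using col_mult2 [OF A one_carrier_mat i] col_mult2 [OF B one_carrier_mat i] A B i by simp_all
  thus "col A i = col B i" using eq [of "unit_vec k i"] by simp
qed (use A B in auto)

lemma smult_one_mult_vec:
  assumes v: "v \<in> carrier_vec n"
  shows "(c \<cdot>\<^sub>m 1\<^sub>m n) *\<^sub>v v = c \<cdot>\<^sub>v (v :: 'k::field vec)"
proof (rule eq_vecI)
  fix i assume "i < dim_vec (c \<cdot>\<^sub>v v)"
  hence i: "i < n" using v by simp
  have "row (c \<cdot>\<^sub>m 1\<^sub>m n) i = c \<cdot>\<^sub>v unit_vec n i"
    using i by (intro eq_vecI) auto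
  thus "((c \<cdot>\<^sub>m 1\<^sub>m n) *\<^sub>v v) $ i = (c \<cdot>\<^sub>v v) $ i" using i v by simp
qed (use v in auto)

lemma factor_through_image:
  fixes A :: "'k::field mat"
  assumes Y: "Y \<in> inj_mats n d" and A: "A \<in> carrier_mat n k"
    and im: "\<And>v. v \<in> carrier_vec k \<Longrightarrow> A *\<^sub>v v \<in> {Y *\<^sub>v u | u. u \<in> carrier_vec d}"
  obtains Z where "Z \<in> carrier_mat d k" "A = Y * Z"
proof -
  from Y obtain L
    where Yc: "Y \<in> carrier_mat n d" and L: "L \<in> carrier_mat d n" and LY: "L * Y = 1\<^sub>m d"
    by (auto simp: inj_mats_def)
  have "A = Y * (L * A)"
  proof (rule mat_eqI_mult_vec [OF A])
    fix v :: "'k vec" assume v: "v \<in> carrier_vec k"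
    obtain u where u: "u \<in> carrier_vec d" and Av: "A *\<^sub>v v = Y *\<^sub>v u" using im [OF v] by blast
    have "(Y * (L * A)) *\<^sub>v v = Y *\<^sub>v (L *\<^sub>v (A *\<^sub>v v))"
      using v Yc L A
        by (simp add: assoc_mult_mat_vec [OF Yc mult_carrier_mat [OF L A] v] assoc_mult_mat_vec [OF L A v])
    also have "L *\<^sub>v (A *\<^sub>v v) = (L * Y) *\<^sub>v u" using u Yc L by (simp add: Av)
    finally show "A *\<^sub>v v = (Y * (L * A)) *\<^sub>v v" using u by (simp add: LY Av)
  qed (use Yc L A in auto)
  thus ?thesis using that [of "L * A"] L A by simp
qed

section \<open>Traces\<close>

definition mat_trace :: "'k::comm_ring_1 mat \<Rightarrow> 'k" where
  "mat_trace A = (\<Sum>i<dim_row A. A $$ (i, i))"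

lemma mult_entry:
  assumes "A \<in> carrier_mat n k" "B \<in> carrier_mat k m" "i < n" "j < m"
  shows "(A * B) $$ (i, j) = (\<Sum>p<k. A $$ (i, p) * B $$ (p, j))"
  using assms by (simp add: scalar_prod_def lessThan_atLeast0)

lemma mat_trace_comm:
  assumes A: "A \<in> carrier_mat n k" and B: "B \<in> carrier_mat k n"
  shows "mat_trace (A * B) = mat_trace (B * A)"
proof -
  have "mat_trace (A * B) = (\<Sum>i<n. \<Sum>p<k. A $$ (i, p) * B $$ (p, i))"
    using A B by (simp add: mat_trace_def mult_entry [OF A B] del: index_mult_mat(1))
  also have "\<dots> = (\<Sum>p<k. \<Sum>i<n. B $$ (p, i) * A $$ (i, p))"
    by (subst sum.swap) (simp add: mult.commute)
  also have "\<dots> = mat_trace (B * A)"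
    using A B by (simp add: mat_trace_def mult_entry [OF B A] del: index_mult_mat(1))
  finally show ?thesis .
qed

lemma mat_trace_conjugate:
  assumes "P \<in> carrier_mat n n" "Q \<in> carrier_mat n n" "A \<in> carrier_mat n n" "Q * P = 1\<^sub>m n"
  shows "mat_trace (P * A * Q) = mat_trace A"
proof -
  have "mat_trace (P * A * Q) = mat_trace (Q * (P * A))"
    using assms by (intro mat_trace_comm) auto
  also have "Q * (P * A) = A"
    using assms by (simp add: assoc_mult_mat [OF assms(2,1,3), symmetric] del: assoc_mult_mat)
  finally show ?thesis .
qed

lemma upper_triangular_mult:
  assumes A: "A \<in> carrier_mat n n" and B: "B \<in> carrier_mat n n"
    and "upper_triangular A" "upper_triangular B"
  shows "upper_triangular (A * B)" and "i < n \<Longrightarrow> (A * B) $$ (i, i) = A $$ (i, i) * B $$ (i, i)"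
proof -
  have z: "A $$ (i, p) * B $$ (p, j) = 0" if "i < n" "p < n" "j < i \<or> j = i \<and> p \<noteq> i" for i j p
  proof (cases "p < i")
    case True
    thus ?thesis using assms that unfolding upper_triangular_def by auto
  next
    case False
    hence "j < p" using that by auto
    thus ?thesis using assms that unfolding upper_triangular_def by auto
  qed
  show "upper_triangular (A * B)"
    using A B unfolding upper_triangular_def
    by (auto simp: mult_entry [OF A B] z simp del: index_mult_mat(1) intro!: sum.neutral)
  assume i: "i < n"
  have "(A * B) $$ (i, i) = (\<Sum>p<n. A $$ (i, p) * B $$ (p, i))"
    using i by (simp add: mult_entry [OF A B] del: index_mult_mat(1))
  also have "\<dots> = (\<Sum>p\<in>{i}. A $$ (i, p) * B $$ (p, i))"
    using i z by (intro sum.mono_neutral_right) auto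
  finally show "(A * B) $$ (i, i) = A $$ (i, i) * B $$ (i, i)" by simp
qed

lemma upper_triangular_pow:
  assumes A: "A \<in> carrier_mat n n" and u: "upper_triangular A"
  shows "upper_triangular (A ^\<^sub>m k) \<and> (\<forall>i<n. (A ^\<^sub>m k) $$ (i, i) = (A $$ (i, i)) ^ k)"
proof (induction k)
  case 0
  thus ?case using A by (simp add: upper_triangular_def)
next
  case (Suc k)
  thus ?case using upper_triangular_mult [OF pow_carrier_mat [OF A] A _ u, of k]
    by (auto simp: power_commutes)
qed

text \<open>Triangularization: the powers of a triangular matrix have the powers of its diagonal entries on
the diagonal. The list \<open>es\<close> is the same for all exponents \<open>k\<close>, which is what allows the trace of
\<open>A\<close> to be compared with the trace of its inverse when \<open>A\<close> has finite order.\<close>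

lemma trace_pow_eigenvalues:
  fixes A :: "complex mat"
  assumes A: "A \<in> carrier_mat n n"
  obtains es where "length es = n" "\<And>e. e \<in> set es \<Longrightarrow> eigenvalue A e"
    "\<And>k. mat_trace (A ^\<^sub>m k) = (\<Sum>e\<leftarrow>es. e ^ k)"
proof -
  obtain es where cp: "char_poly A = (\<Prod>e\<leftarrow>es. [:- e, 1:])" and len: "length es = n"
    using char_poly_factorized [OF A] by blast
  obtain B P Q where "schur_decomposition A es = (B, P, Q)" by (cases "schur_decomposition A es") auto
  from schur_decomposition [OF A cp this] have wit: "similar_mat_wit A B P Q"
    and u: "upper_triangular B" and d: "diag_mat B = es" by auto
  note w = similar_mat_witD2 [OF A wit]
  show ?thesis
  proof
    show "eigenvalue A e" if "e \<in> set es" for e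
      using that unfolding eigenvalue_root_char_poly [OF A] cp by (rule linear_poly_root)
    fix k
    have "A ^\<^sub>m k = P * B ^\<^sub>m k * Q" by (rule similar_mat_wit_pow_id [OF wit])
    hence "mat_trace (A ^\<^sub>m k) = mat_trace (B ^\<^sub>m k)"
      using w by (simp add: mat_trace_conjugate)
    also have "\<dots> = (\<Sum>i<n. (B $$ (i, i)) ^ k)"
      using upper_triangular_pow [OF w(5) u, of k] w(5) by (simp add: mat_trace_def)
    also have "\<dots> = (\<Sum>e\<leftarrow>es. e ^ k)"
      using w(5) unfolding d [symmetric] diag_mat_def
      by (simp add: comp_def interv_sum_list_conv_sum_set_nat lessThan_atLeast0)
    finally show "mat_trace (A ^\<^sub>m k) = (\<Sum>e\<leftarrow>es. e ^ k)" .
  qed (rule len)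
qed

section \<open>Schur's lemma\<close>

lemma irreducible_rep_iff:
  "irreducible_rep G d \<rho> \<longleftrightarrow> \<rho> \<in> hom G (GL d) \<and> 0 < d \<and>
     (\<forall>W. lin_closed d W \<longrightarrow> (\<forall>g\<in>carrier G. \<forall>w\<in>W. \<rho> g *\<^sub>v w \<in> W) \<longrightarrow> W = {0\<^sub>v d} \<or> W = carrier_vec d)"
  by (simp add: irreducible_rep_def subspace_iff_lin_closed)

lemma irreducible_repD:
  assumes "irreducible_rep G d \<rho>" "lin_closed d W"
    "\<And>g w. g \<in> carrier G \<Longrightarrow> w \<in> W \<Longrightarrow> \<rho> g *\<^sub>v w \<in> W"
  shows "W = {0\<^sub>v d} \<or> W = carrier_vec d"
  using assms unfolding irreducible_rep_iff by simp

lemma rep_carrier_mat: "\<rho> \<in> hom G (GL d) \<Longrightarrow> g \<in> carrier G \<Longrightarrow> \<rho> g \<in> carrier_mat d d"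
  by (auto simp: hom_def intro: carrier_GL_mat)

lemma rep_mult:
  "\<rho> \<in> hom G (GL d) \<Longrightarrow> g \<in> carrier G \<Longrightarrow> h \<in> carrier G \<Longrightarrow> \<rho> (g \<otimes>\<^bsub>G\<^esub> h) = \<rho> g * \<rho> h"
  by (simp add: hom_def)

text \<open>The kernel and the image of \<open>T\<close> are invariant subspaces, so the kernel is zero and the image is
everything.\<close>

lemma schur_invertible:
  assumes \<rho>: "irreducible_rep G d \<rho>" and \<sigma>: "irreducible_rep G e \<sigma>"
    and T: "T \<in> carrier_mat e d"
      and com: "\<And>g. g \<in> carrier G \<Longrightarrow> T * \<rho> g = \<sigma> g * T"
    and nz: "T \<noteq> 0\<^sub>m e d"
  shows "d = e \<and> T \<in> carrier (GL d)"
proof -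
  have \<rho>h: "\<rho> \<in> hom G (GL d)" and \<sigma>h: "\<sigma> \<in> hom G (GL e)"
    using \<rho> \<sigma> by (auto simp: irreducible_rep_iff)
  note c = rep_carrier_mat [OF \<rho>h] rep_carrier_mat [OF \<sigma>h]
  have com': "T *\<^sub>v (\<rho> g *\<^sub>v v) = \<sigma> g *\<^sub>v (T *\<^sub>v v)"
    if "g \<in> carrier G" "v \<in> carrier_vec d" for g v
    using arg_cong [OF com [OF that(1)], of "\<lambda>A. A *\<^sub>v v"]
    by (simp add: assoc_mult_mat_vec [OF T c(1) [OF that(1)] that(2)]
        assoc_mult_mat_vec [OF c(2) [OF that(1)] T that(2)])
  have nz': "\<exists>v\<in>carrier_vec d. T *\<^sub>v v \<noteq> 0\<^sub>v e"
  proof (rule ccontr)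
    assume "\<not> ?thesis"
    hence "T = 0\<^sub>m e d" by (intro mat_eqI_mult_vec [OF T]) auto
    thus False using nz by simp
  qed
  let ?K = "{v \<in> carrier_vec d. T *\<^sub>v v = 0\<^sub>v e}"
  have "\<rho> g *\<^sub>v w \<in> ?K" if "g \<in> carrier G" "w \<in> ?K" for g w
    using that com' [of g w] c(1) [OF that(1)] c(2) [OF that(1)] by auto
  with lin_closed_kernel [OF T] have "?K = {0\<^sub>v d} \<or> ?K = carrier_vec d"
    by (rule irreducible_repD [OF \<rho>])
  moreover have "?K \<noteq> carrier_vec d" using nz' by auto
  ultimately have K: "?K = {0\<^sub>v d}" by simp
  let ?I = "{T *\<^sub>v v | v. v \<in> carrier_vec d}"
  have "\<sigma> g *\<^sub>v w \<in> ?I" if g: "g \<in> carrier G" and w: "w \<in> ?I" for g w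
  proof -
    obtain v where v: "v \<in> carrier_vec d" "w = T *\<^sub>v v" using w by blast
    have "\<sigma> g *\<^sub>v w = T *\<^sub>v (\<rho> g *\<^sub>v v)" using com' [OF g v(1)] v(2) by simp
    moreover have "\<rho> g *\<^sub>v v \<in> carrier_vec d" using c(1) [OF g] v(1) by simp
    ultimately show ?thesis by blast
  qed
  with lin_closed_image [OF T] have "?I = {0\<^sub>v e} \<or> ?I = carrier_vec e"
    by (rule irreducible_repD [OF \<sigma>])
  moreover have "?I \<noteq> {0\<^sub>v e}" using nz' by blast
  ultimately have Ts: "T \<in> surj_mats e d" using surj_mats_iff [OF T] by simp
  then obtain R where R: "R \<in> carrier_mat d e" and TR: "T * R = 1\<^sub>m e" by (auto simp: surj_mats_def)
  have "R * T = 1\<^sub>m d"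
  proof (rule mat_eqI_mult_vec)
    fix v :: "complex vec" assume v: "v \<in> carrier_vec d"
    have RTv: "(R * T) *\<^sub>v v \<in> carrier_vec d" using R T v by auto
    have "T *\<^sub>v ((R * T) *\<^sub>v v) = (T * R) *\<^sub>v (T *\<^sub>v v)"
      using R T v by simp
    also have "\<dots> = T *\<^sub>v v" using T v by (simp add: TR)
    finally have "T *\<^sub>v ((R * T) *\<^sub>v v - v) = 0\<^sub>v e"
      using mult_minus_distrib_mat_vec [OF T RTv v] T v by simp
    hence "(R * T) *\<^sub>v v - v \<in> ?K" using RTv v by simp
    hence "(R * T) *\<^sub>v v - v = 0\<^sub>v d" unfolding K by simp
    moreover have "(R * T) *\<^sub>v v = ((R * T) *\<^sub>v v - v) + v" using R RTv v by (intro eq_vecI) auto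
    ultimately have "(R * T) *\<^sub>v v = v" using v by simp
    thus "(R * T) *\<^sub>v v = 1\<^sub>m d *\<^sub>v v" using v by simp
  qed (use R T in auto)
  hence Ti: "T \<in> inj_mats e d" using T R by (auto simp: inj_mats_def)
  have "T\<^sup>T \<in> inj_mats d e" using Ts transpose_inj_mats [of "T\<^sup>T"] by simp
  with Ti have "d = e" using inj_mats_le le_antisym by blast
  with Ti show ?thesis by (simp add: inj_mats_square)
qed

text \<open>Subtracting an eigenvalue makes \<open>T\<close> singular, so that it vanishes by the preceding form of
Schur's lemma.\<close>

lemma schur_scalar:
  assumes \<rho>: "irreducible_rep G d \<rho>"
    and T: "T \<in> carrier_mat d d"
      and com: "\<And>g. g \<in> carrier G \<Longrightarrow> T * \<rho> g = \<rho> g * T"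
  obtains c where "T = c \<cdot>\<^sub>m 1\<^sub>m d"
proof -
  have \<rho>h: "\<rho> \<in> hom G (GL d)" and d: "0 < d" using \<rho> by (auto simp: irreducible_rep_iff)
  obtain es where es: "length es = d" "\<And>e. e \<in> set es \<Longrightarrow> eigenvalue T e"
    by (rule trace_pow_eigenvalues [OF T]) (rule that)
  have "hd es \<in> set es" using es(1) d by auto
  hence "eigenvalue T (hd es)" by (rule es(2))
  then obtain c where "eigenvalue T c" by blast
  then obtain v
    where v: "v \<in> carrier_vec d" "v \<noteq> 0\<^sub>v d" "T *\<^sub>v v = c \<cdot>\<^sub>v v"
    using T by (auto simp: eigenvalue_def eigenvector_def)
  let ?S = "T - c \<cdot>\<^sub>m 1\<^sub>m d"
  have S: "?S \<in> carrier_mat d d" using T by auto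
  have comS: "?S * \<rho> g = \<rho> g * ?S" if g: "g \<in> carrier G" for g
  proof -
    have R: "\<rho> g \<in> carrier_mat d d" by (rule rep_carrier_mat [OF \<rho>h g])
    have "?S * \<rho> g = T * \<rho> g - c \<cdot>\<^sub>m \<rho> g"
      using R T by (simp add: minus_mult_distrib_mat [OF T smult_carrier_mat [OF one_carrier_mat] R]
          mult_smult_assoc_mat [OF one_carrier_mat R])
    also have "\<dots> = \<rho> g * ?S"
      using R T com [OF g]
        by (simp add: mult_minus_distrib_mat [OF R T smult_carrier_mat [OF one_carrier_mat]]
          mult_smult_distrib [OF R one_carrier_mat])
    finally show ?thesis .
  qed
  have "?S = 0\<^sub>m d d"
  proof (rule ccontr)
    assume "?S \<noteq> 0\<^sub>m d d"
    hence "?S \<in> inj_mats d d"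
      using schur_invertible [OF \<rho> \<rho> S comS] by (simp add: inj_mats_square)
    moreover have "?S *\<^sub>v v = 0\<^sub>v d"
      using v T by (simp add: minus_mult_distrib_mat_vec [OF T smult_carrier_mat [OF one_carrier_mat] v(1)]
          smult_one_mult_vec)
    ultimately show False using inj_mats_kernel v by blast
  qed
  hence "T = c \<cdot>\<^sub>m 1\<^sub>m d"
    using T by (intro eq_matI) (auto simp: mat_eq_iff)
  thus ?thesis by (rule that)
qed

section \<open>Orthogonality of irreducible characters\<close>

locale finite_group = group G for G (structure) +
  assumes finite_carrier [simp, intro]: "finite (carrier G)"
begin

lemma card_carrier_pos: "0 < card (carrier G)"
  using one_closed by (auto simp: card_gt_0_iff)

lemma rep_one:
  assumes "\<rho> \<in> hom G (GL d)"
  shows "\<rho> \<one> = 1\<^sub>m d"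
  using hom_one [OF assms group_axioms group_GL] by simp

lemma rep_inv:
  assumes \<rho>: "\<rho> \<in> hom G (GL d)" and g: "g \<in> carrier G"
  shows "\<rho> (inv g) * \<rho> g = 1\<^sub>m d" "\<rho> g * \<rho> (inv g) = 1\<^sub>m d"
  using rep_mult [OF \<rho> inv_closed [OF g] g] rep_mult [OF \<rho> g inv_closed [OF g]] g rep_one [OF \<rho>]
  by simp_all

lemma rep_homI:
  assumes c: "\<And>g. g \<in> carrier G \<Longrightarrow> \<rho> g \<in> carrier_mat d d"
    and m: "\<And>g h. g \<in> carrier G \<Longrightarrow> h \<in> carrier G \<Longrightarrow> \<rho> (g \<otimes> h) = \<rho> g * \<rho> h"
    and o: "\<rho> \<one> = 1\<^sub>m d"
  shows "\<rho> \<in> hom G (GL d)"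
proof (rule homI)
  fix g assume g: "g \<in> carrier G"
  have "\<rho> (inv g) * \<rho> g = 1\<^sub>m d" using m [of "inv g" g] g o by simp
  thus "\<rho> g \<in> carrier (GL d)" unfolding carrier_GL_iff_left_inverse using c g by blast
qed (simp add: m)

lemma sum_translate: "h \<in> carrier G \<Longrightarrow> (\<Sum>g\<in>carrier G. f (h \<otimes> g)) = (\<Sum>g\<in>carrier G. f g)"
  by (rule sum.reindex_bij_witness [where i = "\<lambda>g. inv h \<otimes> g" and j = "\<lambda>g. h \<otimes> g"])
    (auto simp: m_assoc [symmetric])

lemma conjugate_cancel:
  assumes "h \<in> carrier G" "g \<in> carrier G"
  shows "h \<otimes> (inv h \<otimes> g) = g" "inv h \<otimes> (h \<otimes> g) = g"
  using assms by (simp_all add: m_assoc [symmetric])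

lemma sum_conjugate:
  "h \<in> carrier G \<Longrightarrow> (\<Sum>g\<in>carrier G. f (h \<otimes> g \<otimes> inv h)) = (\<Sum>g\<in>carrier G. f g)"
  by (rule sum.reindex_bij_witness [where i = "\<lambda>g. inv h \<otimes> g \<otimes> h" and j = "\<lambda>g. h \<otimes> g \<otimes> inv h"])
    (auto simp: conjugate_cancel m_assoc)

lemma character_trace:
  assumes "\<rho> \<in> hom G (GL d)" "g \<in> carrier G"
  shows "character G d \<rho> g = mat_trace (\<rho> g)"
  using rep_carrier_mat [OF assms] assms(2) by (simp add: character_def mat_trace_def)

lemma character_conjugate:
  assumes \<rho>: "\<rho> \<in> hom G (GL d)" and g: "g \<in> carrier G" and h: "h \<in> carrier G"
  shows "character G d \<rho> (h \<otimes> g \<otimes> inv h) = character G d \<rho> g"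
proof -
  note c = rep_carrier_mat [OF \<rho>]
  have "\<rho> (h \<otimes> g \<otimes> inv h) = \<rho> h * \<rho> g * \<rho> (inv h)"
    using g h by (simp add: rep_mult [OF \<rho>] del: assoc_mult_mat)
  thus ?thesis
    using mat_trace_conjugate [OF c [OF h] c [OF inv_closed [OF h]] c [OF g] rep_inv(1) [OF \<rho> h]]
    by (simp add: character_trace [OF \<rho>] g h del: assoc_mult_mat)
qed

lemma IrrChar_conjugate:
  assumes "\<chi> \<in> IrrChar G" "g \<in> carrier G" "h \<in> carrier G"
  shows "\<chi> (h \<otimes> g \<otimes> inv h) = \<chi> g"
  using assms character_conjugate by (auto simp: IrrChar_def irreducible_rep_iff)

text \<open>The eigenvalues of \<open>\<rho> g\<close> are roots of unity, and \<open>inv g\<close> is a power of \<open>g\<close>.\<close>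

lemma character_cnj:
  assumes \<rho>: "\<rho> \<in> hom G (GL d)" and g: "g \<in> carrier G"
  shows "cnj (character G d \<rho> g) = character G d \<rho> (inv g)"
proof -
  have A: "\<rho> g \<in> carrier_mat d d" by (rule rep_carrier_mat [OF \<rho> g])
  have pw: "\<rho> (g [^] k) = \<rho> g ^\<^sub>m k" for k :: nat
    using g A by (induction k) (simp_all add: rep_one [OF \<rho>] rep_mult [OF \<rho>])
  obtain m where ord: "card (carrier G) = Suc m" using card_carrier_pos gr0_implies_Suc by blast
  have gm: "g [^] m \<otimes> g = \<one>" using pow_order_eq_1 [OF g] ord by (simp add: Coset.order_def)
  hence inv: "inv g = g [^] m" using g by (simp add: inv_equality)
  obtain es
    where len: "length es = d" and ev: "\<And>e. e \<in> set es \<Longrightarrow> eigenvalue (\<rho> g) e"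
    and tr: "\<And>k. mat_trace (\<rho> g ^\<^sub>m k) = (\<Sum>e\<leftarrow>es. e ^ k)"
    by (rule trace_pow_eigenvalues [OF A]) (rule that)
  \<comment> \<open>The eigenvalues are roots of unity, so that \<open>e ^ m = inverse e = cnj e\<close>.\<close>
  have "cnj e = e ^ m" if e: "e \<in> set es" for e
  proof -
    obtain v where v: "eigenvector (\<rho> g) v e" using ev [OF e] by (auto simp: eigenvalue_def)
    hence vc: "v \<in> carrier_vec d" and v0: "v \<noteq> 0\<^sub>v d" using A by (auto simp: eigenvector_def)
    have "\<rho> g ^\<^sub>m Suc m = 1\<^sub>m d" using pw [of "Suc m"] gm rep_one [OF \<rho>] by simp
    hence *: "v = e ^ Suc m \<cdot>\<^sub>v v" using eigenvector_pow [OF A v, of "Suc m"] vc by simp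
    obtain i where i: "i < d" "v $ i \<noteq> 0"
      using v0 vc by (metis carrier_vecD eq_vecI index_zero_vec)
    have "v $ i = e ^ Suc m * v $ i" using arg_cong [OF *, of "\<lambda>w. w $ i"] i vc by simp
    hence one: "e ^ Suc m = 1" using i by simp
    hence "norm e ^ Suc m = 1" by (metis norm_one norm_power)
    hence "norm e = 1" using power_eq_1_iff [of "norm e" "Suc m"] by simp
    hence "e * cnj e = 1" by (simp add: complex_norm_square [symmetric])
    hence "e * cnj e = e * e ^ m" using one by simp
    moreover have "e \<noteq> 0" using \<open>norm e = 1\<close> by auto
    ultimately show ?thesis by simp
  qed
  hence "cnj (\<Sum>e\<leftarrow>es. e) = (\<Sum>e\<leftarrow>es. e ^ m)"
    by (induction es) simp_all
  moreover have "mat_trace (\<rho> g) = (\<Sum>e\<leftarrow>es. e)" using tr [of 1] A by simp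
  ultimately show ?thesis
    using tr [of m] g inv pw [of m] by (simp add: character_trace [OF \<rho>])
qed

lemma IrrChar_cnj: "\<chi> \<in> IrrChar G \<Longrightarrow> g \<in> carrier G \<Longrightarrow> cnj (\<chi> g) = \<chi> (inv g)"
  using character_cnj by (auto simp: IrrChar_def irreducible_rep_iff)

text \<open>The sum of \<open>\<sigma> g * E * \<rho> (inv g)\<close> over the group, where \<open>E\<close> is the matrix unit at \<open>(k, l)\<close>. Written in
coordinates because matrices of unspecified size do not form an additive monoid.\<close>

definition coeff_mat :: "nat \<Rightarrow> nat \<Rightarrow> ('a \<Rightarrow> complex mat) \<Rightarrow> ('a \<Rightarrow> complex mat) \<Rightarrow> nat \<Rightarrow> nat \<Rightarrow> complex mat" where
  "coeff_mat d e \<rho> \<sigma> k l =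
     mat e d (\<lambda>(i, j). \<Sum>g\<in>carrier G. \<sigma> g $$ (i, k) * \<rho> (inv g) $$ (l, j))"

lemma coeff_mat_carrier [simp]:
  "coeff_mat d e \<rho> \<sigma> k l \<in> carrier_mat e d"
  "dim_row (coeff_mat d e \<rho> \<sigma> k l) = e" "dim_col (coeff_mat d e \<rho> \<sigma> k l) = d"
  by (simp_all add: coeff_mat_def)

lemma coeff_mat_intertwines:
  assumes \<rho>: "\<rho> \<in> hom G (GL d)" and \<sigma>: "\<sigma> \<in> hom G (GL e)" and k: "k < e"
    and l: "l < d"
    and h: "h \<in> carrier G"
  shows "coeff_mat d e \<rho> \<sigma> k l * \<rho> h = \<sigma> h * coeff_mat d e \<rho> \<sigma> k l"
proof (rule eq_matI)
  let ?T = "coeff_mat d e \<rho> \<sigma> k l"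
  note r = rep_carrier_mat [OF \<rho>] and s = rep_carrier_mat [OF \<sigma>]
  fix i j assume "i < dim_row (\<sigma> h * ?T)" "j < dim_col (\<sigma> h * ?T)"
  hence i: "i < e" and j: "j < d" using s [OF h] coeff_mat_carrier [of d e \<rho> \<sigma> k l] by auto
  have "(?T * \<rho> h) $$ (i, j) = (\<Sum>p<d. ?T $$ (i, p) * \<rho> h $$ (p, j))"
    by (rule mult_entry [OF coeff_mat_carrier(1) r [OF h] i j])
  also have "\<dots> = (\<Sum>p<d. \<Sum>g\<in>carrier G. \<sigma> g $$ (i, k) * (\<rho> (inv g) $$ (l, p) * \<rho> h $$ (p, j)))"
    using i by (simp add: coeff_mat_def sum_distrib_right mult.assoc)
  also have "\<dots> = (\<Sum>g\<in>carrier G. \<sigma> g $$ (i, k) * (\<Sum>p<d. \<rho> (inv g) $$ (l, p) * \<rho> h $$ (p, j)))"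
    by (subst sum.swap) (simp add: sum_distrib_left)
  also have "\<dots> = (\<Sum>g\<in>carrier G. \<sigma> g $$ (i, k) * \<rho> (inv g \<otimes> h) $$ (l, j))"
    using h l j mult_entry [OF r r, of "inv _" h l j]
      by (simp add: rep_mult [OF \<rho>] del: index_mult_mat(1))
  also have "\<dots> = (\<Sum>g\<in>carrier G. \<sigma> (h \<otimes> g) $$ (i, k) * \<rho> (inv (h \<otimes> g) \<otimes> h) $$ (l, j))"
    by (rule sum_translate [OF h, symmetric])
  also have "\<dots> = (\<Sum>g\<in>carrier G. (\<Sum>p<e. \<sigma> h $$ (i, p) * \<sigma> g $$ (p, k)) * \<rho> (inv g) $$ (l, j))"
  proof (rule sum.cong [OF refl])
    fix g assume g: "g \<in> carrier G"
    have "inv (h \<otimes> g) \<otimes> h = inv g" using g h by (simp add: inv_mult_group m_assoc)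
    moreover have "\<sigma> (h \<otimes> g) $$ (i, k) = (\<Sum>p<e. \<sigma> h $$ (i, p) * \<sigma> g $$ (p, k))"
      unfolding rep_mult [OF \<sigma> h g] by (rule mult_entry [OF s [OF h] s [OF g] i k])
    ultimately show "\<sigma> (h \<otimes> g) $$ (i, k) * \<rho> (inv (h \<otimes> g) \<otimes> h) $$ (l, j) =
        (\<Sum>p<e. \<sigma> h $$ (i, p) * \<sigma> g $$ (p, k)) * \<rho> (inv g) $$ (l, j)" by simp
  qed
  also have "\<dots> = (\<Sum>p<e. \<sigma> h $$ (i, p) * (\<Sum>g\<in>carrier G. \<sigma> g $$ (p, k) * \<rho> (inv g) $$ (l, j)))"
    unfolding sum_distrib_right sum_distrib_left by (subst sum.swap) (simp add: mult.assoc)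
  also have "\<dots> = (\<Sum>p<e. \<sigma> h $$ (i, p) * ?T $$ (p, j))"
    using j by (simp add: coeff_mat_def)
  also have "\<dots> = (\<sigma> h * ?T) $$ (i, j)"
    by (rule mult_entry [OF s [OF h] coeff_mat_carrier(1) i j, symmetric])
  finally show "(?T * \<rho> h) $$ (i, j) = (\<sigma> h * ?T) $$ (i, j)" .
qed (use rep_carrier_mat [OF \<rho> h] rep_carrier_mat [OF \<sigma> h] in auto)

lemma sum_characters:
  assumes \<rho>: "\<rho> \<in> hom G (GL d)" and \<sigma>: "\<sigma> \<in> hom G (GL e)"
  shows "(\<Sum>g\<in>carrier G. character G e \<sigma> g * character G d \<rho> (inv g)) =
    (\<Sum>i<e. \<Sum>l<d. coeff_mat d e \<rho> \<sigma> i l $$ (i, l))"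
proof -
  have "(\<Sum>g\<in>carrier G. character G e \<sigma> g * character G d \<rho> (inv g)) =
      (\<Sum>g\<in>carrier G. \<Sum>i<e. \<Sum>l<d. \<sigma> g $$ (i, i) * \<rho> (inv g) $$ (l, l))"
    by (simp add: character_def sum_product)
  also have "\<dots> = (\<Sum>i<e. \<Sum>g\<in>carrier G. \<Sum>l<d. \<sigma> g $$ (i, i) * \<rho> (inv g) $$ (l, l))"
    by (rule sum.swap)
  also have "\<dots> = (\<Sum>i<e. \<Sum>l<d. \<Sum>g\<in>carrier G. \<sigma> g $$ (i, i) * \<rho> (inv g) $$ (l, l))"
    by (intro sum.cong refl sum.swap)
  finally show ?thesis by (simp add: coeff_mat_def)
qed

text \<open>A nonzero sum \<open>coeff_mat\<close> would be an invertible intertwiner of the two representations, which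
forces equal characters.\<close>

lemma characters_orthogonal:
  assumes \<rho>: "irreducible_rep G d \<rho>" and \<sigma>: "irreducible_rep G e \<sigma>"
    and ne: "character G d \<rho> \<noteq> character G e \<sigma>"
  shows "(\<Sum>g\<in>carrier G. character G e \<sigma> g * character G d \<rho> (inv g)) = 0"
proof -
  have \<rho>h: "\<rho> \<in> hom G (GL d)" and \<sigma>h: "\<sigma> \<in> hom G (GL e)"
    using \<rho> \<sigma> by (auto simp: irreducible_rep_iff)
  have "coeff_mat d e \<rho> \<sigma> i l = 0\<^sub>m e d" if i: "i < e" and l: "l < d" for i l
  proof (rule ccontr)
    let ?T = "coeff_mat d e \<rho> \<sigma> i l"
    assume "?T \<noteq> 0\<^sub>m e d"
    hence T: "d = e" "?T \<in> carrier (GL d)"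
      using schur_invertible [OF \<rho> \<sigma> coeff_mat_carrier(1) coeff_mat_intertwines [OF \<rho>h \<sigma>h i l]] by auto
    obtain S where S: "S \<in> carrier_mat d d" and ST: "S * ?T = 1\<^sub>m d"
      using T(2) by (auto simp: carrier_GL_iff_left_inverse)
    have Tc: "?T \<in> carrier_mat d d" using T by (simp add: carrier_GL_mat)
    have TS: "?T * S = 1\<^sub>m d" by (rule mat_mult_left_right_inverse [OF S Tc ST])
    have "character G d \<rho> g = character G e \<sigma> g" for g
    proof (cases "g \<in> carrier G")
      case g: True
      have r: "\<rho> g \<in> carrier_mat d d" and s: "\<sigma> g \<in> carrier_mat d d"
        using rep_carrier_mat [OF \<rho>h g] rep_carrier_mat [OF \<sigma>h g] T(1) by auto
      have "mat_trace (\<rho> g) = mat_trace (?T * \<rho> g * S)"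
        by (rule mat_trace_conjugate [OF Tc S r ST, symmetric])
      also have "?T * \<rho> g * S = \<sigma> g * (?T * S)"
        unfolding coeff_mat_intertwines [OF \<rho>h \<sigma>h i l g] by (rule assoc_mult_mat [OF s Tc S])
      also have "\<dots> = \<sigma> g" using s by (simp add: TS)
      finally show ?thesis using g by (simp add: character_trace [OF \<rho>h] character_trace [OF \<sigma>h])
    qed (simp add: character_def)
    thus False using ne by auto
  qed
  thus ?thesis by (simp add: sum_characters [OF \<rho>h \<sigma>h])
qed

text \<open>By Schur's lemma the matrices \<open>coeff_mat\<close> are scalar, and their traces determine the scalars.\<close>

lemma character_norm:
  assumes \<rho>: "irreducible_rep G d \<rho>"
  shows "(\<Sum>g\<in>carrier G. character G d \<rho> g * character G d \<rho> (inv g)) = of_nat (card (carrier G))"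
proof -
  have h: "\<rho> \<in> hom G (GL d)" and d: "0 < d" using \<rho> by (auto simp: irreducible_rep_iff)
  let ?T = "coeff_mat d d \<rho> \<rho>"
  have scalar: "\<exists>c. ?T i l = c \<cdot>\<^sub>m 1\<^sub>m d" if "i < d" "l < d" for i l
    using schur_scalar [OF \<rho> coeff_mat_carrier(1) coeff_mat_intertwines [OF h h that]] by blast
  have off: "?T i l $$ (i, l) = 0" if "i < d" "l < d" "i \<noteq> l" for i l
    using scalar [OF that(1,2)] that by auto
  have diag: "of_nat d * ?T i i $$ (i, i) = of_nat (card (carrier G))" if i: "i < d" for i
  proof -
    obtain c where c: "?T i i = c \<cdot>\<^sub>m 1\<^sub>m d" using scalar [OF i i] by blast
    have "of_nat d * ?T i i $$ (i, i) = (\<Sum>p<d. ?T i i $$ (p, p))" using i by (simp add: c)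
    also have "\<dots> = (\<Sum>p<d. \<Sum>g\<in>carrier G. \<rho> (inv g) $$ (i, p) * \<rho> g $$ (p, i))"
      by (simp add: coeff_mat_def mult.commute)
    also have "\<dots> = (\<Sum>g\<in>carrier G. \<Sum>p<d. \<rho> (inv g) $$ (i, p) * \<rho> g $$ (p, i))"
      by (rule sum.swap)
    also have "\<dots> = (\<Sum>g\<in>carrier G. (\<rho> (inv g) * \<rho> g) $$ (i, i))"
      using mult_entry [OF rep_carrier_mat [OF h] rep_carrier_mat [OF h] i i, of "inv _"] by simp
    also have "\<dots> = of_nat (card (carrier G))"
      using i by (simp add: rep_inv(1) [OF h] del: index_mult_mat(1))
    finally show ?thesis .
  qed
  have "(\<Sum>i<d. \<Sum>l<d. ?T i l $$ (i, l)) = (\<Sum>i<d. ?T i i $$ (i, i))"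
  proof (rule sum.cong [OF refl])
    fix i assume "i \<in> {..<d}"
    hence i: "i < d" by simp
    have "(\<Sum>l<d. ?T i l $$ (i, l)) = (\<Sum>l\<in>{i}. ?T i l $$ (i, l))"
      using i off by (intro sum.mono_neutral_right) auto
    thus "(\<Sum>l<d. ?T i l $$ (i, l)) = ?T i i $$ (i, i)" by simp
  qed
  also have "\<dots> = (\<Sum>i<d. of_nat (card (carrier G)) / of_nat d)"
    using diag d by (intro sum.cong) (auto simp: field_simps)
  also have "\<dots> = of_nat (card (carrier G))" using d by simp
  finally show ?thesis by (simp add: sum_characters [OF h h])
qed

lemma IrrChar_orthogonality:
  assumes "\<chi> \<in> IrrChar G" "\<psi> \<in> IrrChar G"
  shows "(\<Sum>g\<in>carrier G. \<chi> g * \<psi> (inv g)) = (if \<chi> = \<psi> then of_nat (card (carrier G)) else 0)"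
proof -
  obtain d \<rho> e \<sigma> where r: "irreducible_rep G d \<rho>" "\<chi> = character G d \<rho>"
    and s: "irreducible_rep G e \<sigma>" "\<psi> = character G e \<sigma>"
    using assms by (auto simp: IrrChar_def)
  show ?thesis
  proof (cases "\<chi> = \<psi>")
    case True
    thus ?thesis using character_norm [OF r(1)] by (simp add: r(2) [symmetric])
  next
    case False
    thus ?thesis using characters_orthogonal [OF s(1) r(1)] by (simp add: r(2) [symmetric] s(2) [symmetric])
  qed
qed

lemma IrrChar_coefficient:
  assumes S: "finite S" "S \<subseteq> IrrChar G" and \<psi>: "\<psi> \<in> S"
  shows "(\<Sum>g\<in>carrier G. (\<Sum>\<chi>\<in>S. a \<chi> * \<chi> g) * \<psi> (inv g)) = of_nat (card (carrier G)) * a \<psi>"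
proof -
  have "(\<Sum>g\<in>carrier G. (\<Sum>\<chi>\<in>S. a \<chi> * \<chi> g) * \<psi> (inv g)) =
      (\<Sum>\<chi>\<in>S. a \<chi> * (\<Sum>g\<in>carrier G. \<chi> g * \<psi> (inv g)))"
    unfolding sum_distrib_right sum_distrib_left by (subst sum.swap) (simp add: mult.assoc)
  also have "\<dots> = (\<Sum>\<chi>\<in>S. if \<chi> = \<psi> then of_nat (card (carrier G)) * a \<psi> else 0)"
    using S \<psi> by (intro sum.cong) (auto simp: IrrChar_orthogonality subset_iff)
  also have "\<dots> = of_nat (card (carrier G)) * a \<psi>" using S \<psi> by simp
  finally show ?thesis .
qed

lemma IrrChar_linear_independent:
  assumes S: "finite S" "S \<subseteq> IrrChar G" and \<psi>: "\<psi> \<in> S"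
    and z: "\<And>g. g \<in> carrier G \<Longrightarrow> (\<Sum>\<chi>\<in>S. a \<chi> * \<chi> g) = 0"
  shows "a \<psi> = 0"
  using IrrChar_coefficient [OF S \<psi>, of a] z one_closed by auto

end

section \<open>Completeness of irreducible characters\<close>

context finite_group
begin

text \<open>The action of the element of the group algebra with coefficients \<open>\<phi>\<close>.\<close>

definition weighted_rep :: "('a \<Rightarrow> complex) \<Rightarrow> nat \<Rightarrow> ('a \<Rightarrow> complex mat) \<Rightarrow> complex mat" where
  "weighted_rep \<phi> d \<rho> = mat d d (\<lambda>(i, j). \<Sum>g\<in>carrier G. \<phi> g * \<rho> g $$ (i, j))"

lemma weighted_rep_carrier [simp]:
  "weighted_rep \<phi> d \<rho> \<in> carrier_mat d d" "dim_row (weighted_rep \<phi> d \<rho>) = d" "dim_col (weighted_rep \<phi> d \<rho>) = d"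
  by (simp_all add: weighted_rep_def)

lemma weighted_rep_mult_right:
  assumes r: "\<And>g. g \<in> carrier G \<Longrightarrow> \<rho> g \<in> carrier_mat d d"
    and X: "X \<in> carrier_mat d n"
    and i: "i < d" and j: "j < n"
  shows "(weighted_rep \<phi> d \<rho> * X) $$ (i, j) = (\<Sum>g\<in>carrier G. \<phi> g * (\<rho> g * X) $$ (i, j))"
proof -
  have "(weighted_rep \<phi> d \<rho> * X) $$ (i, j) = (\<Sum>p<d. (\<Sum>g\<in>carrier G. \<phi> g * \<rho> g $$ (i, p)) * X $$ (p, j))"
    unfolding mult_entry [OF weighted_rep_carrier(1) X i j] using i by (simp add: weighted_rep_def)
  also have "\<dots> = (\<Sum>g\<in>carrier G. \<phi> g * (\<Sum>p<d. \<rho> g $$ (i, p) * X $$ (p, j)))"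
    unfolding sum_distrib_right sum_distrib_left by (subst sum.swap) (simp add: mult.assoc)
  also have "\<dots> = (\<Sum>g\<in>carrier G. \<phi> g * (\<rho> g * X) $$ (i, j))"
    by (intro sum.cong refl) (simp add: mult_entry [OF r X i j] del: index_mult_mat(1))
  finally show ?thesis .
qed

lemma weighted_rep_mult_left:
  assumes r: "\<And>g. g \<in> carrier G \<Longrightarrow> \<rho> g \<in> carrier_mat d d"
    and X: "X \<in> carrier_mat n d"
    and i: "i < n" and j: "j < d"
  shows "(X * weighted_rep \<phi> d \<rho>) $$ (i, j) = (\<Sum>g\<in>carrier G. \<phi> g * (X * \<rho> g) $$ (i, j))"
proof -
  have "(X * weighted_rep \<phi> d \<rho>) $$ (i, j) = (\<Sum>p<d. X $$ (i, p) * (\<Sum>g\<in>carrier G. \<phi> g * \<rho> g $$ (p, j)))"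
    unfolding mult_entry [OF X weighted_rep_carrier(1) i j] using j by (simp add: weighted_rep_def)
  also have "\<dots> = (\<Sum>g\<in>carrier G. \<phi> g * (\<Sum>p<d. X $$ (i, p) * \<rho> g $$ (p, j)))"
    unfolding sum_distrib_right sum_distrib_left by (subst sum.swap) (simp add: mult.left_commute)
  also have "\<dots> = (\<Sum>g\<in>carrier G. \<phi> g * (X * \<rho> g) $$ (i, j))"
    by (intro sum.cong refl) (simp add: mult_entry [OF X r i j] del: index_mult_mat(1))
  finally show ?thesis .
qed

lemma weighted_rep_intertwine:
  assumes R: "\<And>g. g \<in> carrier G \<Longrightarrow> R g \<in> carrier_mat n n"
    and \<rho>: "\<And>g. g \<in> carrier G \<Longrightarrow> \<rho> g \<in> carrier_mat d d"
    and X: "X \<in> carrier_mat n d"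
      and com: "\<And>g. g \<in> carrier G \<Longrightarrow> R g * X = X * \<rho> g"
  shows "weighted_rep \<phi> n R * X = X * weighted_rep \<phi> d \<rho>"
proof (rule eq_matI)
  fix i j assume "i < dim_row (X * weighted_rep \<phi> d \<rho>)" "j < dim_col (X * weighted_rep \<phi> d \<rho>)"
  hence i: "i < n" and j: "j < d" using X by auto
  show "(weighted_rep \<phi> n R * X) $$ (i, j) = (X * weighted_rep \<phi> d \<rho>) $$ (i, j)"
    using com
      by (simp add: weighted_rep_mult_right [OF R X i j] weighted_rep_mult_left [OF \<rho> X i j] del: index_mult_mat(1))
qed (use X in auto)

lemma weighted_rep_commute:
  assumes \<phi>: "class_function G \<phi>" and \<rho>: "\<rho> \<in> hom G (GL d)" and h: "h \<in> carrier G"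
  shows "weighted_rep \<phi> d \<rho> * \<rho> h = \<rho> h * weighted_rep \<phi> d \<rho>"
proof (rule eq_matI)
  note r = rep_carrier_mat [OF \<rho>]
  fix i j assume "i < dim_row (\<rho> h * weighted_rep \<phi> d \<rho>)" "j < dim_col (\<rho> h * weighted_rep \<phi> d \<rho>)"
  hence i: "i < d" and j: "j < d" using r [OF h] by auto
  have "(weighted_rep \<phi> d \<rho> * \<rho> h) $$ (i, j) = (\<Sum>g\<in>carrier G. \<phi> g * \<rho> (g \<otimes> h) $$ (i, j))"
    using h by (simp add: weighted_rep_mult_right [OF r r [OF h] i j] rep_mult [OF \<rho>] del: index_mult_mat(1))
  also have "\<dots> = (\<Sum>g\<in>carrier G. \<phi> (h \<otimes> g \<otimes> inv h) * \<rho> ((h \<otimes> g \<otimes> inv h) \<otimes> h) $$ (i, j))"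
    by (rule sum_conjugate [OF h, symmetric])
  also have "\<dots> = (\<Sum>g\<in>carrier G. \<phi> g * \<rho> (h \<otimes> g) $$ (i, j))"
    using \<phi> h by (intro sum.cong refl) (simp add: class_function_def m_assoc)
  also have "\<dots> = (\<rho> h * weighted_rep \<phi> d \<rho>) $$ (i, j)"
    using h by (simp add: weighted_rep_mult_left [OF r r [OF h] i j] rep_mult [OF \<rho>] del: index_mult_mat(1))
  finally show "(weighted_rep \<phi> d \<rho> * \<rho> h) $$ (i, j) = (\<rho> h * weighted_rep \<phi> d \<rho>) $$ (i, j)" .
qed (use rep_carrier_mat [OF \<rho> h] in auto)

lemma weighted_rep_irreducible:
  assumes \<phi>: "class_function G \<phi>" and \<rho>: "irreducible_rep G d \<rho>"
    and z: "(\<Sum>g\<in>carrier G. \<phi> g * character G d \<rho> g) = 0"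
  shows "weighted_rep \<phi> d \<rho> = 0\<^sub>m d d"
proof -
  have h: "\<rho> \<in> hom G (GL d)" and d: "0 < d" using \<rho> by (auto simp: irreducible_rep_iff)
  obtain c where c: "weighted_rep \<phi> d \<rho> = c \<cdot>\<^sub>m 1\<^sub>m d"
    by (rule schur_scalar [OF \<rho> weighted_rep_carrier(1) weighted_rep_commute [OF \<phi> h]])
  have "of_nat d * c = (\<Sum>i<d. weighted_rep \<phi> d \<rho> $$ (i, i))" by (simp add: c)
  also have "\<dots> = (\<Sum>i<d. \<Sum>g\<in>carrier G. \<phi> g * \<rho> g $$ (i, i))"
    by (simp add: weighted_rep_def)
  also have "\<dots> = (\<Sum>g\<in>carrier G. \<Sum>i<d. \<phi> g * \<rho> g $$ (i, i))" by (rule sum.swap)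
  also have "\<dots> = (\<Sum>g\<in>carrier G. \<phi> g * character G d \<rho> g)"
    by (simp add: character_def sum_distrib_left)
  finally have "c = 0" using z d by simp
  thus ?thesis by (auto simp: c)
qed

text \<open>The eigenspace of \<open>T\<close> is a nonzero invariant subspace. Among the injective matrices \<open>X\<close> whose image
is a nonzero invariant subspace of it, one with the least number of columns has an irreducible image; \<open>\<rho>\<close> is
the restricted action in the basis given by the columns of \<open>X\<close>.\<close>

lemma irreducible_constituent:
  assumes R: "R \<in> hom G (GL n)" and T: "T \<in> carrier_mat n n"
    and com: "\<And>g. g \<in> carrier G \<Longrightarrow> T * R g = R g * T" and ev: "eigenvalue T c"
  obtains d \<rho> X where "irreducible_rep G d \<rho>" "X \<in> inj_mats n d"
    "\<And>g. g \<in> carrier G \<Longrightarrow> R g * X = X * \<rho> g" "T * X = c \<cdot>\<^sub>m X"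
proof -
  note r = rep_carrier_mat [OF R]
  define inv_sub
    where "inv_sub = (\<lambda>d X. X \<in> inj_mats n d \<and> 0 < d \<and> T * X = c \<cdot>\<^sub>m X \<and>
    (\<forall>g\<in>carrier G. \<exists>Z\<in>carrier_mat d d. R g * X = X * Z))"
  have ex: "\<exists>d X. inv_sub d X"
  proof -
    let ?S = "T - c \<cdot>\<^sub>m 1\<^sub>m n"
    have S: "?S \<in> carrier_mat n n" using T by auto
    have Sv: "?S *\<^sub>v v = T *\<^sub>v v - c \<cdot>\<^sub>v v" if v: "v \<in> carrier_vec n" for v
      by (simp add: minus_mult_distrib_mat_vec [OF T smult_carrier_mat [OF one_carrier_mat] v] smult_one_mult_vec [OF v])
    have E: "v \<in> {v \<in> carrier_vec n. ?S *\<^sub>v v = 0\<^sub>v n} \<longleftrightarrow> v \<in> carrier_vec n \<and> T *\<^sub>v v = c \<cdot>\<^sub>v v" for v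
    proof (cases "v \<in> carrier_vec n")
      case v: True
      have Tv: "T *\<^sub>v v \<in> carrier_vec n" using T v by simp
      have "T *\<^sub>v v = c \<cdot>\<^sub>v v" if z: "T *\<^sub>v v - c \<cdot>\<^sub>v v = 0\<^sub>v n"
      proof (rule eq_vecI)
        fix i assume "i < dim_vec (c \<cdot>\<^sub>v v)"
        hence i: "i < n" using v by simp
        show "(T *\<^sub>v v) $ i = (c \<cdot>\<^sub>v v) $ i"
          using arg_cong [OF z, of "\<lambda>w. w $ i"] i v Tv by (simp del: index_mult_mat_vec)
      qed (use T v in auto)
      moreover have "T *\<^sub>v v - c \<cdot>\<^sub>v v = 0\<^sub>v n"
        if "T *\<^sub>v v = c \<cdot>\<^sub>v v" using v by (simp add: that)
      ultimately show ?thesis using v Sv by auto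
    qed auto
    obtain d Y where Y: "Y \<in> inj_mats n d"
      and YE: "{v \<in> carrier_vec n. ?S *\<^sub>v v = 0\<^sub>v n} = {Y *\<^sub>v v | v. v \<in> carrier_vec d}"
      by (rule obtain_basis_matrix [OF lin_closed_kernel [OF S]])
    have Yc: "Y \<in> carrier_mat n d" using Y by (simp add: inj_mats_def)
    have TY: "T *\<^sub>v (Y *\<^sub>v v) = c \<cdot>\<^sub>v (Y *\<^sub>v v)" if "v \<in> carrier_vec d"
      for v
      using E [of "Y *\<^sub>v v"] that unfolding YE by auto
    have "T * Y = c \<cdot>\<^sub>m Y"
    proof (rule mat_eqI_mult_vec)
      fix v :: "complex vec" assume v: "v \<in> carrier_vec d"
      have "(c \<cdot>\<^sub>m Y) *\<^sub>v v = c \<cdot>\<^sub>v (Y *\<^sub>v v)"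
        using Yc v by (intro eq_vecI) auto
      thus "(T * Y) *\<^sub>v v = (c \<cdot>\<^sub>m Y) *\<^sub>v v"
        using TY [OF v] by (simp add: assoc_mult_mat_vec [OF T Yc v])
    qed (use T Yc in auto)
    moreover have "0 < d"
    proof (rule ccontr)
      assume "\<not> 0 < d"
      hence d: "d = 0" by simp
      obtain v where v: "v \<in> carrier_vec n" "v \<noteq> 0\<^sub>v n" "T *\<^sub>v v = c \<cdot>\<^sub>v v"
        using ev T by (auto simp: eigenvalue_def eigenvector_def)
      then obtain u where u: "u \<in> carrier_vec d" "v = Y *\<^sub>v u" using E [of v] unfolding YE by blast
      have "Y *\<^sub>v u = 0\<^sub>v n" using u Yc d by (intro eq_vecI) (auto simp: scalar_prod_def)
      with u v show False by simp
    qed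
    moreover have "\<exists>Z\<in>carrier_mat d d. R g * Y = Y * Z" if g: "g \<in> carrier G" for g
    proof -
      have "(R g * Y) *\<^sub>v v \<in> {Y *\<^sub>v u | u. u \<in> carrier_vec d}"
        if v: "v \<in> carrier_vec d" for v
      proof -
        have Yv: "Y *\<^sub>v v \<in> carrier_vec n" using Yc v by simp
        have "T *\<^sub>v (R g *\<^sub>v (Y *\<^sub>v v)) = R g *\<^sub>v (T *\<^sub>v (Y *\<^sub>v v))"
          using assoc_mult_mat_vec [OF T r [OF g] Yv] assoc_mult_mat_vec [OF r [OF g] T Yv] com [OF g] by simp
        also have "\<dots> = c \<cdot>\<^sub>v (R g *\<^sub>v (Y *\<^sub>v v))"
          unfolding TY [OF v] by (rule mult_mat_vec [OF r [OF g] Yv])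
        finally have "R g *\<^sub>v (Y *\<^sub>v v) \<in> {Y *\<^sub>v u | u. u \<in> carrier_vec d}"
          using E [of "R g *\<^sub>v (Y *\<^sub>v v)"] r [OF g] Yv unfolding YE by simp
        thus ?thesis by (simp only: assoc_mult_mat_vec [OF r [OF g] Yc v])
      qed
      with factor_through_image [OF Y mult_carrier_mat [OF r [OF g] Yc]] show ?thesis by blast
    qed
    ultimately show ?thesis using Y unfolding inv_sub_def by blast
  qed
  define d where "d = (LEAST d. \<exists>X. inv_sub d X)"
  have "\<exists>X. inv_sub d X" unfolding d_def by (rule LeastI_ex [OF ex])
  then obtain X where inv_sub: "inv_sub d X" ..
  have minimal: "d \<le> d'" if "inv_sub d' X'" for d' X'
    unfolding d_def using that by (blast intro: Least_le)
  have X: "X \<in> inj_mats n d" and d: "0 < d" and TX: "T * X = c \<cdot>\<^sub>m X"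
    and Z: "\<forall>g\<in>carrier G. \<exists>Z\<in>carrier_mat d d. R g * X = X * Z"
    using inv_sub by (auto simp: inv_sub_def)
  have Xc: "X \<in> carrier_mat n d" using X by (simp add: inj_mats_def)
  have "\<forall>g\<in>carrier G. \<exists>Z. Z \<in> carrier_mat d d \<and> R g * X = X * Z" using Z by blast
  then obtain \<rho>
    where "\<forall>g\<in>carrier G. \<rho> g \<in> carrier_mat d d \<and> R g * X = X * \<rho> g"
    by (rule bchoice [THEN exE])
  hence \<rho>c: "\<And>g. g \<in> carrier G \<Longrightarrow> \<rho> g \<in> carrier_mat d d"
    and RX: "\<And>g. g \<in> carrier G \<Longrightarrow> R g * X = X * \<rho> g" by auto
  have hom: "\<rho> \<in> hom G (GL d)"
  proof (rule rep_homI [OF \<rho>c])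
    fix g h assume g: "g \<in> carrier G" and h: "h \<in> carrier G"
    have "X * \<rho> (g \<otimes> h) = R g * R h * X"
      using g h RX [of "g \<otimes> h"] by (simp add: rep_mult [OF R] del: assoc_mult_mat)
    also have "\<dots> = R g * (X * \<rho> h)"
      using assoc_mult_mat [OF r [OF g] r [OF h] Xc] RX [OF h] by simp
    also have "\<dots> = X * \<rho> g * \<rho> h"
      using assoc_mult_mat [OF r [OF g] Xc \<rho>c [OF h]] RX [OF g] by simp
    also have "\<dots> = X * (\<rho> g * \<rho> h)"
      by (rule assoc_mult_mat [OF Xc \<rho>c [OF g] \<rho>c [OF h]])
    finally show "\<rho> (g \<otimes> h) = \<rho> g * \<rho> h"
      by (rule inj_mats_left_cancel [OF X \<rho>c [OF m_closed [OF g h]] mult_carrier_mat [OF \<rho>c [OF g] \<rho>c [OF h]]])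
  next
    have "X * \<rho> \<one> = X * 1\<^sub>m d" using RX [of \<one>] Xc by (simp add: rep_one [OF R])
    thus "\<rho> \<one> = 1\<^sub>m d"
      by (rule inj_mats_left_cancel [OF X \<rho>c [OF one_closed] one_carrier_mat])
  qed
  have irr: "W = {0\<^sub>v d} \<or> W = carrier_vec d"
    if W: "lin_closed d W" and inv: "\<forall>g\<in>carrier G. \<forall>w\<in>W. \<rho> g *\<^sub>v w \<in> W"
      for W
  proof -
    obtain d' Y where Y: "Y \<in> inj_mats d d'" and WY: "W = {Y *\<^sub>v v | v. v \<in> carrier_vec d'}"
      by (rule obtain_basis_matrix [OF W])
    have Yc: "Y \<in> carrier_mat d d'" using Y by (simp add: inj_mats_def)
    show ?thesis
    proof (cases "d' = 0")
      case True
      have "Y *\<^sub>v v = 0\<^sub>v d" if "v \<in> carrier_vec d'" for v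
        using that Yc True by (intro eq_vecI) (auto simp: scalar_prod_def)
      hence "W \<subseteq> {0\<^sub>v d}" unfolding WY by auto
      thus ?thesis using W by (auto simp: lin_closed_def)
    next
      case False
      have XY: "X * Y \<in> inj_mats n d'"
        using X Y by (rule inj_mats_mult)
      have "T * (X * Y) = c \<cdot>\<^sub>m (X * Y)"
        using assoc_mult_mat [OF T Xc Yc] mult_smult_assoc_mat [OF Xc Yc, of c] TX by simp
      moreover have "\<exists>Z\<in>carrier_mat d' d'. R g * (X * Y) = X * Y * Z" if g: "g \<in> carrier G"
        for g
      proof -
        have "(\<rho> g * Y) *\<^sub>v v \<in> {Y *\<^sub>v u | u. u \<in> carrier_vec d'}"
          if v: "v \<in> carrier_vec d'" for v
        proof -
          have "\<rho> g *\<^sub>v (Y *\<^sub>v v) \<in> W" using inv g v unfolding WY by blast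
          thus ?thesis unfolding WY by (simp only: assoc_mult_mat_vec [OF \<rho>c [OF g] Yc v])
        qed
        then obtain Z where Zc: "Z \<in> carrier_mat d' d'" and Z: "\<rho> g * Y = Y * Z"
          using factor_through_image [OF Y mult_carrier_mat [OF \<rho>c [OF g] Yc]] by blast
        have "R g * (X * Y) = X * \<rho> g * Y" using assoc_mult_mat [OF r [OF g] Xc Yc] RX [OF g] by simp
        also have "\<dots> = X * (Y * Z)"
          unfolding Z [symmetric] by (rule assoc_mult_mat [OF Xc \<rho>c [OF g] Yc])
        also have "\<dots> = X * Y * Z" by (rule assoc_mult_mat [OF Xc Yc Zc, symmetric])
        finally show ?thesis using Zc by blast
      qed
      ultimately have "inv_sub d' (X * Y)" using XY False unfolding inv_sub_def by blast
      hence "d \<le> d'" by (rule minimal)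
      hence "d' = d" using inj_mats_le [OF Y] by simp
      hence "Y \<in> surj_mats d d" using Y by (simp add: inj_mats_square surj_mats_square)
      hence "W = carrier_vec d" using WY surj_mats_iff [OF Yc] \<open>d' = d\<close> by simp
      thus ?thesis ..
    qed
  qed
  have "irreducible_rep G d \<rho>" using hom d irr unfolding irreducible_rep_iff by blast
  thus ?thesis using X RX TX by (rule that)
qed

text \<open>The regular representation, in the basis of group elements enumerated by \<open>e\<close>.\<close>

lemma regular_rep:
  assumes e: "bij_betw e {..<n} (carrier G)"
  shows "(\<lambda>g. mat n n (\<lambda>(i, j). if e i = g \<otimes> e j then 1 else 0 :: complex)) \<in> hom G (GL n)"
    (is "?R \<in> _")
proof (rule rep_homI)
  have ec: "e i \<in> carrier G" if "i < n" for i using e that by (auto simp: bij_betw_def)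
  have inj: "i = j" if "e i = e j" "i < n" "j < n" for i j
    using e that by (auto simp: bij_betw_def inj_on_def)
  show "?R g \<in> carrier_mat n n" for g by simp
  show "?R \<one> = 1\<^sub>m n" using ec inj by (intro eq_matI) auto
  fix g h assume g: "g \<in> carrier G" and h: "h \<in> carrier G"
  show "?R (g \<otimes> h) = ?R g * ?R h"
  proof (rule eq_matI)
    fix i j assume "i < dim_row (?R g * ?R h)" "j < dim_col (?R g * ?R h)"
    hence i: "i < n" and j: "j < n" by auto
    have "h \<otimes> e j \<in> e ` {..<n}" using e h ec [OF j] by (simp add: bij_betw_def)
    then obtain q where q: "q < n" "e q = h \<otimes> e j" by (metis imageE lessThan_iff)
    have "(?R g * ?R h) $$ (i, j) = (\<Sum>p<n. ?R g $$ (i, p) * ?R h $$ (p, j))"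
      by (rule mult_entry) (use i j in auto)
    also have "\<dots> = (\<Sum>p\<in>{q}. ?R g $$ (i, p) * ?R h $$ (p, j))"
    proof (rule sum.mono_neutral_right)
      show "\<forall>p\<in>{..<n} - {q}. ?R g $$ (i, p) * ?R h $$ (p, j) = 0"
        using i j q inj by auto
    qed (use q in auto)
    also have "\<dots> = ?R (g \<otimes> h) $$ (i, j)"
      using i j q g h ec by (simp add: m_assoc)
    finally show "?R (g \<otimes> h) $$ (i, j) = (?R g * ?R h) $$ (i, j)" by simp
  qed auto
qed

text \<open>Completeness. In the regular representation \<open>f\<close> acts by \<open>T\<close>, and \<open>f'\<close> by the adjoint \<open>S\<close>
of \<open>T\<close>. The trace of \<open>T * S\<close> is a sum of squares of absolute values, and not zero if \<open>f\<close> is not zero. So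
\<open>T * S\<close> acts as a nonzero scalar on some irreducible representation, although \<open>f\<close> acts there as zero.\<close>

lemma class_function_eq_0:
  assumes f: "class_function G f"
    and z: "\<And>\<chi>. \<chi> \<in> IrrChar G \<Longrightarrow> (\<Sum>g\<in>carrier G. f g * \<chi> g) = 0"
    and g0: "g0 \<in> carrier G"
  shows "f g0 = 0"
proof (rule ccontr)
  assume nz: "f g0 \<noteq> 0"
  define n where "n = card (carrier G)"
  obtain e where e: "bij_betw e {..<n} (carrier G)"
    using ex_bij_betw_nat_finite [OF finite_carrier] by (auto simp: n_def lessThan_atLeast0)
  have ec: "e i \<in> carrier G" if "i < n" for i using e that by (auto simp: bij_betw_def)
  define R where "R = (\<lambda>g. mat n n (\<lambda>(i, j). if e i = g \<otimes> e j then 1 else 0 :: complex))"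
  have R: "R \<in> hom G (GL n)" unfolding R_def by (rule regular_rep [OF e])
  note r = rep_carrier_mat [OF R]
  have entry: "weighted_rep \<phi> n R $$ (i, j) = \<phi> (e i \<otimes> inv (e j))" if i: "i < n"
    and j: "j < n" for \<phi> i j
  proof -
    have iff: "e i = g \<otimes> e j \<longleftrightarrow> g = e i \<otimes> inv (e j)" if "g \<in> carrier G"
      for g
      using that ec [OF i] ec [OF j] by (metis inv_solve_right)
    have "weighted_rep \<phi> n R $$ (i, j) = (\<Sum>g\<in>carrier G. if g = e i \<otimes> inv (e j) then \<phi> g else 0)"
    proof -
      have "weighted_rep \<phi> n R $$ (i, j) = (\<Sum>g\<in>carrier G. \<phi> g * (if e i = g \<otimes> e j then 1 else 0))"
        using i j by (simp add: weighted_rep_def R_def)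
      also have "\<dots> = (\<Sum>g\<in>carrier G. if g = e i \<otimes> inv (e j) then \<phi> g else 0)"
        by (rule sum.cong) (simp_all add: iff)
      finally show ?thesis .
    qed
    thus ?thesis using ec [OF i] ec [OF j] by simp
  qed
  define f' where "f' = (\<lambda>g. cnj (f (inv g)))"
  have f': "class_function G f'"
    unfolding class_function_def
  proof (intro ballI)
    fix g h assume g: "g \<in> carrier G" and h: "h \<in> carrier G"
    have "inv (h \<otimes> g \<otimes> inv h) = h \<otimes> inv g \<otimes> inv h"
      using g h by (simp add: inv_mult_group m_assoc)
    thus "f' (h \<otimes> g \<otimes> inv h) = f' g" using f g h by (simp add: f'_def class_function_def)
  qed
  let ?T = "weighted_rep f n R" and ?S = "weighted_rep f' n R"
  have H: "?T * ?S \<in> carrier_mat n n"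
    by (rule mult_carrier_mat [OF weighted_rep_carrier(1) weighted_rep_carrier(1)])
  have "mat_trace (?T * ?S) = (\<Sum>i<n. \<Sum>p<n. ?T $$ (i, p) * ?S $$ (p, i))"
    by (simp add: mat_trace_def mult_entry [OF weighted_rep_carrier(1) weighted_rep_carrier(1)] del: index_mult_mat(1))
  also have "\<dots> = (\<Sum>i<n. \<Sum>p<n. of_real ((norm (f (e i \<otimes> inv (e p))))\<^sup>2))"
  proof (intro sum.cong refl)
    fix i p assume "i \<in> {..<n}" "p \<in> {..<n}"
    hence i: "i < n" and p: "p < n" by auto
    have "inv (e p \<otimes> inv (e i)) = e i \<otimes> inv (e p)"
      using ec [OF i] ec [OF p] by (simp add: inv_mult_group)
    thus "?T $$ (i, p) * ?S $$ (p, i) = of_real ((norm (f (e i \<otimes> inv (e p))))\<^sup>2)"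
      by (simp only: entry i p f'_def complex_norm_square)
  qed
  also have "\<dots> = of_real (\<Sum>i<n. \<Sum>p<n. (norm (f (e i \<otimes> inv (e p))))\<^sup>2)" by simp
  finally have tr: "mat_trace (?T * ?S) = of_real (\<Sum>i<n. \<Sum>p<n. (norm (f (e i \<otimes> inv (e p))))\<^sup>2)" .
  obtain i0 p0 where i0: "i0 < n" "e i0 = g0" and p0: "p0 < n" "e p0 = \<one>"
    using e g0 one_closed unfolding bij_betw_def by (metis imageE lessThan_iff)
  have "0 < (norm (f (e i0 \<otimes> inv (e p0))))\<^sup>2" using nz g0 i0 p0 by simp
  also have "\<dots> \<le> (\<Sum>p<n. (norm (f (e i0 \<otimes> inv (e p))))\<^sup>2)"
    using p0 by (intro member_le_sum [where f = "\<lambda>p. (norm (f (e i0 \<otimes> inv (e p))))\<^sup>2"]) auto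
  also have "\<dots> \<le> (\<Sum>i<n. \<Sum>p<n. (norm (f (e i \<otimes> inv (e p))))\<^sup>2)"
    using i0 by (intro member_le_sum [where f = "\<lambda>i. \<Sum>p<n. (norm (f (e i \<otimes> inv (e p))))\<^sup>2"]) (auto intro: sum_nonneg)
  finally have "mat_trace (?T * ?S) \<noteq> 0" unfolding tr of_real_eq_0_iff by simp
  moreover obtain es where es: "\<And>c. c \<in> set es \<Longrightarrow> eigenvalue (?T * ?S) c"
      "\<And>k. mat_trace ((?T * ?S) ^\<^sub>m k) = (\<Sum>c\<leftarrow>es. c ^ k)"
    by (rule trace_pow_eigenvalues [OF H]) (rule that)
  ultimately have "(\<Sum>c\<leftarrow>es. c) \<noteq> 0" using es(2) [of 1] H by simp
  hence "\<exists>c\<in>set es. c \<noteq> 0" by (induction es) auto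
  then obtain c where ev: "eigenvalue (?T * ?S) c" and c: "c \<noteq> 0" using es(1) by blast
  have com: "?T * ?S * R g = R g * (?T * ?S)" if g: "g \<in> carrier G" for g
  proof -
    note w = weighted_rep_carrier(1)
    have "?T * ?S * R g = ?T * (R g * ?S)"
      using assoc_mult_mat [OF w w r [OF g]] weighted_rep_commute [OF f' R g] by simp
    also have "\<dots> = R g * ?T * ?S"
      unfolding assoc_mult_mat [OF w r [OF g] w, symmetric] weighted_rep_commute [OF f R g] by (rule refl)
    also have "\<dots> = R g * (?T * ?S)" by (rule assoc_mult_mat [OF r [OF g] w w])
    finally show ?thesis .
  qed
  obtain d \<rho> X where \<rho>: "irreducible_rep G d \<rho>" and X: "X \<in> inj_mats n d"
    and RX: "\<And>g. g \<in> carrier G \<Longrightarrow> R g * X = X * \<rho> g"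
      and HX: "?T * ?S * X = c \<cdot>\<^sub>m X"
    by (rule irreducible_constituent [OF R H com ev], assumption, rule that)
  have h: "\<rho> \<in> hom G (GL d)" and d: "0 < d" using \<rho> by (auto simp: irreducible_rep_iff)
  from X obtain L
    where Xc: "X \<in> carrier_mat n d" and L: "L \<in> carrier_mat d n" and LX: "L * X = 1\<^sub>m d"
    by (auto simp: inj_mats_def)
  have "character G d \<rho> \<in> IrrChar G" using \<rho> by (auto simp: IrrChar_def)
  hence f0: "weighted_rep f d \<rho> = 0\<^sub>m d d" using weighted_rep_irreducible [OF f \<rho>] z by blast
  note w = weighted_rep_carrier(1)
  have "?T * ?S * X = ?T * (?S * X)" by (rule assoc_mult_mat [OF w w Xc])
  also have "?S * X = X * weighted_rep f' d \<rho>"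
    by (rule weighted_rep_intertwine [OF r rep_carrier_mat [OF h] Xc RX])
  also have "?T * \<dots> = ?T * X * weighted_rep f' d \<rho>" by (rule assoc_mult_mat [OF w Xc w, symmetric])
  also have "?T * X = X * weighted_rep f d \<rho>"
    by (rule weighted_rep_intertwine [OF r rep_carrier_mat [OF h] Xc RX])
  also have "\<dots> = 0\<^sub>m n d" using Xc by (simp add: f0)
  finally have "c \<cdot>\<^sub>m X = 0\<^sub>m n d" using HX by simp
  hence "X = 0\<^sub>m n d" using c Xc by (auto simp: mat_eq_iff)
  hence "1\<^sub>m d = (0\<^sub>m d d :: complex mat)" using LX L by simp
  hence "(1\<^sub>m d :: complex mat) $$ (0, 0) = 0\<^sub>m d d $$ (0, 0)" by simp
  thus False using d by simp
qed

text \<open>Orthogonal functions on a set of \<open>n\<close> elements are at most \<open>n\<close> in number.\<close>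

lemma finite_IrrChar: "finite (IrrChar G)"
proof (rule ccontr)
  define n where "n = card (carrier G)"
  assume "infinite (IrrChar G)"
  then obtain S where S: "S \<subseteq> IrrChar G" "finite S" "card S = Suc n"
    using infinite_arbitrarily_large by blast
  obtain e where e: "bij_betw e {..<n} (carrier G)"
    using ex_bij_betw_nat_finite [OF finite_carrier] by (auto simp: n_def lessThan_atLeast0)
  obtain c where c: "bij_betw c {..<Suc n} S"
    using ex_bij_betw_nat_finite [OF S(2)] S(3) by (auto simp: lessThan_atLeast0)
  \<comment> \<open>The values of \<open>n + 1\<close> characters form a matrix with more columns than rows, but orthogonality gives it a left inverse.\<close>
  define X where "X = mat n (Suc n) (\<lambda>(i, j). c j (inv (e i)))"
  define L where "L = mat (Suc n) n (\<lambda>(j, i). c j (e i) / of_nat n)"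
  have Xc: "X \<in> carrier_mat n (Suc n)" and Lc: "L \<in> carrier_mat (Suc n) n"
    by (simp_all add: X_def L_def)
  have "L * X = 1\<^sub>m (Suc n)"
  proof (rule eq_matI)
    fix j k assume "j < dim_row (1\<^sub>m (Suc n) :: complex mat)" "k < dim_col (1\<^sub>m (Suc n) :: complex mat)"
    hence j: "j < Suc n" and k: "k < Suc n" by simp_all
    have cj: "c j \<in> IrrChar G" "c k \<in> IrrChar G" using c S(1) j k by (auto simp: bij_betw_def)
    have "(L * X) $$ (j, k) = (\<Sum>i<n. c j (e i) / of_nat n * c k (inv (e i)))"
      unfolding mult_entry [OF Lc Xc j k] using j k by (simp add: X_def L_def)
    also have "\<dots> = (\<Sum>g\<in>carrier G. c j g / of_nat n * c k (inv g))"
      by (rule sum.reindex_bij_betw [OF e])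
    also have "\<dots> = (\<Sum>g\<in>carrier G. c j g * c k (inv g)) / of_nat n"
      by (simp add: sum_divide_distrib)
    also have "\<dots> = (if c j = c k then 1 else 0)"
      using one_closed by (auto simp: IrrChar_orthogonality [OF cj] n_def)
    also have "\<dots> = 1\<^sub>m (Suc n) $$ (j, k)"
      using c j k by (auto simp: bij_betw_def inj_on_def)
    finally show "(L * X) $$ (j, k) = 1\<^sub>m (Suc n) $$ (j, k)" .
  qed (use Xc Lc in auto)
  hence "X \<in> inj_mats n (Suc n)" using Xc Lc by (auto simp: inj_mats_def)
  from inj_mats_le [OF this] show False by simp
qed

text \<open>The difference of the two sides, as a function of \<open>g\<close>, is a class function that is orthogonal to
every irreducible character. Counting conjugators instead of dividing by the size of a class keeps the
formula uniform in \<open>g\<close>.\<close>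

lemma column_orthogonality:
  assumes h: "h \<in> carrier G" and g: "g \<in> carrier G"
  shows "(\<Sum>\<chi>\<in>IrrChar G. \<chi> h * \<chi> (inv g)) = of_nat (card {x \<in> carrier G. x \<otimes> h \<otimes> inv x = g})"
proof -
  let ?c = "\<lambda>g. card {x \<in> carrier G. x \<otimes> h \<otimes> inv x = g}"
  define f where "f = (\<lambda>g. of_nat (?c g) - (\<Sum>\<chi>\<in>IrrChar G. \<chi> h * \<chi> (inv g)))"
  have cf: "class_function G f"
    unfolding class_function_def
  proof (intro ballI)
    fix g y assume g: "g \<in> carrier G" and y: "y \<in> carrier G"
    have "inv (y \<otimes> g \<otimes> inv y) = y \<otimes> inv g \<otimes> inv y"
      using g y by (simp add: inv_mult_group m_assoc)
    hence 1: "\<chi> (inv (y \<otimes> g \<otimes> inv y)) = \<chi> (inv g)"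
      if "\<chi> \<in> IrrChar G" for \<chi>
      using IrrChar_conjugate [OF that inv_closed [OF g] y] by simp
    have "bij_betw (\<lambda>x. inv y \<otimes> x) {x \<in> carrier G. x \<otimes> h \<otimes> inv x = y \<otimes> g \<otimes> inv y} {x \<in> carrier G. x \<otimes> h \<otimes> inv x = g}"
    proof (rule bij_betw_byWitness [where f' = "\<lambda>x. y \<otimes> x"])
      show "(\<lambda>x. inv y \<otimes> x) ` {x \<in> carrier G. x \<otimes> h \<otimes> inv x = y \<otimes> g \<otimes> inv y} \<subseteq> {x \<in> carrier G. x \<otimes> h \<otimes> inv x = g}"
      proof clarify
        fix x assume x: "x \<in> carrier G"
          and eq: "x \<otimes> h \<otimes> inv x = y \<otimes> g \<otimes> inv y"
        have "inv y \<otimes> x \<otimes> h \<otimes> inv (inv y \<otimes> x) = inv y \<otimes> (x \<otimes> h \<otimes> inv x) \<otimes> y"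
          using x y h by (simp add: inv_mult_group m_assoc)
        also have "\<dots> = g" unfolding eq using g y by (simp add: m_assoc conjugate_cancel)
        finally show "inv y \<otimes> x \<in> carrier G \<and> inv y \<otimes> x \<otimes> h \<otimes> inv (inv y \<otimes> x) = g" using x y by simp
      qed
      show "(\<lambda>x. y \<otimes> x) ` {x \<in> carrier G. x \<otimes> h \<otimes> inv x = g} \<subseteq> {x \<in> carrier G. x \<otimes> h \<otimes> inv x = y \<otimes> g \<otimes> inv y}"
        using y h by (auto simp: inv_mult_group m_assoc)
    qed (use y in \<open>auto simp: conjugate_cancel\<close>)
    hence "?c (y \<otimes> g \<otimes> inv y) = ?c g" by (rule bij_betw_same_card)
    moreover have "(\<Sum>\<chi>\<in>IrrChar G. \<chi> h * \<chi> (inv (y \<otimes> g \<otimes> inv y))) = (\<Sum>\<chi>\<in>IrrChar G. \<chi> h * \<chi> (inv g))"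
      by (intro sum.cong refl) (simp only: 1)
    ultimately show "f (y \<otimes> g \<otimes> inv y) = f g" by (simp only: f_def)
  qed
  have "(\<Sum>g\<in>carrier G. f g * \<psi> g) = 0" if \<psi>: "\<psi> \<in> IrrChar G" for \<psi>
  proof -
    have "(\<Sum>g\<in>carrier G. of_nat (?c g) * \<psi> g) = (\<Sum>g\<in>carrier G. \<Sum>x | x \<in> carrier G \<and> x \<otimes> h \<otimes> inv x = g. \<psi> (x \<otimes> h \<otimes> inv x))"
      by (intro sum.cong refl) simp
    also have "\<dots> = (\<Sum>x\<in>carrier G. \<psi> (x \<otimes> h \<otimes> inv x))"
      by (rule sum.group) (use h in auto)
    also have "\<dots> = of_nat (card (carrier G)) * \<psi> h"
      using h by (simp add: IrrChar_conjugate [OF \<psi>])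
    finally have 1: "(\<Sum>g\<in>carrier G. of_nat (?c g) * \<psi> g) = of_nat (card (carrier G)) * \<psi> h" .
    have "(\<Sum>g\<in>carrier G. (\<Sum>\<chi>\<in>IrrChar G. \<chi> h * \<chi> (inv g)) * \<psi> g) =
        (\<Sum>g\<in>carrier G. (\<Sum>\<chi>\<in>IrrChar G. \<chi> h * \<chi> g) * \<psi> (inv g))"
      by (rule sum.reindex_bij_witness [where i = "\<lambda>g. inv g" and j = "\<lambda>g. inv g"]) auto
    also have "\<dots> = of_nat (card (carrier G)) * \<psi> h"
      by (rule IrrChar_coefficient [OF finite_IrrChar subset_refl \<psi>])
    finally show ?thesis using 1 by (simp add: f_def left_diff_distrib sum_subtractf)
  qed
  from class_function_eq_0 [OF cf this g] show ?thesis by (simp add: f_def)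
qed

end

section \<open>Counting intertwiners in the two directions\<close>

lemma finite_carrier_mat [simp, intro]: "finite (carrier_mat m n :: 'a::finite mat set)"
proof (rule finite_subset)
  show "carrier_mat m n \<subseteq> mat m n ` PiE ({..<m} \<times> {..<n}) (\<lambda>_. UNIV :: 'a set)"
  proof
    fix A :: "'a mat" assume "A \<in> carrier_mat m n"
    hence "A = mat m n (restrict (\<lambda>ij. A $$ ij) ({..<m} \<times> {..<n}))" by (intro eq_matI) auto
    thus "A \<in> mat m n ` PiE ({..<m} \<times> {..<n}) (\<lambda>_. UNIV)"
      by (rule ssubst) (rule imageI, auto simp: PiE_def extensional_def)
  qed
qed (intro finite_imageI finite_PiE; simp)

lemma finite_inj_mats [simp, intro]: "finite (inj_mats n k :: 'a::{finite,field} mat set)"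
  by (rule finite_subset [OF _ finite_carrier_mat [of n k]]) (auto simp: inj_mats_def)

lemma finite_surj_mats [simp, intro]: "finite (surj_mats n k :: 'a::{finite,field} mat set)"
  by (rule finite_subset [OF _ finite_carrier_mat [of n k]]) (auto simp: surj_mats_def)

lemma finite_GL [simp, intro]: "finite (carrier (GL n) :: 'a::{finite,field} mat set)"
  using finite_inj_mats [of n n] by (simp add: inj_mats_square)

lemma card_carrier_mat_transpose: "card (carrier_mat k n :: 'a mat set) = card (carrier_mat n k :: 'a mat set)"
  by (rule bij_betw_same_card [OF bij_betw_byWitness [where f = transpose_mat and f' = transpose_mat]]) auto

lemma mat_trace_add:
  assumes "A \<in> carrier_mat n n" "B \<in> carrier_mat n n"
  shows "mat_trace (A + B) = mat_trace A + mat_trace B"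
  using assms by (simp add: mat_trace_def sum.distrib)

lemma mat_trace_diff:
  assumes "A \<in> carrier_mat n n" "B \<in> carrier_mat n n"
  shows "mat_trace (A - B) = mat_trace A - mat_trace B"
  using assms by (simp add: mat_trace_def sum_subtractf)

lemma mat_trace_smult: "A \<in> carrier_mat n n \<Longrightarrow> mat_trace (c \<cdot>\<^sub>m A) = c * mat_trace A"
  by (simp add: mat_trace_def sum_distrib_left)

text \<open>\<open>X \<mapsto> mat_trace (Y * X)\<close> is a nonzero linear form, so its fibers are translates of each other.\<close>

lemma card_trace_hyperplane:
  fixes Y :: "'a::{finite,field} mat"
  assumes Y: "Y \<in> carrier_mat k n" and nz: "Y \<noteq> 0\<^sub>m k n"
  shows "card (UNIV :: 'a set) * card {X \<in> carrier_mat n k. mat_trace (Y * X) = 0} = card (carrier_mat n k :: 'a mat set)"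
proof -
  let ?F = "\<lambda>a. {X \<in> carrier_mat n k. mat_trace (Y * X) = a}"
  obtain i j where i: "i < k" and j: "j < n" and y: "Y $$ (i, j) \<noteq> 0"
    using Y nz by (auto simp: mat_eq_iff)
  \<comment> \<open>The matrix \<open>Z\<close> is the multiple of a matrix unit at which the linear form takes the value \<open>1\<close>.\<close>
  define Z where "Z = mat n k (\<lambda>(p, q). if p = j \<and> q = i then 1 / Y $$ (i, j) else 0)"
  have Z: "Z \<in> carrier_mat n k" by (simp add: Z_def)
  have "mat_trace (Y * Z) = (\<Sum>s<k. (Y * Z) $$ (s, s))" using Y by (simp add: mat_trace_def)
  also have "\<dots> = (\<Sum>s<k. if s = i then 1 else 0)"
  proof (rule sum.cong [OF refl])
    fix s assume "s \<in> {..<k}"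
    hence s: "s < k" by simp
    have "(Y * Z) $$ (s, s) = (\<Sum>p<n. if p = j then (if s = i then 1 else 0) else 0)"
      unfolding mult_entry [OF Y Z s s] using s y by (intro sum.cong) (auto simp: Z_def)
    thus "(Y * Z) $$ (s, s) = (if s = i then 1 else 0)" using j by simp
  qed
  finally have tZ: "mat_trace (Y * Z) = 1" using i by simp
  have tr: "mat_trace (Y * (X + a \<cdot>\<^sub>m Z)) = mat_trace (Y * X) + a" if X: "X \<in> carrier_mat n k"
    for X a
  proof -
    have "Y * (X + a \<cdot>\<^sub>m Z) = Y * X + a \<cdot>\<^sub>m (Y * Z)"
      using mult_add_distrib_mat [OF Y X smult_carrier_mat [OF Z]] mult_smult_distrib [OF Y Z] by simp
    moreover have "Y * X \<in> carrier_mat k k" "Y * Z \<in> carrier_mat k k" using Y X Z by auto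
    ultimately show ?thesis by (simp add: mat_trace_add mat_trace_smult tZ)
  qed
  have F: "card (?F a) = card (?F 0)" for a
  proof (rule bij_betw_same_card [OF bij_betw_byWitness [where f = "\<lambda>X. X + (- a) \<cdot>\<^sub>m Z" and f' = "\<lambda>X. X + a \<cdot>\<^sub>m Z"]])
    show "\<forall>X\<in>?F a. X + (- a) \<cdot>\<^sub>m Z + a \<cdot>\<^sub>m Z = X"
      using Z by (auto intro!: eq_matI)
    show "\<forall>X\<in>?F 0. X + a \<cdot>\<^sub>m Z + (- a) \<cdot>\<^sub>m Z = X"
      using Z by (auto intro!: eq_matI)
    show "(\<lambda>X. X + (- a) \<cdot>\<^sub>m Z) ` ?F a \<subseteq> ?F 0" "(\<lambda>X. X + a \<cdot>\<^sub>m Z) ` ?F 0 \<subseteq> ?F a"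
      using Z by (auto simp: tr)
  qed
  have "(\<Sum>a\<in>UNIV. card (?F a)) = (\<Sum>a\<in>(UNIV :: 'a set). card (?F 0))"
    by (intro sum.cong refl F)
  hence "(\<Sum>a\<in>UNIV. card (?F a)) = card (UNIV :: 'a set) * card (?F 0)"
    by (simp only: sum_constant of_nat_id)
  moreover have "(\<Sum>a\<in>UNIV. card (?F a)) = card (carrier_mat n k :: 'a mat set)"
    using sum.group [of "carrier_mat n k :: 'a mat set" UNIV "\<lambda>X. mat_trace (Y * X)" "\<lambda>_. 1 :: nat"] by simp
  ultimately show ?thesis by simp
qed

text \<open>Pairs \<open>(M, X)\<close> with \<open>mat_trace (\<phi> M * X) = 0\<close> are counted by \<open>M\<close>: each \<open>M\<close> in the kernel of \<open>\<phi>\<close> has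
\<open>T\<close> partners, each other \<open>M\<close> has \<open>T\<close> divided by the order of the field. The summand \<open>K * T\<close> on the
left replaces a subtraction of natural numbers.\<close>

lemma sum_card_trace_orthogonal:
  fixes \<phi> :: "'a::{finite,field} mat \<Rightarrow> 'a mat"
  assumes \<phi>: "\<And>M. M \<in> carrier_mat k n \<Longrightarrow> \<phi> M \<in> carrier_mat k n"
  defines "T \<equiv> card (carrier_mat k n :: 'a mat set)"
  defines "K \<equiv> card {M \<in> carrier_mat k n. \<phi> M = 0\<^sub>m k n}"
  shows "card (UNIV :: 'a set) * (\<Sum>M\<in>carrier_mat k n. card {X \<in> carrier_mat n k. mat_trace (\<phi> M * X) = 0}) + K * T =
    card (UNIV :: 'a set) * K * T + T * T"
proof -
  let ?q = "card (UNIV :: 'a set)" and ?c = "\<lambda>M. card {X \<in> carrier_mat n k. mat_trace (\<phi> M * X) = 0}"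
  let ?N = "{M \<in> carrier_mat k n. \<phi> M = 0\<^sub>m k n}"
  have T: "card (carrier_mat n k :: 'a mat set) = T" by (simp add: T_def card_carrier_mat_transpose)
  have c: "?q * ?c M + (if M \<in> ?N then T else 0) = T + (if M \<in> ?N then ?q * T else 0)"
    if M: "M \<in> carrier_mat k n" for M
  proof (cases "\<phi> M = 0\<^sub>m k n")
    case True
    have "mat_trace (0\<^sub>m k n * X) = 0" if "X \<in> carrier_mat n k" for X :: "'a mat"
      using that by (simp add: mat_trace_def)
    hence "{X \<in> carrier_mat n k. mat_trace (\<phi> M * X) = 0} = carrier_mat n k" by (auto simp: True)
    thus ?thesis using M True T by simp
  next
    case False
    thus ?thesis using card_trace_hyperplane [OF \<phi> [OF M] False] T by simp
  qed
  have "?q * (\<Sum>M\<in>carrier_mat k n. ?c M) + K * T = (\<Sum>M\<in>carrier_mat k n. ?q * ?c M + (if M \<in> ?N then T else 0))"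
    by (simp add: sum.distrib sum_distrib_left K_def sum.If_cases Int_def)
  also have "\<dots> = (\<Sum>M\<in>carrier_mat k n. T + (if M \<in> ?N then ?q * T else 0))"
    by (rule sum.cong [OF refl c])
  also have "\<dots> = ?q * K * T + T * T"
    by (simp add: sum.distrib K_def sum.If_cases Int_def T_def)
  finally show ?thesis .
qed

text \<open>Adjoint maps yield the same number of orthogonal pairs, and this number determines the size of
the kernel.\<close>

lemma card_kernel_adjoint:
  fixes \<phi> \<psi> :: "'a::{finite,field} mat \<Rightarrow> 'a mat"
  assumes \<phi>: "\<And>M. M \<in> carrier_mat k n \<Longrightarrow> \<phi> M \<in> carrier_mat k n"
    and \<psi>: "\<And>X. X \<in> carrier_mat n k \<Longrightarrow> \<psi> X \<in> carrier_mat n k"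
    and adj: "\<And>M X. M \<in> carrier_mat k n \<Longrightarrow> X \<in> carrier_mat n k \<Longrightarrow> mat_trace (\<phi> M * X) = mat_trace (M * \<psi> X)"
  shows "card {M \<in> carrier_mat k n. \<phi> M = 0\<^sub>m k n} = card {X \<in> carrier_mat n k. \<psi> X = 0\<^sub>m n k}"
proof -
  let ?q = "card (UNIV :: 'a set)" and ?T = "card (carrier_mat k n :: 'a mat set)"
  let ?K = "card {M \<in> carrier_mat k n. \<phi> M = 0\<^sub>m k n}" and ?L = "card {X \<in> carrier_mat n k. \<psi> X = 0\<^sub>m n k}"
  define S where "S = (\<Sum>M\<in>carrier_mat k n. card {X \<in> carrier_mat n k. mat_trace (\<phi> M * X) = 0})"
  have "S = (\<Sum>M\<in>carrier_mat k n. \<Sum>X\<in>carrier_mat n k. if mat_trace (\<phi> M * X) = 0 then 1 else 0)"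
    unfolding S_def by (simp add: sum.If_cases Int_def)
  also have "\<dots> = (\<Sum>X\<in>carrier_mat n k. \<Sum>M\<in>carrier_mat k n. if mat_trace (\<phi> M * X) = 0 then 1 else 0)"
    by (rule sum.swap)
  also have "\<dots> = (\<Sum>X\<in>carrier_mat n k. \<Sum>M\<in>carrier_mat k n. if mat_trace (\<psi> X * M) = 0 then 1 else 0)"
  proof (intro sum.cong refl)
    fix X M :: "'a mat" assume X: "X \<in> carrier_mat n k" and M: "M \<in> carrier_mat k n"
    show "(if mat_trace (\<phi> M * X) = 0 then 1 else 0) = (if mat_trace (\<psi> X * M) = 0 then 1 else 0 :: nat)"
      using adj [OF M X] mat_trace_comm [OF M \<psi> [OF X]] by simp
  qed
  also have "\<dots> = (\<Sum>X\<in>carrier_mat n k. card {M \<in> carrier_mat k n. mat_trace (\<psi> X * M) = 0})"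
    by (simp add: sum.If_cases Int_def)
  finally have S: "S = (\<Sum>X\<in>carrier_mat n k. card {M \<in> carrier_mat k n. mat_trace (\<psi> X * M) = 0})" .
  have 1: "?q * S + ?K * ?T = ?q * ?K * ?T + ?T * ?T"
    using sum_card_trace_orthogonal [OF \<phi>] by (simp add: S_def)
  have 2: "?q * S + ?L * ?T = ?q * ?L * ?T + ?T * ?T"
    using sum_card_trace_orthogonal [OF \<psi>] by (simp add: S card_carrier_mat_transpose [of n k])
  have "card {0, 1 :: 'a} \<le> ?q" by (intro card_mono) auto
  hence q: "int ?q - 1 \<noteq> 0" by simp
  have "carrier_mat k n \<noteq> ({} :: 'a mat set)" by (auto intro: zero_carrier_mat)
  hence T: "int ?T \<noteq> 0" by (simp add: card_eq_0_iff)
  have "(int ?q - 1) * int ?T * int ?K = (int ?q - 1) * int ?T * int ?L"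
    using arg_cong [OF 1, of int] arg_cong [OF 2, of int] by (simp add: algebra_simps)
  thus ?thesis using q T by simp
qed

text \<open>The intertwiners from the space acted on by \<open>C\<close> to the one acted on by \<open>B\<close>. The sizes
are explicit because matrices do not determine them in the type.\<close>

definition hom_mats :: "nat \<Rightarrow> nat \<Rightarrow> 'a::field mat \<Rightarrow> 'a mat \<Rightarrow> 'a mat set" where
  "hom_mats k n B C = {M \<in> carrier_mat k n. M * C = B * M}"

lemma finite_hom_mats [simp, intro]: "finite (hom_mats k n B C :: 'a::{finite,field} mat set)"
  by (rule finite_subset [OF _ finite_carrier_mat [of k n]]) (auto simp: hom_mats_def)

lemma hom_matsD: "M \<in> hom_mats k n B C \<Longrightarrow> M \<in> carrier_mat k n" "M \<in> hom_mats k n B C \<Longrightarrow> M * C = B * M"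
  by (simp_all add: hom_mats_def)

lemma minus_eq_0_mat_iff:
  assumes "A \<in> carrier_mat k n" "B \<in> carrier_mat k n"
  shows "A - B = 0\<^sub>m k n \<longleftrightarrow> A = (B :: 'a::ab_group_add mat)"
  using assms by (auto simp: mat_eq_iff)

lemma card_hom_mats_sym:
  fixes B C :: "'a::{finite,field} mat"
  assumes B: "B \<in> carrier_mat k k" and C: "C \<in> carrier_mat n n"
  shows "card (hom_mats k n B C) = card (hom_mats n k C B)"
proof -
  have "card {M \<in> carrier_mat k n. M * C - B * M = 0\<^sub>m k n} = card {X \<in> carrier_mat n k. C * X - X * B = 0\<^sub>m n k}"
  proof (rule card_kernel_adjoint)
    fix M X :: "'a mat" assume M: "M \<in> carrier_mat k n" and X: "X \<in> carrier_mat n k"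
    have c: "M * C \<in> carrier_mat k n" "B * M \<in> carrier_mat k n" "C * X \<in> carrier_mat n k" "X * B \<in> carrier_mat n k"
      "M * X \<in> carrier_mat k k" "M * (C * X) \<in> carrier_mat k k" "B * (M * X) \<in> carrier_mat k k" "M * X * B \<in> carrier_mat k k"
      using M X B C by (auto intro!: mult_carrier_mat)
    have "(M * C - B * M) * X = M * (C * X) - B * (M * X)"
      unfolding minus_mult_distrib_mat [OF c(1,2) X] assoc_mult_mat [OF M C X] assoc_mult_mat [OF B M X] ..
    moreover have "M * (C * X - X * B) = M * (C * X) - M * X * B"
      unfolding mult_minus_distrib_mat [OF M c(3,4)] assoc_mult_mat [OF M X B] ..
    ultimately show "mat_trace ((M * C - B * M) * X) = mat_trace (M * (C * X - X * B))"
      using mat_trace_comm [OF B c(5)] by (simp only: mat_trace_diff [OF c(6,7)] mat_trace_diff [OF c(6,8)])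
  qed (use B C in auto)
  moreover have "{M \<in> carrier_mat k n. M * C - B * M = 0\<^sub>m k n} = hom_mats k n B C"
    using B C by (auto simp: hom_mats_def minus_eq_0_mat_iff [OF mult_carrier_mat mult_carrier_mat])
  moreover have "{X \<in> carrier_mat n k. C * X - X * B = 0\<^sub>m n k} = hom_mats n k C B"
    using B C by (auto simp: hom_mats_def minus_eq_0_mat_iff [OF mult_carrier_mat mult_carrier_mat])
  ultimately show ?thesis by simp
qed

section \<open>Intertwiners of a given rank\<close>

text \<open>The intertwiners of rank \<open>j\<close>, described by a factorization through \<open>K\<^sup>j\<close>.\<close>

definition rank_part :: "nat \<Rightarrow> nat \<Rightarrow> nat \<Rightarrow> 'a::field mat \<Rightarrow> 'a mat \<Rightarrow> 'a mat set" where
  "rank_part j k n B C = {M \<in> hom_mats k n B C. \<exists>X\<in>inj_mats k j. \<exists>Y\<in>surj_mats j n. M = X * Y}"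

lemma rank_part_finite [simp, intro]: "finite (rank_part j k n B C :: 'a::{finite,field} mat set)"
  by (rule finite_subset [OF _ finite_hom_mats [of k n B C]]) (auto simp: rank_part_def)

text \<open>The rank is well defined: \<open>j\<close> is at most \<open>j'\<close>, since \<open>Y' * R\<close>, with \<open>R\<close> a right inverse of \<open>Y\<close>, is
injective.\<close>

lemma rank_factorization_le:
  assumes X: "X \<in> inj_mats k j"
    and Y: "Y \<in> surj_mats j n" and X': "X' \<in> inj_mats k j'" and Y': "Y' \<in> surj_mats j' n"
    and eq: "X * Y = X' * Y'"
  shows "j \<le> j'"
proof -
  from X obtain L
    where L: "X \<in> carrier_mat k j" "L \<in> carrier_mat j k" "L * X = 1\<^sub>m j"
      by (auto simp: inj_mats_def)
  from Y obtain R
    where R: "Y \<in> carrier_mat j n" "R \<in> carrier_mat n j" "Y * R = 1\<^sub>m j"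
      by (auto simp: surj_mats_def)
  note c = inj_matsD [OF X'] surj_matsD [OF Y']
  have "(L * X') * (Y' * R) = L * (X' * Y' * R)"
    unfolding assoc_mult_mat [OF L(2) c(1) mult_carrier_mat [OF c(2) R(2)]] assoc_mult_mat [OF c R(2)] ..
  also have "X' * Y' * R = X"
    unfolding eq [symmetric] assoc_mult_mat [OF L(1) R(1,2)] R(3) using L(1) by simp
  finally have "Y' * R \<in> inj_mats j' j"
    unfolding inj_mats_def using L R c by (auto intro!: bexI [of _ "L * X'"])
  thus ?thesis by (rule inj_mats_le)
qed

lemma card_hom_mats_rank_parts:
  fixes B C :: "'a::{finite,field} mat"
  assumes p: "k \<le> p \<or> n \<le> p"
  shows "card (hom_mats k n B C) = (\<Sum>j\<le>p. card (rank_part j k n B C))"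
proof -
  have "hom_mats k n B C = (\<Union>j\<le>p. rank_part j k n B C)"
  proof (intro equalityI subsetI)
    fix M assume M: "M \<in> hom_mats k n B C"
    obtain j X Y where *: "X \<in> inj_mats k j" "Y \<in> surj_mats j n" "M = X * Y"
      by (rule rank_factorization [OF hom_matsD(1) [OF M]])
    have "j \<le> p" using p inj_mats_le [OF *(1)] surj_mats_le [OF *(2)] by auto
    moreover have "M \<in> rank_part j k n B C" using M * by (auto simp: rank_part_def)
    ultimately show "M \<in> (\<Union>j\<le>p. rank_part j k n B C)" by blast
  qed (auto simp: rank_part_def)
  moreover have "rank_part i k n B C \<inter> rank_part j k n B C = {}" if "i \<noteq> j" for i j
  proof (rule ccontr)
    assume "rank_part i k n B C \<inter> rank_part j k n B C \<noteq> {}"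
    then obtain X Y X' Y' :: "'a mat"
      where "X \<in> inj_mats k i" "Y \<in> surj_mats i n" "X' \<in> inj_mats k j" "Y' \<in> surj_mats j n"
      and eq: "X * Y = X' * Y'" by (auto simp: rank_part_def)
    hence "i \<le> j" "j \<le> i"
      using rank_factorization_le [OF _ _ _ _ eq] rank_factorization_le [OF _ _ _ _ eq [symmetric]] by blast+
    thus False using that by simp
  qed
  ultimately show ?thesis by (simp add: card_UN_disjoint)
qed

text \<open>\<open>GL j\<close> acts simply transitively on the rank factorizations of a matrix.\<close>

lemma card_factorizations:
  fixes X0 Y0 :: "'a::{finite,field} mat"
  assumes X0: "X0 \<in> inj_mats k j" and Y0: "Y0 \<in> surj_mats j n"
  shows "card {(X, Y). X \<in> inj_mats k j \<and> Y \<in> surj_mats j n \<and> X * Y = X0 * Y0} = card (carrier (GL j) :: 'a mat set)"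
proof -
  interpret GL: group "GL j :: 'a mat monoid" by (rule group_GL)
  from X0 obtain L0
    where L0: "X0 \<in> carrier_mat k j" "L0 \<in> carrier_mat j k" "L0 * X0 = 1\<^sub>m j"
      by (auto simp: inj_mats_def)
  from Y0 obtain R0
    where R0: "Y0 \<in> carrier_mat j n" "R0 \<in> carrier_mat n j" "Y0 * R0 = 1\<^sub>m j"
      by (auto simp: surj_mats_def)
  let ?F = "{(X, Y). X \<in> inj_mats k j \<and> Y \<in> surj_mats j n \<and> X * Y = X0 * Y0}"
  let ?f = "\<lambda>a. (X0 * a, inv\<^bsub>GL j\<^esub> a * Y0)"
  have "bij_betw ?f (carrier (GL j)) ?F"
    unfolding bij_betw_def
  proof (intro conjI equalityI subsetI)
    show "inj_on ?f (carrier (GL j))"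
    proof (rule inj_onI)
      fix a b assume "a \<in> carrier (GL j)" "b \<in> carrier (GL j)" and eq: "?f a = ?f b"
      hence "a \<in> carrier_mat j j" "b \<in> carrier_mat j j" by (simp_all add: carrier_GL_mat)
      moreover have "X0 * a = X0 * b" using eq by (simp only: prod.inject)
      ultimately show "a = b" by (rule inj_mats_left_cancel [OF X0])
    qed
  next
    fix z assume "z \<in> ?f ` carrier (GL j)"
    then obtain a where a: "a \<in> carrier (GL j)" and z: "z = ?f a" by blast
    let ?b = "inv\<^bsub>GL j\<^esub> a"
    have b: "?b \<in> carrier (GL j)" using a by simp
    have ab: "a * ?b = 1\<^sub>m j" using GL.r_inv [OF a] by simp
    note ca = carrier_GL_mat [OF a] and cb = carrier_GL_mat [OF b]
    have a': "a \<in> inj_mats j j" using a unfolding inj_mats_square .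
    have b': "?b \<in> surj_mats j j" using b unfolding surj_mats_square .
    have "X0 * a * (?b * Y0) = X0 * (a * ?b * Y0)"
      unfolding assoc_mult_mat [OF L0(1) ca mult_carrier_mat [OF cb R0(1)]] assoc_mult_mat [OF ca cb R0(1)] ..
    hence "X0 * a * (?b * Y0) = X0 * Y0" using R0(1) by (simp add: ab)
    moreover have "X0 * a \<in> inj_mats k j" by (rule inj_mats_mult [OF X0 a'])
    moreover have "?b * Y0 \<in> surj_mats j n" by (rule surj_mats_mult [OF b' Y0])
    ultimately show "z \<in> ?F" by (simp add: z)
  next
    fix z assume "z \<in> ?F"
    then obtain X Y
      where z: "z = (X, Y)" and X: "X \<in> inj_mats k j" and Y: "Y \<in> surj_mats j n"
        and eq: "X * Y = X0 * Y0"
      by blast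
    note cX = inj_matsD [OF X] and cY = surj_matsD [OF Y]
    \<comment> \<open>The only candidate for the element that carries \<open>(X0, Y0)\<close> to \<open>(X, Y)\<close>.\<close>
    define a where "a = L0 * X"
    have ca: "a \<in> carrier_mat j j" unfolding a_def by (rule mult_carrier_mat [OF L0(2) cX])
    have aY: "a * Y = Y0"
      using assoc_mult_mat [OF L0(2) cX cY] left_inverse_cancel [OF L0 R0(1)] eq unfolding a_def by simp
    have "a * (Y * R0) = 1\<^sub>m j" using assoc_mult_mat [OF ca cY R0(2)] aY R0(3) by simp
    hence "a \<in> surj_mats j j"
      unfolding surj_mats_def using ca mult_carrier_mat [OF cY R0(2)] by blast
    hence a: "a \<in> carrier (GL j)" by (simp add: surj_mats_square)
    have "X0 * a * Y = X * Y" using assoc_mult_mat [OF L0(1) ca cY] aY eq by simp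
    hence "X0 * a = X" by (rule surj_mats_right_cancel [OF Y mult_carrier_mat [OF L0(1) ca] cX])
    moreover have "inv\<^bsub>GL j\<^esub> a * Y0 = Y"
    proof -
      have b: "inv\<^bsub>GL j\<^esub> a \<in> carrier_mat j j" using a by (auto intro: carrier_GL_mat)
      have "inv\<^bsub>GL j\<^esub> a * a = 1\<^sub>m j" using GL.l_inv [OF a] by simp
      from left_inverse_cancel [OF ca b this cY] show ?thesis by (simp only: aY)
    qed
    ultimately have "z = ?f a" by (simp add: z)
    thus "z \<in> ?f ` carrier (GL j)" using a by blast
  qed
  from bij_betw_same_card [OF this] show ?thesis by (rule sym)
qed

text \<open>Through a factorization \<open>X * Y\<close> of an intertwiner the two actions induce the same
matrix \<open>D\<close> on the middle space.\<close>

lemma factor_intertwines: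
  fixes B C :: "'a::{finite,field} mat"
  assumes B: "B \<in> carrier_mat k k" and C: "C \<in> carrier_mat n n"
    and X: "X \<in> inj_mats k j" and Y: "Y \<in> surj_mats j n"
  shows "X * Y \<in> hom_mats k n B C \<longleftrightarrow> (\<exists>D\<in>carrier_mat j j. Y \<in> hom_mats j n D C \<and> X \<in> hom_mats k j B D)"
proof
  note cX = inj_matsD [OF X] and cY = surj_matsD [OF Y]
  from X obtain L
    where L: "X \<in> carrier_mat k j" "L \<in> carrier_mat j k" "L * X = 1\<^sub>m j"
      by (auto simp: inj_mats_def)
  assume h: "X * Y \<in> hom_mats k n B C"
  have cBX: "B * X \<in> carrier_mat k j" by (rule mult_carrier_mat [OF B cX])
  define D where "D = L * (B * X)"
  have D: "D \<in> carrier_mat j j" unfolding D_def by (rule mult_carrier_mat [OF L(2) cBX])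
  have e: "X * (Y * C) = B * X * Y"
    using hom_matsD(2) [OF h] assoc_mult_mat [OF cX cY C] assoc_mult_mat [OF B cX cY] by simp
  have "Y * C = L * (X * (Y * C))" by (rule left_inverse_cancel [OF L mult_carrier_mat [OF cY C], symmetric])
  also have "\<dots> = D * Y" unfolding e D_def by (rule assoc_mult_mat [OF L(2) cBX cY, symmetric])
  finally have YC: "Y * C = D * Y" .
  have "X * D * Y = B * X * Y" using assoc_mult_mat [OF cX D cY] YC e by simp
  hence "X * D = B * X" by (rule surj_mats_right_cancel [OF Y mult_carrier_mat [OF cX D] cBX])
  with YC D cX cY show "\<exists>D\<in>carrier_mat j j. Y \<in> hom_mats j n D C \<and> X \<in> hom_mats k j B D"
    by (auto simp: hom_mats_def)
next
  note cX = inj_matsD [OF X] and cY = surj_matsD [OF Y]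
  assume "\<exists>D\<in>carrier_mat j j. Y \<in> hom_mats j n D C \<and> X \<in> hom_mats k j B D"
  then obtain D where D: "D \<in> carrier_mat j j" and Y': "Y * C = D * Y" and X': "X * D = B * X"
    by (auto simp: hom_mats_def)
  have "X * Y * C = X * D * Y" using assoc_mult_mat [OF cX cY C] assoc_mult_mat [OF cX D cY] Y' by simp
  also have "\<dots> = B * (X * Y)" unfolding X' by (rule assoc_mult_mat [OF B cX cY])
  finally show "X * Y \<in> hom_mats k n B C" using mult_carrier_mat [OF cX cY] by (simp add: hom_mats_def)
qed

text \<open>Triples \<open>(D, X, Y)\<close> are counted in two ways, using that \<open>D\<close> is determined by \<open>Y\<close>.\<close>

lemma card_rank_part:
  fixes B C :: "'a::{finite,field} mat"
  assumes B: "B \<in> carrier_mat k k" and C: "C \<in> carrier_mat n n"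
  shows "card (carrier (GL j) :: 'a mat set) * card (rank_part j k n B C) =
    (\<Sum>D\<in>carrier_mat j j. card (hom_mats j n D C \<inter> surj_mats j n) * card (hom_mats k j B D \<inter> inj_mats k j))"
proof -
  define P where "P = {(X, Y). X \<in> inj_mats k j \<and> Y \<in> surj_mats j n \<and> X * Y \<in> hom_mats k n B C}"
  have finP: "finite P"
    by (rule finite_subset [of _ "inj_mats k j \<times> surj_mats j n"]) (auto simp: P_def)
  have "card P = (\<Sum>M\<in>rank_part j k n B C. card {z \<in> P. (case z of (X, Y) \<Rightarrow> X * Y) = M})"
  proof -
    have "(\<lambda>(X, Y). X * Y) ` P \<subseteq> rank_part j k n B C" by (auto simp: P_def rank_part_def)
    from sum.group [OF finP rank_part_finite this, of "\<lambda>_. 1 :: nat"] show ?thesis by simp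
  qed
  also have "\<dots> = (\<Sum>M\<in>rank_part j k n B C. card (carrier (GL j) :: 'a mat set))"
  proof (rule sum.cong [OF refl])
    fix M assume M: "M \<in> rank_part j k n B C"
    then obtain X0 Y0
      where 0: "X0 \<in> inj_mats k j" "Y0 \<in> surj_mats j n" "M = X0 * Y0" by (auto simp: rank_part_def)
    have "{z \<in> P. (case z of (X, Y) \<Rightarrow> X * Y) = M} = {(X, Y). X \<in> inj_mats k j \<and> Y \<in> surj_mats j n \<and> X * Y = X0 * Y0}"
    proof -
      have "X0 * Y0 \<in> hom_mats k n B C" using M by (simp add: rank_part_def 0(3))
      thus ?thesis unfolding 0(3) P_def by force
    qed
    thus "card {z \<in> P. (case z of (X, Y) \<Rightarrow> X * Y) = M} = card (carrier (GL j) :: 'a mat set)"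
      using card_factorizations [OF 0(1,2)] by simp
  qed
  finally have 1: "card P = card (carrier (GL j) :: 'a mat set) * card (rank_part j k n B C)" by simp
  let ?Q = "\<lambda>D. (hom_mats k j B D \<inter> inj_mats k j) \<times> (hom_mats j n D C \<inter> surj_mats j n)"
  have "P = (\<Union>D\<in>carrier_mat j j. ?Q D)"
  proof (intro equalityI subsetI)
    fix z assume "z \<in> P"
    then obtain X Y
      where z: "z = (X, Y)" "X \<in> inj_mats k j" "Y \<in> surj_mats j n" "X * Y \<in> hom_mats k n B C"
      unfolding P_def by blast
    with factor_intertwines [OF B C z(2,3)] show "z \<in> (\<Union>D\<in>carrier_mat j j. ?Q D)" by blast
  next
    fix z assume "z \<in> (\<Union>D\<in>carrier_mat j j. ?Q D)"
    then obtain X Y D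
      where D: "D \<in> carrier_mat j j" and z: "z = (X, Y)" "X \<in> inj_mats k j" "Y \<in> surj_mats j n"
      "X \<in> hom_mats k j B D" "Y \<in> hom_mats j n D C" by blast
    with factor_intertwines [OF B C z(2,3)] have "X * Y \<in> hom_mats k n B C" by blast
    thus "z \<in> P" using z unfolding P_def by simp
  qed
  moreover have "card (\<Union>D\<in>carrier_mat j j. ?Q D) = (\<Sum>D\<in>carrier_mat j j. card (?Q D))"
  proof (rule card_UN_disjoint)
    show "\<forall>D\<in>carrier_mat j j. \<forall>D'\<in>carrier_mat j j. D \<noteq> D' \<longrightarrow> ?Q D \<inter> ?Q D' = {}"
    proof (intro ballI impI, rule ccontr)
      fix D D' :: "'a mat" assume D: "D \<in> carrier_mat j j" "D' \<in> carrier_mat j j"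
        and ne: "D \<noteq> D'"
      assume "?Q D \<inter> ?Q D' \<noteq> {}"
      then obtain Y
        where Y: "Y \<in> surj_mats j n" "Y \<in> hom_mats j n D C" "Y \<in> hom_mats j n D' C" by blast
      have "D * Y = D' * Y" using hom_matsD(2) [OF Y(2)] hom_matsD(2) [OF Y(3)] by (rule subst)
      from surj_mats_right_cancel [OF Y(1) D this] ne show False by simp
    qed
  qed auto
  ultimately have "card P = (\<Sum>D\<in>carrier_mat j j. card (?Q D))" by simp
  also have "\<dots> = (\<Sum>D\<in>carrier_mat j j. card (hom_mats j n D C \<inter> surj_mats j n) * card (hom_mats k j B D \<inter> inj_mats k j))"
    by (simp only: card_cartesian_product mult.commute)
  finally show ?thesis unfolding 1 .
qed

lemma rank_part_surj:
  fixes B C :: "'a::{finite,field} mat"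
  shows "rank_part k k n B C = hom_mats k n B C \<inter> surj_mats k n"
proof (intro equalityI subsetI)
  fix M assume "M \<in> rank_part k k n B C"
  then obtain X Y
    where M: "M \<in> hom_mats k n B C" "X \<in> inj_mats k k" "Y \<in> surj_mats k n" "M = X * Y"
    by (auto simp: rank_part_def)
  have "X \<in> surj_mats k k" using M(2) by (simp add: inj_mats_square surj_mats_square)
  from surj_mats_mult [OF this M(3)] M(1,4) show "M \<in> hom_mats k n B C \<inter> surj_mats k n" by simp
next
  fix M assume M: "M \<in> hom_mats k n B C \<inter> surj_mats k n"
  have "1\<^sub>m k \<in> inj_mats k k" by (auto simp: inj_mats_def intro!: bexI [of _ "1\<^sub>m k"])
  moreover have "M = 1\<^sub>m k * M" using M by (auto simp: hom_mats_def)
  ultimately show "M \<in> rank_part k k n B C" using M unfolding rank_part_def by blast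
qed

lemma rank_part_inj:
  fixes B C :: "'a::{finite,field} mat"
  shows "rank_part k n k C B = hom_mats n k C B \<inter> inj_mats n k"
proof (intro equalityI subsetI)
  fix M assume "M \<in> rank_part k n k C B"
  then obtain X Y
    where M: "M \<in> hom_mats n k C B" "X \<in> inj_mats n k" "Y \<in> surj_mats k k" "M = X * Y"
    by (auto simp: rank_part_def)
  have "Y \<in> inj_mats k k" using M(3) by (simp add: inj_mats_square surj_mats_square)
  from inj_mats_mult [OF M(2) this] M(1,4) show "M \<in> hom_mats n k C B \<inter> inj_mats n k" by simp
next
  fix M assume M: "M \<in> hom_mats n k C B \<inter> inj_mats n k"
  have "1\<^sub>m k \<in> surj_mats k k" by (auto simp: surj_mats_def intro!: bexI [of _ "1\<^sub>m k"])
  moreover have "M = M * 1\<^sub>m k" using M by (auto simp: hom_mats_def)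
  ultimately show "M \<in> rank_part k n k C B" using M unfolding rank_part_def by blast
qed

text \<open>Among all intertwiners the two directions are equinumerous by duality. Those of rank \<open>j < k\<close> are
equinumerous by induction, applied to \<open>D\<close> and \<open>C\<close> and to \<open>D\<close> and \<open>B\<close>, and the remaining ones are
those of full rank.\<close>

lemma card_surj_eq_card_inj:
  fixes B C :: "'a::{finite,field} mat"
  assumes "B \<in> carrier_mat k k" and "C \<in> carrier_mat n n"
  shows "card (hom_mats k n B C \<inter> surj_mats k n) = card (hom_mats n k C B \<inter> inj_mats n k)"
  using assms
proof (induction k arbitrary: n B C rule: less_induct)
  case (less k)
  note B = less.prems(1) and C = less.prems(2)
  have lower: "card (rank_part j k n B C) = card (rank_part j n k C B)" if j: "j < k" for j
  proof -
    have "card (carrier (GL j) :: 'a mat set) * card (rank_part j k n B C) =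
        (\<Sum>D\<in>carrier_mat j j. card (hom_mats j n D C \<inter> surj_mats j n) * card (hom_mats k j B D \<inter> inj_mats k j))"
      by (rule card_rank_part [OF B C])
    also have "\<dots> = (\<Sum>D\<in>carrier_mat j j. card (hom_mats j k D B \<inter> surj_mats j k) * card (hom_mats n j C D \<inter> inj_mats n j))"
    proof (rule sum.cong [OF refl])
      fix D :: "'a mat" assume D: "D \<in> carrier_mat j j"
      show "card (hom_mats j n D C \<inter> surj_mats j n) * card (hom_mats k j B D \<inter> inj_mats k j) =
          card (hom_mats j k D B \<inter> surj_mats j k) * card (hom_mats n j C D \<inter> inj_mats n j)"
        unfolding less.IH [OF j D C] less.IH [OF j D B] by (rule mult.commute)
    qed
    also have "\<dots> = card (carrier (GL j) :: 'a mat set) * card (rank_part j n k C B)"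
      by (rule card_rank_part [OF C B, symmetric])
    finally have eq: "card (carrier (GL j) :: 'a mat set) * card (rank_part j k n B C) =
      card (carrier (GL j) :: 'a mat set) * card (rank_part j n k C B)" .
    have "1\<^sub>m j \<in> carrier (GL j :: 'a mat monoid)"
      by (auto simp: carrier_GL_iff_left_inverse intro!: bexI [of _ "1\<^sub>m j"])
    hence "card (carrier (GL j) :: 'a mat set) \<noteq> 0" by (auto simp: card_eq_0_iff)
    thus ?thesis using eq by simp
  qed
  have "(\<Sum>j\<le>k. card (rank_part j k n B C)) = (\<Sum>j\<le>k. card (rank_part j n k C B))"
  proof -
    have "(\<Sum>j\<le>k. card (rank_part j k n B C)) = card (hom_mats k n B C)"
      by (rule card_hom_mats_rank_parts [symmetric]) simp
    also have "\<dots> = card (hom_mats n k C B)" by (rule card_hom_mats_sym [OF B C])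
    also have "\<dots> = (\<Sum>j\<le>k. card (rank_part j n k C B))"
      by (rule card_hom_mats_rank_parts) simp
    finally show ?thesis .
  qed
  moreover have "(\<Sum>j<k. card (rank_part j k n B C)) = (\<Sum>j<k. card (rank_part j n k C B))"
    by (intro sum.cong refl lower) simp
  ultimately have "card (rank_part k k n B C) = card (rank_part k n k C B)"
    by (simp add: lessThan_Suc_atMost [symmetric])
  thus ?case by (simp add: rank_part_surj rank_part_inj)
qed

section \<open>Parabolic induction counts injective intertwiners\<close>

text \<open>Right multiplication by this matrix selects the first \<open>m\<close> columns; for \<open>m\<close> larger than \<open>N\<close> it
pads with zeros.\<close>

definition first_cols :: "nat \<Rightarrow> nat \<Rightarrow> 'k::field mat" where
  "first_cols N m = mat N m (\<lambda>(i, j). if i = j then 1 else 0)"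

lemma first_cols_carrier [simp]:
  "first_cols N m \<in> carrier_mat N m" "dim_row (first_cols N m) = N" "dim_col (first_cols N m) = m"
  by (simp_all add: first_cols_def)

lemma mult_first_cols':
  assumes x: "x \<in> carrier_mat n N" and i: "i < n" and j: "j < m"
  shows "(x * first_cols N m) $$ (i, j) = (if j < N then x $$ (i, j) else 0)"
proof -
  have "(x * first_cols N m) $$ (i, j) = (\<Sum>p<N. if p = j then x $$ (i, p) else 0)"
    unfolding mult_entry [OF x first_cols_carrier(1) i j] using j
    by (intro sum.cong refl) (auto simp: first_cols_def)
  thus ?thesis by simp
qed

lemma mult_first_cols:
  assumes "x \<in> carrier_mat n N" and "m \<le> N" and "i < n" and "j < m"
  shows "(x * first_cols N m) $$ (i, j) = x $$ (i, j)"
  using mult_first_cols' [OF assms(1,3,4)] assms(2,4) by simp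

lemma first_cols_mult:
  assumes b: "b \<in> carrier_mat m k" and i: "i < N" and j: "j < k"
  shows "(first_cols N m * b) $$ (i, j) = (if i < m then b $$ (i, j) else 0)"
proof -
  have "(first_cols N m * b) $$ (i, j) = (\<Sum>p<m. if p = i then b $$ (p, j) else 0)"
    unfolding mult_entry [OF first_cols_carrier(1) b i j] using i
    by (intro sum.cong refl) (auto simp: first_cols_def)
  thus ?thesis by simp
qed

lemma first_cols_inj:
  assumes "m \<le> N"
  shows "(first_cols N m :: 'k::field mat) \<in> inj_mats N m"
proof -
  have "first_cols m N * first_cols N m = (1\<^sub>m m :: 'k mat)"
  proof (rule eq_matI)
    fix i j assume "i < dim_row (1\<^sub>m m :: 'k mat)" "j < dim_col (1\<^sub>m m :: 'k mat)"
    hence i: "i < m" and j: "j < m" by simp_all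
    show "(first_cols m N * first_cols N m) $$ (i, j) = (1\<^sub>m m :: 'k mat) $$ (i, j)"
      unfolding mult_first_cols [OF first_cols_carrier(1) assms i j] using i j assms
      by (simp add: first_cols_def)
  qed (auto simp: first_cols_def)
  thus ?thesis unfolding inj_mats_def using first_cols_carrier(1) by blast
qed

lemma carrier_GL_iff_det: "A \<in> carrier (GL n) \<longleftrightarrow> A \<in> carrier_mat n n \<and> det A \<noteq> 0"
proof
  assume A: "A \<in> carrier (GL n)"
  hence "A \<in> Units (ring_mat TYPE('a) n ())" by (simp add: GL_def units_of_def)
  from unit_imp_det_non_zero [OF this] carrier_GL_mat [OF A] show "A \<in> carrier_mat n n \<and> det A \<noteq> 0" by simp
next
  assume "A \<in> carrier_mat n n \<and> det A \<noteq> 0"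
  hence "A \<in> Units (ring_mat TYPE('a) n ())" by (intro det_non_zero_imp_unit) auto
  thus "A \<in> carrier (GL n)" by (simp add: GL_def units_of_def)
qed

text \<open>The parabolic subgroup stabilizes the span of the first \<open>m\<close> unit vectors. The lower right
block is then automatically invertible, by the determinant.\<close>

lemma parabolic_iff:
  fixes y :: "'k::field mat"
  shows "y \<in> parabolic m r \<longleftrightarrow>
    y \<in> carrier (GL (m + r)) \<and> (\<exists>b\<in>carrier (GL m). y * first_cols (m + r) m = first_cols (m + r) m * b)"
proof
  assume "y \<in> parabolic m r"
  then obtain a b d where y: "y = four_block_mat a b (0\<^sub>m r m) d" and a: "a \<in> carrier (GL m)"
    and b: "b \<in> carrier_mat m r" and d: "d \<in> carrier (GL r)"
    unfolding parabolic_def by blast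
  note ca = carrier_GL_mat [OF a] and cd = carrier_GL_mat [OF d]
  have cy: "y \<in> carrier_mat (m + r) (m + r)" unfolding y by (rule four_block_carrier_mat [OF ca cd])
  have "det y = det a * det d" unfolding y by (rule det_four_block_mat_lower_left_zero [OF ca b refl cd])
  hence "y \<in> carrier (GL (m + r))" using a d cy by (simp add: carrier_GL_iff_det)
  moreover have "y * first_cols (m + r) m = first_cols (m + r) m * a"
  proof (rule eq_matI)
    fix i j assume "i < dim_row (first_cols (m + r) m * a)" "j < dim_col (first_cols (m + r) m * a)"
    hence i: "i < m + r" and j: "j < m" using ca by (auto simp: first_cols_def)
    show "(y * first_cols (m + r) m) $$ (i, j) = (first_cols (m + r) m * a) $$ (i, j)"
      unfolding mult_first_cols [OF cy le_add1 i j] first_cols_mult [OF ca i j]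
      unfolding y using i j ca cd by auto
  qed (use cy ca in \<open>auto simp: first_cols_def\<close>)
  ultimately show "y \<in> carrier (GL (m + r)) \<and> (\<exists>b\<in>carrier (GL m). y * first_cols (m + r) m = first_cols (m + r) m * b)"
    using a by blast
next
  assume "y \<in> carrier (GL (m + r)) \<and> (\<exists>b\<in>carrier (GL m). y * first_cols (m + r) m = first_cols (m + r) m * b)"
  then obtain b where y: "y \<in> carrier (GL (m + r))" and b: "b \<in> carrier (GL m)"
    and eq: "y * first_cols (m + r) m = first_cols (m + r) m * b" by blast
  note cy = carrier_GL_mat [OF y] and cb = carrier_GL_mat [OF b]
  have e: "y $$ (i, j) = (if i < m then b $$ (i, j) else 0)" if i: "i < m + r" and j: "j < m" for i j
    using arg_cong [OF eq, of "\<lambda>A. A $$ (i, j)"]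
    unfolding mult_first_cols [OF cy le_add1 i j] first_cols_mult [OF cb i j] .
  define c where "c = mat m r (\<lambda>(i, j). y $$ (i, j + m))"
  define d where "d = mat r r (\<lambda>(i, j). y $$ (i + m, j + m))"
  have c: "c \<in> carrier_mat m r" and d: "d \<in> carrier_mat r r" by (simp_all add: c_def d_def)
  have y4: "y = four_block_mat b c (0\<^sub>m r m) d"
    using cy cb by (intro eq_matI) (auto simp: e c_def d_def)
  have "det y = det b * det d" unfolding y4 by (rule det_four_block_mat_lower_left_zero [OF cb c refl d])
  hence "d \<in> carrier (GL r)" using y d by (simp add: carrier_GL_iff_det)
  thus "y \<in> parabolic m r" unfolding parabolic_def using y4 b c by blast
qed

lemma split_block_corner:
  assumes y: "y \<in> carrier_mat (m + r) (m + r)" and b: "b \<in> carrier_mat m m"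
    and eq: "y * first_cols (m + r) m = first_cols (m + r) m * b"
  shows "fst (split_block y m m) = (b :: 'k::field mat)"
proof (rule eq_matI)
  fix i j assume "i < dim_row b" "j < dim_col b"
  hence i: "i < m" and j: "j < m" using b by auto
  hence i': "i < m + r" by simp
  have "y $$ (i, j) = b $$ (i, j)"
    using arg_cong [OF eq, of "\<lambda>A. A $$ (i, j)"] i
    unfolding mult_first_cols [OF y le_add1 i' j] first_cols_mult [OF b i' j] by simp
  thus "fst (split_block y m m) $$ (i, j) = b $$ (i, j)" using i j by (simp add: split_block_def Let_def)
qed (use b in \<open>auto simp: split_block_def Let_def\<close>)

text \<open>The number of completions of a given injective \<open>N\<close> by \<open>m\<close> matrix to an invertible one, here
for the standard frame.\<close>

definition frame_count :: "nat \<Rightarrow> nat \<Rightarrow> 'a::{finite,field} itself \<Rightarrow> nat" where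
  "frame_count N m _ = card {x \<in> carrier (GL N :: 'a mat monoid). x * first_cols N m = first_cols N m}"

lemma frame_count_pos: "0 < frame_count N m TYPE('a::{finite,field})"
proof -
  have "1\<^sub>m N \<in> carrier (GL N :: 'a mat monoid)"
    by (simp add: carrier_GL_iff_det)
  moreover have "1\<^sub>m N * first_cols N m = (first_cols N m :: 'a mat)" by (simp add: first_cols_def)
  ultimately have "1\<^sub>m N \<in> {x \<in> carrier (GL N :: 'a mat monoid). x * first_cols N m = first_cols N m}" by simp
  moreover have "finite {x \<in> carrier (GL N :: 'a mat monoid). x * first_cols N m = first_cols N m}"
    by simp
  ultimately show ?thesis unfolding frame_count_def by (auto simp: card_gt_0_iff)
qed

text \<open>\<open>GL N\<close> acts transitively on injective \<open>N\<close> by \<open>m\<close> matrices, and the sets in question are cosets of the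
stabilizer of the standard one.\<close>

lemma card_frames:
  fixes X :: "'a::{finite,field} mat"
  assumes m: "m \<le> N" and X: "X \<in> inj_mats N m"
  shows "card {x \<in> carrier (GL N). x * first_cols N m = X} = frame_count N m TYPE('a)"
proof -
  interpret GL: group "GL N :: 'a mat monoid" by (rule group_GL)
  obtain x0 where x0: "x0 \<in> carrier (GL N)" and cols: "\<forall>j<m. col x0 j = col X j"
    using extend_to_GL [OF X] by blast
  let ?y = "inv\<^bsub>GL N\<^esub> x0"
  have y: "?y \<in> carrier (GL N)" using x0 by simp
  note cx = carrier_GL_mat [OF x0] and cy = carrier_GL_mat [OF y] and cX = inj_matsD [OF X]
  have yx: "?y * x0 = 1\<^sub>m N" and xy: "x0 * ?y = 1\<^sub>m N"
    using GL.l_inv [OF x0] GL.r_inv [OF x0] by simp_all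
  have x0E: "x0 * first_cols N m = X"
  proof (rule eq_matI)
    fix i j assume "i < dim_row X" "j < dim_col X"
    hence i: "i < N" and j: "j < m" using cX by auto
    have "col x0 j $ i = col X j $ i" using cols j by simp
    thus "(x0 * first_cols N m) $$ (i, j) = X $$ (i, j)"
      unfolding mult_first_cols [OF cx m i j] using i j cx cX m by simp
  qed (use cx cX in \<open>auto simp: first_cols_def\<close>)
  have "bij_betw (\<lambda>x. x0 * x) {x \<in> carrier (GL N). x * first_cols N m = first_cols N m}
      {x \<in> carrier (GL N). x * first_cols N m = X}"
  proof (rule bij_betw_byWitness [where f' = "\<lambda>x. ?y * x"])
    show "\<forall>x\<in>{x \<in> carrier (GL N). x * first_cols N m = first_cols N m}. ?y * (x0 * x) = x"
      using left_inverse_cancel [OF cx cy yx] carrier_GL_mat by blast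
    show "\<forall>x\<in>{x \<in> carrier (GL N). x * first_cols N m = X}. x0 * (?y * x) = x"
      using left_inverse_cancel [OF cy cx xy] carrier_GL_mat by blast
    show "(\<lambda>x. x0 * x) ` {x \<in> carrier (GL N). x * first_cols N m = first_cols N m}
        \<subseteq> {x \<in> carrier (GL N). x * first_cols N m = X}"
    proof clarify
      fix x :: "'a mat" assume x: "x \<in> carrier (GL N)" and e: "x * first_cols N m = first_cols N m"
      have "x0 * x * first_cols N m = X"
        using assoc_mult_mat [OF cx carrier_GL_mat [OF x] first_cols_carrier(1)] e x0E by simp
      moreover have "x0 * x \<in> carrier (GL N)" using GL.m_closed [OF x0 x] by simp
      ultimately show "x0 * x \<in> carrier (GL N) \<and> x0 * x * first_cols N m = X" by simp
    qed
    show "(\<lambda>x. ?y * x) ` {x \<in> carrier (GL N). x * first_cols N m = X}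
        \<subseteq> {x \<in> carrier (GL N). x * first_cols N m = first_cols N m}"
    proof clarify
      fix x :: "'a mat" assume x: "x \<in> carrier (GL N)" and e: "X = x * first_cols N m"
      have "?y * x * first_cols N m = ?y * (x0 * first_cols N m)"
        using assoc_mult_mat [OF cy carrier_GL_mat [OF x] first_cols_carrier(1)] e x0E by simp
      also have "\<dots> = first_cols N m" by (rule left_inverse_cancel [OF cx cy yx first_cols_carrier(1)])
      finally have "?y * x * first_cols N m = first_cols N m" .
      moreover have "?y * x \<in> carrier (GL N)" using GL.m_closed [OF y x] by simp
      ultimately show "?y * x \<in> carrier (GL N) \<and> ?y * x * first_cols N m = first_cols N m" by simp
    qed
  qed
  from bij_betw_same_card [OF this] show ?thesis unfolding frame_count_def by (rule sym)
qed

lemma card_frames_in: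
  fixes S :: "'a::{finite,field} mat set"
  assumes m: "m \<le> N" and S: "S \<subseteq> inj_mats N m"
  shows "card {x \<in> carrier (GL N). x * first_cols N m \<in> S} = card S * frame_count N m TYPE('a)"
proof -
  let ?A = "{x \<in> carrier (GL N). x * first_cols N m \<in> S}"
  have fS: "finite S" by (rule finite_subset [OF S finite_inj_mats])
  have "card ?A = (\<Sum>X\<in>S. card {x \<in> ?A. x * first_cols N m = X})"
  proof -
    have "finite ?A" "(\<lambda>x. x * first_cols N m) ` ?A \<subseteq> S" by auto
    from sum.group [OF this(1) fS this(2), of "\<lambda>_. 1 :: nat"] show ?thesis by simp
  qed
  also have "\<dots> = (\<Sum>X\<in>S. frame_count N m TYPE('a))"
  proof (rule sum.cong [OF refl])
    fix X assume X: "X \<in> S"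
    hence "{x \<in> ?A. x * first_cols N m = X} = {x \<in> carrier (GL N). x * first_cols N m = X}" by auto
    thus "card {x \<in> ?A. x * first_cols N m = X} = frame_count N m TYPE('a)"
      using card_frames [OF m, of X] X S by auto
  qed
  finally show ?thesis by simp
qed

lemma card_parabolic:
  "card (parabolic m r :: 'a::{finite,field} mat set) =
    card (carrier (GL m) :: 'a mat set) * frame_count (m + r) m TYPE('a)"
proof -
  let ?E = "first_cols (m + r) m :: 'a mat"
  have E: "?E \<in> inj_mats (m + r) m" by (rule first_cols_inj) simp
  have "(parabolic m r :: 'a mat set) = {x \<in> carrier (GL (m + r)). x * ?E \<in> (\<lambda>b. ?E * b) ` carrier (GL m)}"
    by (auto simp: parabolic_iff)
  moreover have "(\<lambda>b. ?E * b) ` carrier (GL m) \<subseteq> inj_mats (m + r) m"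
  proof clarify
    fix b :: "'a mat" assume "b \<in> carrier (GL m)"
    hence "b \<in> inj_mats m m" unfolding inj_mats_square .
    thus "?E * b \<in> inj_mats (m + r) m" by (rule inj_mats_mult [OF E])
  qed
  moreover have "card ((\<lambda>b. ?E * b) ` carrier (GL m)) = card (carrier (GL m) :: 'a mat set)"
  proof (rule card_image, rule inj_onI)
    fix b b' :: "'a mat" assume "b \<in> carrier (GL m)" "b' \<in> carrier (GL m)" "?E * b = ?E * b'"
    thus "b = b'" by (intro inj_mats_left_cancel [OF E, of b m b'] carrier_GL_mat)
  qed
  ultimately show ?thesis
    using card_frames_in [where m = m and N = "m + r" and S = "(\<lambda>b. ?E * b) ` carrier (GL m)"] by simp
qed

lemma fr_count_eq_surj:
  "fr_count m B N g = of_nat (card (hom_mats m N B g \<inter> surj_mats m N))"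
proof -
  have "{M \<in> carrier_mat m N. M * g = B * M \<and> vec_space.rank m M = m} = hom_mats m N B g \<inter> surj_mats m N"
    using full_rank_iff_surj_mats by (auto simp: hom_mats_def surj_mats_def)
  thus ?thesis by (simp only: fr_count_def)
qed

lemma fr_count_eq_inj:
  fixes g :: "'a::{finite,field} mat"
  assumes B: "B \<in> carrier_mat m m" and g: "g \<in> carrier_mat N N"
  shows "fr_count m B N g = of_nat (card {X \<in> inj_mats N m. g * X = X * B})"
proof -
  have "{X \<in> inj_mats N m. g * X = X * B} = hom_mats N m g B \<inter> inj_mats N m"
    by (auto simp: hom_mats_def inj_mats_def)
  thus ?thesis
    using card_surj_eq_card_inj [OF B g] by (simp only: fr_count_eq_surj)
qed

text \<open>Group the sum that defines the induced character by the corner \<open>B\<close>, and inside each group by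
the first \<open>m\<close> columns of the conjugating matrix. The number of completions of these columns cancels
against the same factor in the order of the parabolic subgroup.\<close>

lemma circ_one_fun_eq:
  fixes g :: "'a::{finite,field} mat"
  assumes m: "m \<le> N" and g: "g \<in> carrier (GL N)"
  shows "circ_one_fun m \<chi> N g =
    (\<Sum>B\<in>carrier (GL m). \<chi> B * fr_count m B N g) / of_nat (card (carrier (GL m :: 'a mat monoid)))"
proof -
  define r where "r = N - m"
  have N: "N = m + r" using m by (simp add: r_def)
  interpret GL: group "GL N :: 'a mat monoid" by (rule group_GL)
  let ?E = "first_cols N m :: 'a mat"
  have E: "?E \<in> inj_mats N m" by (rule first_cols_inj [OF m])
  note cg = carrier_GL_mat [OF g] and cE = first_cols_carrier(1) [of N m, where 'a = 'a]
  define y where "y = (\<lambda>x. inv\<^bsub>GL N\<^esub> x * g * x)"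
  have yc: "y x \<in> carrier (GL N)" if "x \<in> carrier (GL N)" for x
    using GL.m_closed [OF GL.m_closed [OF GL.inv_closed [OF that] g] that] by (simp add: y_def)
  \<comment> \<open>The conjugate of \<open>g\<close> by \<open>x\<close> has corner \<open>b\<close> exactly if the first columns of \<open>x\<close> intertwine \<open>g\<close> and \<open>b\<close>.\<close>
  have yE: "y x * ?E = ?E * b \<longleftrightarrow> g * (x * ?E) = x * ?E * b"
    if x: "x \<in> carrier (GL N)" and b: "b \<in> carrier_mat m m" for x b
  proof -
    let ?i = "inv\<^bsub>GL N\<^esub> x"
    have i: "?i \<in> carrier (GL N)" using x by simp
    note cx = carrier_GL_mat [OF x] and ci = carrier_GL_mat [OF i]
    have ix: "?i * x = 1\<^sub>m N" and xi: "x * ?i = 1\<^sub>m N"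
      using GL.l_inv [OF x] GL.r_inv [OF x] by simp_all
    have xE: "x * ?E \<in> carrier_mat N m" by (rule mult_carrier_mat [OF cx cE])
    have gxE: "g * (x * ?E) \<in> carrier_mat N m" by (rule mult_carrier_mat [OF cg xE])
    have Eb: "?E * b \<in> carrier_mat N m" by (rule mult_carrier_mat [OF cE b])
    have 1: "y x * ?E = ?i * (g * (x * ?E))"
      unfolding y_def assoc_mult_mat [OF mult_carrier_mat [OF ci cg] cx cE] assoc_mult_mat [OF ci cg xE] ..
    show ?thesis
    proof
      assume "y x * ?E = ?E * b"
      hence "x * (?i * (g * (x * ?E))) = x * (?E * b)" unfolding 1 by (rule arg_cong)
      thus "g * (x * ?E) = x * ?E * b"
        unfolding left_inverse_cancel [OF ci cx xi gxE] assoc_mult_mat [OF cx cE b] .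
    next
      assume e: "g * (x * ?E) = x * ?E * b"
      show "y x * ?E = ?E * b"
        unfolding 1 e assoc_mult_mat [OF cx cE b] by (rule left_inverse_cancel [OF cx ci ix Eb])
    qed
  qed
  define Q where "Q = {x \<in> carrier (GL N). y x \<in> parabolic m r}"
  define corner where "corner = (\<lambda>x. fst (split_block (y x) m m))"
  have Q: "x \<in> Q \<longleftrightarrow> x \<in> carrier (GL N) \<and> (\<exists>b\<in>carrier (GL m). y x * ?E = ?E * b)" for x
    using yc [of x] unfolding Q_def parabolic_iff N [symmetric] by blast
  have corner: "corner x = b" if "x \<in> carrier (GL N)" "b \<in> carrier (GL m)" "y x * ?E = ?E * b" for x b
    unfolding corner_def
    using split_block_corner [of "y x" m r b] carrier_GL_mat [OF yc [OF that(1)]] carrier_GL_mat [OF that(2)] that(3)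
    unfolding N [symmetric] by simp
  have fin: "finite Q" unfolding Q_def by simp
  have sub: "corner ` Q \<subseteq> carrier (GL m)"
  proof clarify
    fix x assume "x \<in> Q"
    then obtain b
      where "x \<in> carrier (GL N)" "b \<in> carrier (GL m)" "y x * ?E = ?E * b" unfolding Q by blast
    thus "corner x \<in> carrier (GL m)" using corner [of x b] by simp
  qed
  have fib: "card {x \<in> Q. corner x = b} = card {X \<in> inj_mats N m. g * X = X * b} * frame_count N m TYPE('a)"
    if b: "b \<in> carrier (GL m)" for b
  proof -
    have "{x \<in> Q. corner x = b} = {x \<in> carrier (GL N). y x * ?E = ?E * b}"
      using corner b unfolding Q by auto
    also have "\<dots> = {x \<in> carrier (GL N). x * ?E \<in> {X \<in> inj_mats N m. g * X = X * b}}"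
    proof -
      have "x * ?E \<in> inj_mats N m" if "x \<in> carrier (GL N)" for x
      proof -
        have "x \<in> inj_mats N N" using that unfolding inj_mats_square .
        thus ?thesis by (rule inj_mats_mult [OF _ E])
      qed
      thus ?thesis using yE [OF _ carrier_GL_mat [OF b]] by blast
    qed
    finally show ?thesis using card_frames_in [OF m, of "{X \<in> inj_mats N m. g * X = X * b}"] by auto
  qed
  have "circ_one_fun m \<chi> N g = (\<Sum>x\<in>Q. \<chi> (corner x)) / of_nat (card (parabolic m r :: 'a mat set))"
    using m unfolding circ_one_fun_def parabolic_ind_def induced_def r_def [symmetric] N [symmetric]
    by (simp add: Q_def y_def corner_def case_prod_beta)
  also have "(\<Sum>x\<in>Q. \<chi> (corner x)) = (\<Sum>b\<in>carrier (GL m). \<Sum>x\<in>{x \<in> Q. corner x = b}. \<chi> (corner x))"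
    by (rule sum.group [OF fin finite_GL sub, symmetric])
  also have "\<dots> = (\<Sum>b\<in>carrier (GL m). of_nat (card {x \<in> Q. corner x = b}) * \<chi> b)"
    by (intro sum.cong refl) simp
  also have "\<dots> = (\<Sum>b\<in>carrier (GL m). \<chi> b * fr_count m b N g * of_nat (frame_count N m TYPE('a)))"
    by (intro sum.cong refl) (simp add: fib fr_count_eq_inj [OF carrier_GL_mat cg])
  also have "\<dots> = (\<Sum>b\<in>carrier (GL m). \<chi> b * fr_count m b N g) * of_nat (frame_count N m TYPE('a))"
    by (simp add: sum_distrib_right)
  finally show ?thesis
    using frame_count_pos [of N m, where 'a = 'a] unfolding card_parabolic N [symmetric] by simp
qed

section \<open>Evaluation at block sums with a generic second block\<close>

text \<open>The companion matrix of the polynomial \<open>t ^ r - t + 1\<close>: it sends the basis vector \<open>e\<^sub>j\<close> to \<open>e\<^sub>j\<^sub>+\<^sub>1\<close> and the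
last one to \<open>e\<^sub>1 - e\<^sub>0\<close>.\<close>

definition generic :: "nat \<Rightarrow> 'k::field mat" where
  "generic r = mat r r (\<lambda>(i, j). if Suc j < r then (if i = Suc j then 1 else 0)
     else (if i = 1 then 1 else 0) - (if i = 0 then 1 else 0))"

lemma generic_carrier [simp]:
  "generic r \<in> carrier_mat r r" "dim_row (generic r) = r" "dim_col (generic r) = r"
  by (simp_all add: generic_def)

lemma mult_generic:
  assumes A: "A \<in> carrier_mat n r" and r: "1 < r" and i: "i < n" and j: "j < r"
  shows "(A * generic r) $$ (i, j) = (if Suc j < r then A $$ (i, Suc j) else A $$ (i, 1) - A $$ (i, 0))"
proof (cases "Suc j < r")
  case True
  have "(A * generic r) $$ (i, j) = (\<Sum>p<r. if p = Suc j then A $$ (i, p) else 0)"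
    unfolding mult_entry [OF A generic_carrier(1) i j] using j True
    by (intro sum.cong refl) (auto simp: generic_def)
  thus ?thesis using True by simp
next
  case False
  have "(A * generic r) $$ (i, j) =
      (\<Sum>p<r. (if p = 1 then A $$ (i, p) else 0) - (if p = 0 then A $$ (i, p) else 0))"
    unfolding mult_entry [OF A generic_carrier(1) i j] using j False
    by (intro sum.cong refl) (auto simp: generic_def)
  also have "\<dots> = A $$ (i, 1) - A $$ (i, 0)"
    using r by (simp add: sum_subtractf)
  finally show ?thesis using False by simp
qed

lemma generic_GL:
  assumes r: "1 < r"
  shows "(generic r :: 'k::field mat) \<in> carrier (GL r)"
proof -
  \<comment> \<open>The inverse sends \<open>e\<^sub>0\<close> to \<open>e\<^sub>0 - e\<^sub>r\<^sub>-\<^sub>1\<close> and shifts the other basis vectors down.\<close>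
  define K where "K = mat r r (\<lambda>(i, j). if j = 0 then (if i = 0 then 1 else 0) - (if Suc i = r then 1 else 0)
    else if Suc i = j then 1 else 0 :: 'k)"
  have K: "K \<in> carrier_mat r r" by (simp add: K_def)
  have "K * generic r = 1\<^sub>m r"
  proof (rule eq_matI)
    fix i j assume "i < dim_row (1\<^sub>m r :: 'k mat)" "j < dim_col (1\<^sub>m r :: 'k mat)"
    hence i: "i < r" and j: "j < r" by simp_all
    show "(K * generic r) $$ (i, j) = (1\<^sub>m r :: 'k mat) $$ (i, j)"
      unfolding mult_generic [OF K r i j] using i j r by (auto simp: K_def)
  qed (simp_all add: K_def generic_def)
  thus ?thesis unfolding carrier_GL_iff_left_inverse using K generic_carrier(1) by blast
qed

lemma finite_group_GL: "finite_group (GL m :: 'a::{finite,field} mat monoid)"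
  using group_GL by (intro finite_group.intro finite_group_axioms.intro) auto

text \<open>The exponent \<open>r\<close> is \<open>1\<close> modulo the order of \<open>GL m\<close>, so that \<open>B\<close> satisfies \<open>B ^ r = B\<close>, and the polynomial
\<open>t ^ r - t + 1\<close> takes the value \<open>1\<close> at \<open>B\<close> while it annihilates the companion matrix. In terms of
the columns \<open>v\<^sub>j\<close> of \<open>M\<close>: \<open>v\<^sub>j = B ^ j v\<^sub>0\<close>, hence the last one is \<open>v\<^sub>0\<close>, and
\<open>v\<^sub>1 - v\<^sub>0 = B v\<^sub>0 = v\<^sub>1\<close>.\<close>

lemma generic_no_intertwiner:
  fixes B :: "'a::{finite,field} mat"
  assumes B: "B \<in> carrier (GL m)" and k: "0 < k"
    and r: "r = Suc (k * card (carrier (GL m :: 'a mat monoid)))"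
    and M: "M \<in> carrier_mat m r" and eq: "M * generic r = B * M"
  shows "M = 0\<^sub>m m r"
proof -
  interpret GL: finite_group "GL m :: 'a mat monoid" by (rule finite_group_GL)
  let ?e = "card (carrier (GL m :: 'a mat monoid))"
  have r1: "1 < r" using k GL.card_carrier_pos by (simp add: r)
  have cB: "B \<in> carrier_mat m m" by (rule carrier_GL_mat [OF B])
  have P: "B [^]\<^bsub>GL m\<^esub> j \<in> carrier_mat m m" for j :: nat
    by (rule carrier_GL_mat) (use B in simp)
  have colc: "col M j \<in> carrier_vec m" for j using M by (intro carrier_vecI) simp
  have step: "B *\<^sub>v col M j = (if Suc j < r then col M (Suc j) else col M 1 - col M 0)" if j: "j < r"
    for j
  proof (rule eq_vecI)
    fix i assume "i < dim_vec (if Suc j < r then col M (Suc j) else col M 1 - col M 0)"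
    hence i: "i < m" using M by (auto split: if_splits)
    have "(B *\<^sub>v col M j) $ i = (B * M) $$ (i, j)" using i j cB M by simp
    also have "\<dots> = (if Suc j < r then M $$ (i, Suc j) else M $$ (i, 1) - M $$ (i, 0))"
      unfolding eq [symmetric] by (rule mult_generic [OF M r1 i j])
    also have "\<dots> = (if Suc j < r then col M (Suc j) else col M 1 - col M 0) $ i"
      using i M r1 by simp
    finally show "(B *\<^sub>v col M j) $ i = (if Suc j < r then col M (Suc j) else col M 1 - col M 0) $ i" .
  qed (use cB M in auto)
  have pow: "col M j = B [^]\<^bsub>GL m\<^esub> j *\<^sub>v col M 0" if "j < r" for j
    using that
  proof (induction j)
    case 0
    show ?case using colc [of 0] by simp
  next
    case (Suc j)
    have "col M (Suc j) = B *\<^sub>v (B [^]\<^bsub>GL m\<^esub> j *\<^sub>v col M 0)"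
      using step [of j] Suc by simp
    also have "\<dots> = (B * B [^]\<^bsub>GL m\<^esub> j) *\<^sub>v col M 0"
      by (rule assoc_mult_mat_vec [OF cB P colc, symmetric])
    also have "B * B [^]\<^bsub>GL m\<^esub> j = B [^]\<^bsub>GL m\<^esub> Suc j"
      using GL.nat_pow_Suc2 [OF B, of j] by simp
    finally show ?case .
  qed
  have "B [^]\<^bsub>GL m\<^esub> (k * ?e) = 1\<^sub>m m"
    using GL.nat_pow_pow [OF B, of ?e k] GL.pow_order_eq_1 [OF B] GL.nat_pow_one [of k]
    by (simp add: Coset.order_def mult.commute)
  hence last: "col M (k * ?e) = col M 0" using pow [of "k * ?e"] colc [of 0] by (simp add: r)
  have "col M 1 - col M 0 = B *\<^sub>v col M (k * ?e)" using step [of "k * ?e"] by (simp add: r)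
  also have "\<dots> = col M 1" unfolding last using step [of 0] r1 by simp
  finally have d: "col M 1 - col M 0 = col M 1" .
  have "col M 0 = 0\<^sub>v m"
  proof (rule eq_vecI)
    fix i assume "i < dim_vec (0\<^sub>v m :: 'a vec)"
    hence i: "i < dim_row M" using M by simp
    have "(col M 1 - col M 0) $ i = col M 1 $ i" by (simp only: d)
    thus "col M 0 $ i = 0\<^sub>v m $ i" using i M by (simp del: index_col)
  qed (use M in simp)
  hence z: "col M j = 0\<^sub>v m" if "j < r" for j using pow [OF that] P [of j] by auto
  show ?thesis
  proof (rule mat_col_eqI)
    fix j assume "j < dim_col (0\<^sub>m m r :: 'a mat)"
    thus "col M j = col (0\<^sub>m m r) j" using z [of j] by simp
  qed (use M in auto)
qed

definition block_sum :: "nat \<Rightarrow> nat \<Rightarrow> 'k::field mat \<Rightarrow> 'k mat" where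
  "block_sum m r B = four_block_mat B (0\<^sub>m m r) (0\<^sub>m r m) (generic r)"

lemma block_sum_GL:
  assumes B: "B \<in> carrier (GL m)" and r: "1 < r"
  shows "block_sum m r B \<in> carrier (GL (m + r))"
proof -
  note cB = carrier_GL_mat [OF B]
  have "det (block_sum m r B) = det B * det (generic r)"
    unfolding block_sum_def
      by (rule det_four_block_mat_lower_left_zero [OF cB zero_carrier_mat refl generic_carrier(1)])
  moreover have "block_sum m r B \<in> carrier_mat (m + r) (m + r)"
    unfolding block_sum_def by (rule four_block_carrier_mat [OF cB generic_carrier(1)])
  ultimately show ?thesis using B generic_GL [OF r, where 'k = 'a] by (simp add: carrier_GL_iff_det)
qed

text \<open>The generic block admits no nonzero intertwiner with \<open>B\<close>, so an intertwiner of full rank is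
the same as an invertible intertwiner of \<open>B'\<close> and \<open>B\<close>, extended by zero.\<close>

lemma fr_count_block_sum:
  fixes B B' :: "'a::{finite,field} mat"
  assumes B: "B \<in> carrier (GL m)" and B': "B' \<in> carrier (GL m)"
    and k: "0 < k" and r: "r = Suc (k * card (carrier (GL m :: 'a mat monoid)))"
  shows "fr_count m B (m + r) (block_sum m r B') = of_nat (card {x \<in> carrier (GL m). x * B' = B * x})"
proof -
  let ?N = "m + r" and ?g = "block_sum m r B'"
  let ?E = "first_cols (m + r) m :: 'a mat" and ?F = "first_cols m (m + r) :: 'a mat"
  note cB = carrier_GL_mat [OF B] and cB' = carrier_GL_mat [OF B']
  have cg: "?g \<in> carrier_mat ?N ?N"
    unfolding block_sum_def by (rule four_block_carrier_mat [OF cB' generic_carrier(1)])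
  note cE = first_cols_carrier(1) [of ?N m,
    where 'a = 'a] and cF = first_cols_carrier(1) [of m ?N, where 'a = 'a]
  have gE: "?g * ?E = ?E * B'"
  proof (rule eq_matI)
    fix i j assume "i < dim_row (?E * B')" "j < dim_col (?E * B')"
    hence i: "i < ?N" and j: "j < m" using cB' cE by auto
    show "(?g * ?E) $$ (i, j) = (?E * B') $$ (i, j)"
      unfolding mult_first_cols [OF cg le_add1 i j] first_cols_mult [OF cB' i j]
      using i j cB' by (auto simp: block_sum_def)
  qed (use cg cB' cE in auto)
  have Fg: "?F * ?g = B' * ?F"
  proof (rule eq_matI)
    fix i j assume "i < dim_row (B' * ?F)" "j < dim_col (B' * ?F)"
    hence i: "i < m" and j: "j < ?N" using cB' cF by auto
    show "(?F * ?g) $$ (i, j) = (B' * ?F) $$ (i, j)"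
      unfolding mult_first_cols' [OF cB' i j] first_cols_mult [OF cg i j]
      using i j cB' by (auto simp: block_sum_def)
  qed (use cg cB' cF in auto)
  \<comment> \<open>Right multiplication by \<open>D\<close> selects the last \<open>r\<close> columns.\<close>
  define D where "D = mat ?N r (\<lambda>(i, j). if i = m + j then 1 else 0 :: 'a)"
  have cD: "D \<in> carrier_mat ?N r" by (simp add: D_def)
  have mult_D: "(A * D) $$ (i, j) = A $$ (i, m + j)" if A: "A \<in> carrier_mat n ?N" and i: "i < n"
    and j: "j < r" for A n i j
  proof -
    have "(A * D) $$ (i, j) = (\<Sum>p<?N. if p = m + j then A $$ (i, p) else 0)"
      unfolding mult_entry [OF A cD i j] using j by (intro sum.cong refl) (auto simp: D_def)
    thus ?thesis using j by simp
  qed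
  have gD: "?g * D = D * generic r"
  proof (rule eq_matI)
    fix i j assume "i < dim_row (D * generic r)" "j < dim_col (D * generic r)"
    hence i: "i < ?N" and j: "j < r" using cD by auto
    have "(D * generic r) $$ (i, j) = (\<Sum>p<r. if m + p = i then generic r $$ (p, j) else 0)"
      unfolding mult_entry [OF cD generic_carrier(1) i j] using i by (intro sum.cong refl) (auto simp: D_def)
    also have "\<dots> = (if i < m then 0 else generic r $$ (i - m, j))"
    proof (cases "i < m")
      case False
      have "(\<Sum>p<r. if m + p = i then generic r $$ (p, j) else 0) = (\<Sum>p<r. if p = i - m then generic r $$ (p, j) else 0 :: 'a)"
        using False by (intro sum.cong refl) auto
      thus ?thesis using False i by simp
    qed auto
    also have "\<dots> = (?g * D) $$ (i, j)"
      unfolding mult_D [OF cg i j] using i j cB' by (auto simp: block_sum_def)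
    finally show "(?g * D) $$ (i, j) = (D * generic r) $$ (i, j)" by simp
  qed (use cg cD in auto)
  have FE: "?F * ?E = 1\<^sub>m m"
  proof (rule eq_matI)
    fix i j assume "i < dim_row (1\<^sub>m m :: 'a mat)" "j < dim_col (1\<^sub>m m :: 'a mat)"
    hence i: "i < m" and j: "j < m" by simp_all
    show "(?F * ?E) $$ (i, j) = (1\<^sub>m m :: 'a mat) $$ (i, j)"
      unfolding mult_first_cols [OF cF le_add1 i j] using i j by (simp add: first_cols_def)
  qed (use cE cF in auto)
  have F: "?F \<in> surj_mats m ?N" unfolding surj_mats_def using cE cF FE by blast
  \<comment> \<open>Since nothing nonzero intertwines the generic block with \<open>B\<close>, only the first \<open>m\<close> columns of an intertwiner survive.\<close>
  have MEF: "M * ?E * ?F = M" if M: "M \<in> hom_mats m ?N B ?g" for M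
  proof (rule eq_matI)
    note cM = hom_matsD(1) [OF M]
    have "M * D * generic r = B * (M * D)"
    proof -
      have "M * D * generic r = M * ?g * D"
        unfolding assoc_mult_mat [OF cM cD generic_carrier(1)] assoc_mult_mat [OF cM cg cD] gD ..
      also have "\<dots> = B * (M * D)" unfolding hom_matsD(2) [OF M] by (rule assoc_mult_mat [OF cB cM cD])
      finally show ?thesis .
    qed
    hence MD: "M * D = 0\<^sub>m m r" by (rule generic_no_intertwiner [OF B k r mult_carrier_mat [OF cM cD]])
    fix i j assume "i < dim_row M" "j < dim_col M"
    hence i: "i < m" and j: "j < ?N" using cM by auto
    show "(M * ?E * ?F) $$ (i, j) = M $$ (i, j)"
    proof (cases "j < m")
      case True
      show ?thesis
        unfolding mult_first_cols' [OF mult_carrier_mat [OF cM cE] i j] mult_first_cols [OF cM le_add1 i True]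
        using True by simp
    next
      case False
      hence j': "j - m < r" using j by simp
      have "M $$ (i, j) = 0" using mult_D [OF cM i j'] False i j' by (simp add: MD)
      thus ?thesis unfolding mult_first_cols' [OF mult_carrier_mat [OF cM cE] i j] using False by simp
    qed
  qed (use hom_matsD(1) [OF M] cE cF in auto)
  have "bij_betw (\<lambda>x. x * ?F) {x \<in> carrier (GL m). x * B' = B * x} (hom_mats m ?N B ?g \<inter> surj_mats m ?N)"
  proof (rule bij_betw_byWitness [where f' = "\<lambda>M. M * ?E"])
    show "\<forall>x\<in>{x \<in> carrier (GL m). x * B' = B * x}. x * ?F * ?E = x"
    proof
      fix x assume "x \<in> {x \<in> carrier (GL m). x * B' = B * x}"
      hence cx: "x \<in> carrier_mat m m" by (simp add: carrier_GL_mat)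
      show "x * ?F * ?E = x" unfolding assoc_mult_mat [OF cx cF cE] FE using cx by simp
    qed
    show "\<forall>M\<in>hom_mats m ?N B ?g \<inter> surj_mats m ?N. M * ?E * ?F = M" using MEF by blast
    show "(\<lambda>x. x * ?F) ` {x \<in> carrier (GL m). x * B' = B * x} \<subseteq> hom_mats m ?N B ?g \<inter> surj_mats m ?N"
    proof clarify
      fix x :: "'a mat" assume x: "x \<in> carrier (GL m)" and e: "x * B' = B * x"
      note cx = carrier_GL_mat [OF x]
      have "x \<in> surj_mats m m" using x unfolding surj_mats_square .
      hence "x * ?F \<in> surj_mats m ?N" by (rule surj_mats_mult [OF _ F])
      moreover have "x * ?F * ?g = B * (x * ?F)"
      proof -
        have "x * ?F * ?g = x * B' * ?F"
          unfolding assoc_mult_mat [OF cx cF cg] assoc_mult_mat [OF cx cB' cF] Fg ..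
        thus ?thesis unfolding e assoc_mult_mat [OF cB cx cF] .
      qed
      ultimately show "x * ?F \<in> hom_mats m ?N B ?g \<inter> surj_mats m ?N"
        using mult_carrier_mat [OF cx cF] by (simp add: hom_mats_def)
    qed
    show "(\<lambda>M. M * ?E) ` (hom_mats m ?N B ?g \<inter> surj_mats m ?N) \<subseteq> {x \<in> carrier (GL m). x * B' = B * x}"
    proof clarify
      fix M assume M: "M \<in> hom_mats m ?N B ?g" and s: "M \<in> surj_mats m ?N"
      note cM = hom_matsD(1) [OF M]
      have cME: "M * ?E \<in> carrier_mat m m" by (rule mult_carrier_mat [OF cM cE])
      from s obtain R where R: "R \<in> carrier_mat ?N m" "M * R = 1\<^sub>m m" by (auto simp: surj_mats_def)
      have "M * ?E * (?F * R) = M * ?E * ?F * R" by (rule assoc_mult_mat [OF cME cF R(1), symmetric])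
      also have "\<dots> = 1\<^sub>m m" unfolding MEF [OF M] by (rule R(2))
      finally have "M * ?E \<in> surj_mats m m"
        unfolding surj_mats_def using cME mult_carrier_mat [OF cF R(1)] by blast
      moreover have "M * ?E * B' = B * (M * ?E)"
      proof -
        have "M * ?E * B' = M * ?g * ?E"
          unfolding assoc_mult_mat [OF cM cE cB'] assoc_mult_mat [OF cM cg cE] gE ..
        thus ?thesis unfolding hom_matsD(2) [OF M] assoc_mult_mat [OF cB cM cE] .
      qed
      ultimately show "M * ?E \<in> carrier (GL m) \<and> M * ?E * B' = B * (M * ?E)"
        unfolding surj_mats_square by blast
    qed
  qed
  from bij_betw_same_card [OF this]
  have "card (hom_mats m ?N B ?g \<inter> surj_mats m ?N) = card {x \<in> carrier (GL m). x * B' = B * x}"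
    by (rule sym)
  thus ?thesis by (simp only: fr_count_eq_surj)
qed

section \<open>Computing with stable class functions\<close>

lemma abs_cf_eqI:
  assumes "cf_rel F F" "cf_rel F' F'" "\<And>N g. M \<le> N \<Longrightarrow> g \<in> carrier (GL N) \<Longrightarrow> F N g = F' N g"
  shows "abs_cf F = abs_cf F'"
proof -
  have "\<forall>\<^sub>F N in sequentially. \<forall>g\<in>carrier (GL N). F N g = F' N g"
    using assms(3) unfolding eventually_sequentially by blast
  hence "cf_rel F F'"
    using assms(1,2) unfolding cf_rel_def by eventually_elim simp
  thus ?thesis using assms(1,2) Quotient_cf unfolding Quotient_def by blast
qed

lemma abs_cf_eq_0D:
  assumes "cf_rel F F" "abs_cf F = 0"
  shows "\<forall>\<^sub>F N in sequentially. \<forall>g\<in>carrier (GL N). F N g = 0"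
proof -
  have "cf_rel (\<lambda>_ _. 0) (\<lambda>_ (_ :: 'a mat). 0)" by (simp add: cf_rel_def class_function_def)
  moreover have "abs_cf F = abs_cf (\<lambda>_ _. 0)" using assms(2) by (simp add: zero_cf_def)
  ultimately have "cf_rel F (\<lambda>_ _. 0)" using assms(1) Quotient_cf unfolding Quotient_def by blast
  thus ?thesis unfolding cf_rel_def by (rule eventually_mono) simp
qed

text \<open>Linear combinations may be computed on representatives. The reflexivity statement is carried
along because \<open>abs_cf\<close> respects the operations only on families of class functions.\<close>

lemma sum_scale_abs_cf:
  assumes "finite S" and F: "\<And>s. s \<in> S \<Longrightarrow> cf_rel (F s) (F s)"
  shows "cf_rel (\<lambda>N g. \<Sum>s\<in>S. c s * F s N g) (\<lambda>N g. \<Sum>s\<in>S. c s * F s N g) \<and>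
    (\<Sum>s\<in>S. scale_cf (c s) (abs_cf (F s))) = abs_cf (\<lambda>N g. \<Sum>s\<in>S. c s * F s N g)"
  using assms
proof (induction S rule: finite_induct)
  case empty
  show ?case by (simp add: zero_cf_def cf_rel_def class_function_def)
next
  case (insert s S)
  have 1: "cf_rel (\<lambda>N g. c s * F s N g) (\<lambda>N g. c s * F s N g)"
    using insert.prems [of s] unfolding cf_rel_def by (auto elim!: eventually_mono simp: class_function_def)
  have IH: "cf_rel (\<lambda>N g. \<Sum>s\<in>S. c s * F s N g) (\<lambda>N g. \<Sum>s\<in>S. c s * F s N g)"
    "(\<Sum>s\<in>S. scale_cf (c s) (abs_cf (F s))) = abs_cf (\<lambda>N g. \<Sum>s\<in>S. c s * F s N g)"
    using insert by auto
  have "cf_rel (\<lambda>N g. c s * F s N g + (\<Sum>s\<in>S. c s * F s N g)) (\<lambda>N g. c s * F s N g + (\<Sum>s\<in>S. c s * F s N g))"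
    using 1 IH(1) unfolding cf_rel_def by eventually_elim (auto simp: class_function_def)
  moreover have "scale_cf (c s) (abs_cf (F s)) = abs_cf (\<lambda>N g. c s * F s N g)"
    by (rule scale_cf.abs_eq) (rule insert.prems, simp)
  moreover have "abs_cf (\<lambda>N g. c s * F s N g) + abs_cf (\<lambda>N g. \<Sum>s\<in>S. c s * F s N g) =
      abs_cf (\<lambda>N g. c s * F s N g + (\<Sum>s\<in>S. c s * F s N g))"
    by (rule plus_cf.abs_eq [OF 1 IH(1)])
  ultimately show ?case using insert.hyps IH(2) by simp
qed

section \<open>The change of basis\<close>

lemma circ_one_eq_sum_fr:
  fixes \<chi> :: "'a::{finite,field} mat \<Rightarrow> complex"
  shows "circ_one m \<chi> = scale_cf (1 / of_nat (card (carrier (GL m :: 'a mat monoid))))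
    (\<Sum>B\<in>carrier (GL m). scale_cf (\<chi> B) (fr m B))"
proof -
  let ?n = "of_nat (card (carrier (GL m :: 'a mat monoid))) :: complex"
  have rel: "cf_rel (fr_count m B) (fr_count m B)" if "B \<in> carrier (GL m)" for B :: "'a mat"
    by (rule cf_rel_fr_count [OF carrier_GL_mat [OF that]])
  have "scale_cf (1 / ?n) (\<Sum>B\<in>carrier (GL m). scale_cf (\<chi> B) (fr m B)) =
      (\<Sum>B\<in>carrier (GL m). scale_cf (1 / ?n * \<chi> B) (abs_cf (fr_count m B)))"
    by (simp add: cf.scale_sum_right fr_def)
  also have "\<dots> = abs_cf (\<lambda>N g. \<Sum>B\<in>carrier (GL m). 1 / ?n * \<chi> B * fr_count m B N g)"
    using sum_scale_abs_cf [where F = "fr_count m" and c = "\<lambda>B. 1 / ?n * \<chi> B", OF finite_GL rel]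
      by simp
  also have "\<dots> = circ_one m \<chi>"
    unfolding circ_one_def
  proof (rule abs_cf_eqI [OF _ cf_rel_circ_one_fun])
    show "cf_rel (\<lambda>N g. \<Sum>B\<in>carrier (GL m). 1 / ?n * \<chi> B * fr_count m B N g)
        (\<lambda>N g. \<Sum>B\<in>carrier (GL m). 1 / ?n * \<chi> B * fr_count m B N g)"
      using sum_scale_abs_cf [where F = "fr_count m" and c = "\<lambda>B. 1 / ?n * \<chi> B", OF finite_GL rel] by simp
    fix N and g :: "'a mat" assume "m \<le> N" "g \<in> carrier (GL N)"
    thus "(\<Sum>B\<in>carrier (GL m). 1 / ?n * \<chi> B * fr_count m B N g) = circ_one_fun m \<chi> N g"
      by (simp add: circ_one_fun_eq sum_divide_distrib)
  qed
  finally show ?thesis by (rule sym)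
qed

text \<open>Left multiplication by \<open>x\<close> is a bijection between the intertwiners for \<open>B\<close> and those for \<open>B'\<close>.\<close>

lemma fr_conjugate:
  fixes B x :: "'a::{finite,field} mat"
  assumes B: "B \<in> carrier (GL m)" and B': "B' \<in> carrier (GL m)" and x: "x \<in> carrier (GL m)"
    and eq: "x * B = B' * x"
  shows "fr m B = fr m B'"
  unfolding fr_def
proof (rule abs_cf_eqI [where M = 0])
  interpret GL: group "GL m :: 'a mat monoid" by (rule group_GL)
  note cB = carrier_GL_mat [OF B] and cB' = carrier_GL_mat [OF B'] and cx = carrier_GL_mat [OF x]
  show "cf_rel (fr_count m B) (fr_count m B)" "cf_rel (fr_count m B') (fr_count m B')"
    by (rule cf_rel_fr_count, fact)+
  let ?y = "inv\<^bsub>GL m\<^esub> x"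
  have y: "?y \<in> carrier (GL m)" using x by simp
  note cy = carrier_GL_mat [OF y]
  have yx: "?y * x = 1\<^sub>m m" and xy: "x * ?y = 1\<^sub>m m"
    using GL.l_inv [OF x] GL.r_inv [OF x] by simp_all
  have yB': "?y * B' = B * ?y"
  proof -
    have "?y * B' = ?y * (B' * (x * ?y))" using cB' by (simp add: xy)
    also have "B' * (x * ?y) = x * B * ?y" unfolding eq by (rule assoc_mult_mat [OF cB' cx cy, symmetric])
    also have "\<dots> = x * (B * ?y)" by (rule assoc_mult_mat [OF cx cB cy])
    also have "?y * \<dots> = B * ?y" by (rule left_inverse_cancel [OF cx cy yx mult_carrier_mat [OF cB cy]])
    finally show ?thesis .
  qed
  have move: "u * M \<in> hom_mats m N D g \<inter> surj_mats m N"
    if M: "M \<in> hom_mats m N C g \<inter> surj_mats m N" and u: "u \<in> carrier (GL m)"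
      and C: "C \<in> carrier_mat m m"
      and D: "D \<in> carrier_mat m m" and uC: "u * C = D * u" and g: "g \<in> carrier_mat N N"
        for M u C D g N
  proof -
    note cu = carrier_GL_mat [OF u]
    have cM: "M \<in> carrier_mat m N" and Mg: "M * g = C * M" and Ms: "M \<in> surj_mats m N"
      using M by (simp_all add: hom_mats_def)
    have "u \<in> surj_mats m m" using u unfolding surj_mats_square .
    hence "u * M \<in> surj_mats m N" by (rule surj_mats_mult [OF _ Ms])
    moreover have "u * M * g = D * (u * M)"
    proof -
      have "u * M * g = u * C * M" unfolding assoc_mult_mat [OF cu cM g] assoc_mult_mat [OF cu C cM] Mg ..
      also have "\<dots> = D * (u * M)" unfolding uC by (rule assoc_mult_mat [OF D cu cM])
      finally show ?thesis .
    qed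
    ultimately show ?thesis using mult_carrier_mat [OF cu cM] by (simp add: hom_mats_def)
  qed
  fix N and g :: "'a mat" assume g: "g \<in> carrier (GL N)"
  note cg = carrier_GL_mat [OF g]
  have "bij_betw (\<lambda>M. x * M) (hom_mats m N B g \<inter> surj_mats m N) (hom_mats m N B' g \<inter> surj_mats m N)"
  proof (rule bij_betw_byWitness [where f' = "\<lambda>M. ?y * M"])
    show "\<forall>M\<in>hom_mats m N B g \<inter> surj_mats m N. ?y * (x * M) = M"
      using left_inverse_cancel [OF cx cy yx] surj_matsD by blast
    show "\<forall>M\<in>hom_mats m N B' g \<inter> surj_mats m N. x * (?y * M) = M"
      using left_inverse_cancel [OF cy cx xy] surj_matsD by blast
    show "(\<lambda>M. x * M) ` (hom_mats m N B g \<inter> surj_mats m N) \<subseteq> hom_mats m N B' g \<inter> surj_mats m N"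
      using move [OF _ x cB cB' eq cg] by blast
    show "(\<lambda>M. ?y * M) ` (hom_mats m N B' g \<inter> surj_mats m N) \<subseteq> hom_mats m N B g \<inter> surj_mats m N"
      using move [OF _ y cB' cB yB' cg] by blast
  qed
  from bij_betw_same_card [OF this] show "fr_count m B N g = fr_count m B' N g"
    by (simp only: fr_count_eq_surj)
qed

lemma conjugator_iff:
  fixes x :: "'a::field mat"
  assumes x: "x \<in> carrier (GL m)" and B: "B \<in> carrier (GL m)" and B': "B' \<in> carrier (GL m)"
  shows "x \<otimes>\<^bsub>GL m\<^esub> B \<otimes>\<^bsub>GL m\<^esub> inv\<^bsub>GL m\<^esub> x = B' \<longleftrightarrow> x * B = B' * x"
proof -
  interpret GL: group "GL m :: 'a mat monoid" by (rule group_GL)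
  show ?thesis
    using GL.inv_solve_right' [of B' "x \<otimes>\<^bsub>GL m\<^esub> B" x] GL.m_closed [OF x B] x B B'
    by (metis GL.inv_solve_right' mult_GL)
qed

text \<open>Insert the first formula and apply column orthogonality: the coefficient of \<open>B'\<close> becomes the proportion of \<open>x\<close>
that conjugate \<open>B'\<close> to \<open>B\<close>. Only conjugates of \<open>B\<close> survive, and each \<open>x\<close> is counted for exactly one of them.\<close>

lemma fr_eq_sum_circ_one:
  fixes B :: "'a::{finite,field} mat"
  assumes B: "B \<in> carrier (GL m)"
  shows "fr m B = (\<Sum>\<chi>\<in>IrrChar (GL m :: 'a mat monoid). scale_cf (cnj (\<chi> B)) (circ_one m \<chi>))"
proof -
  interpret GL: finite_group "GL m :: 'a mat monoid" by (rule finite_group_GL)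
  let ?I = "IrrChar (GL m :: 'a mat monoid)" and ?G = "carrier (GL m :: 'a mat monoid)"
  let ?n = "of_nat (card ?G) :: complex"
  let ?X = "\<lambda>B'. {x \<in> ?G. x * B' = B * x}"
  have "(\<Sum>\<chi>\<in>?I. scale_cf (cnj (\<chi> B)) (circ_one m \<chi>)) =
      (\<Sum>\<chi>\<in>?I. \<Sum>B'\<in>?G. scale_cf (1 / ?n * (\<chi> B' * cnj (\<chi> B))) (fr m B'))"
    by (intro sum.cong refl) (subst circ_one_eq_sum_fr, simp add: cf.scale_sum_right mult.commute)
  also have "\<dots> = (\<Sum>B'\<in>?G. scale_cf (1 / ?n * (\<Sum>\<chi>\<in>?I. \<chi> B' * cnj (\<chi> B))) (fr m B'))"
    by (subst sum.swap) (simp add: cf.scale_sum_left [symmetric] sum_divide_distrib)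
  also have "\<dots> = (\<Sum>B'\<in>?G. scale_cf (1 / ?n * of_nat (card (?X B'))) (fr m B))"
  proof (rule sum.cong [OF refl])
    fix B' :: "'a mat" assume B': "B' \<in> ?G"
    have "(\<Sum>\<chi>\<in>?I. \<chi> B' * cnj (\<chi> B)) = (\<Sum>\<chi>\<in>?I. \<chi> B' * \<chi> (inv\<^bsub>GL m\<^esub> B))"
      by (intro sum.cong refl) (simp only: GL.IrrChar_cnj [OF _ B])
    also have "\<dots> = of_nat (card {x \<in> ?G. x \<otimes>\<^bsub>GL m\<^esub> B' \<otimes>\<^bsub>GL m\<^esub> inv\<^bsub>GL m\<^esub> x = B})"
      by (rule GL.column_orthogonality [OF B' B])
    also have "{x \<in> ?G. x \<otimes>\<^bsub>GL m\<^esub> B' \<otimes>\<^bsub>GL m\<^esub> inv\<^bsub>GL m\<^esub> x = B} = ?X B'"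
      using conjugator_iff [OF _ B' B] by blast
    finally have c: "(\<Sum>\<chi>\<in>?I. \<chi> B' * cnj (\<chi> B)) = of_nat (card (?X B'))" .
    show "scale_cf (1 / ?n * (\<Sum>\<chi>\<in>?I. \<chi> B' * cnj (\<chi> B))) (fr m B') =
        scale_cf (1 / ?n * of_nat (card (?X B'))) (fr m B)"
    proof (cases "?X B' = {}")
      case True
      show ?thesis unfolding c True by simp
    next
      case False
      then obtain x where "x \<in> ?G" "x * B' = B * x" by blast
      hence "fr m B' = fr m B" by (rule fr_conjugate [OF B' B])
      thus ?thesis unfolding c by simp
    qed
  qed
  also have "\<dots> = scale_cf (1 / ?n * of_nat (\<Sum>B'\<in>?G. card (?X B'))) (fr m B)"
    by (simp add: cf.scale_sum_left [symmetric] sum_divide_distrib)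
  also have "(\<Sum>B'\<in>?G. card (?X B')) = card ?G"
  proof -
    have "(\<Sum>B'\<in>?G. card (?X B')) = (\<Sum>B'\<in>?G. card {x \<in> ?G. inv\<^bsub>GL m\<^esub> x \<otimes>\<^bsub>GL m\<^esub> B \<otimes>\<^bsub>GL m\<^esub> x = B'})"
    proof (intro sum.cong refl arg_cong [where f = card] Collect_cong conj_cong)
      fix B' x :: "'a mat" assume B': "B' \<in> ?G" and x: "x \<in> ?G"
      have "x * B' = B * x \<longleftrightarrow> x \<otimes>\<^bsub>GL m\<^esub> B' = B \<otimes>\<^bsub>GL m\<^esub> x" by simp
      also have "\<dots> \<longleftrightarrow> inv\<^bsub>GL m\<^esub> x \<otimes>\<^bsub>GL m\<^esub> (B \<otimes>\<^bsub>GL m\<^esub> x) = B'"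
        using GL.inv_solve_left' [of B' x "B \<otimes>\<^bsub>GL m\<^esub> x"] GL.m_closed [OF B x] x B'
          by (auto simp del: mult_GL)
      finally show "(x * B' = B * x) = (inv\<^bsub>GL m\<^esub> x \<otimes>\<^bsub>GL m\<^esub> B \<otimes>\<^bsub>GL m\<^esub> x = B')"
        using x B by (simp only: GL.m_assoc GL.inv_closed)
    qed
    also have "\<dots> = card ?G"
    proof -
      have "(\<lambda>x. inv\<^bsub>GL m\<^esub> x \<otimes>\<^bsub>GL m\<^esub> B \<otimes>\<^bsub>GL m\<^esub> x) ` ?G \<subseteq> ?G" using B by blast
      from sum.group [OF finite_GL finite_GL this, of "\<lambda>_. 1 :: nat"] show ?thesis by simp
    qed
    finally show ?thesis .
  qed
  also have "1 / ?n * of_nat (card ?G) = 1" using GL.one_closed by auto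
  finally show ?thesis by simp
qed

section \<open>Linear independence\<close>

text \<open>An equation between stable class functions is information about large \<open>N\<close> only. Since the size of the
generic block is still free, block sums reach such \<open>N\<close>.\<close>

lemma eventually_at_block_sum:
  assumes ev: "\<forall>\<^sub>F N in sequentially. \<forall>g\<in>carrier (GL N). P N g"
  obtains k r where "0 < k" "r = Suc (k * card (carrier (GL m :: 'a::{finite,field} mat monoid)))"
    "\<And>B. B \<in> carrier (GL m) \<Longrightarrow> P (m + r) (block_sum m r B :: 'a mat)"
proof -
  interpret GL: finite_group "GL m :: 'a mat monoid" by (rule finite_group_GL)
  let ?e = "card (carrier (GL m :: 'a mat monoid))"
  obtain N0 where N0: "\<And>N g. N0 \<le> N \<Longrightarrow> g \<in> carrier (GL N) \<Longrightarrow> P N g"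
    using ev unfolding eventually_sequentially by blast
  \<comment> \<open>The factor \<open>Suc N0\<close> only makes \<open>r\<close> large and at least \<open>2\<close>.\<close>
  define r where "r = Suc (Suc N0 * ?e)"
  have e: "1 \<le> ?e" using GL.card_carrier_pos by linarith
  have "Suc N0 * 1 \<le> Suc N0 * ?e" using e by (intro mult_le_mono) simp_all
  hence "Suc N0 < r" unfolding r_def by simp
  hence r: "N0 \<le> m + r" "1 < r" by linarith+
  show ?thesis
  proof (rule that [OF _ r_def])
    fix B :: "'a mat" assume "B \<in> carrier (GL m)"
    thus "P (m + r) (block_sum m r B)" by (intro N0 r block_sum_GL)
  qed simp
qed

text \<open>Evaluation at block sums turns \<open>circ_one m \<chi>\<close> into \<open>\<chi>\<close>.\<close>

lemma circ_one_linear_independent: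
  assumes S: "finite S" "S \<subseteq> IrrChar (GL m :: 'a::{finite,field} mat monoid)" and \<psi>: "\<psi> \<in> S"
    and z: "(\<Sum>\<chi>\<in>S. scale_cf (a \<chi>) (circ_one m \<chi>)) = 0"
  shows "a \<psi> = 0"
proof -
  interpret GL: finite_group "GL m :: 'a mat monoid" by (rule finite_group_GL)
  let ?G = "carrier (GL m :: 'a mat monoid)"
  let ?F = "\<lambda>N g. \<Sum>\<chi>\<in>S. a \<chi> * circ_one_fun m \<chi> N g"
  have F: "cf_rel ?F ?F" "abs_cf ?F = 0"
    using sum_scale_abs_cf [OF S(1), of "circ_one_fun m" a] cf_rel_circ_one_fun z
      unfolding circ_one_def by auto
  obtain k r where k: "0 < k" and r: "r = Suc (k * card ?G)"
    and ev: "\<And>B. B \<in> ?G \<Longrightarrow> ?F (m + r) (block_sum m r B) = 0"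
    by (rule eventually_at_block_sum [OF abs_cf_eq_0D [OF F], where m = m]) (rule that)
  have r1: "1 < r" using k GL.card_carrier_pos by (simp add: r)
  have value_at: "circ_one_fun m \<chi> (m + r) (block_sum m r B) = \<chi> B"
    if B: "B \<in> ?G" and \<chi>: "\<chi> \<in> IrrChar (GL m)" for B \<chi>
  proof -
    have "(\<Sum>C\<in>?G. \<chi> C * fr_count m C (m + r) (block_sum m r B)) =
        (\<Sum>C\<in>?G. \<Sum>x | x \<in> ?G \<and> x \<otimes>\<^bsub>GL m\<^esub> B \<otimes>\<^bsub>GL m\<^esub> inv\<^bsub>GL m\<^esub> x = C. \<chi> (x \<otimes>\<^bsub>GL m\<^esub> B \<otimes>\<^bsub>GL m\<^esub> inv\<^bsub>GL m\<^esub> x))"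
    proof (rule sum.cong [OF refl])
      fix C :: "'a mat" assume C: "C \<in> ?G"
      have "{x \<in> ?G. x * B = C * x} = {x \<in> ?G. x \<otimes>\<^bsub>GL m\<^esub> B \<otimes>\<^bsub>GL m\<^esub> inv\<^bsub>GL m\<^esub> x = C}"
        using conjugator_iff [OF _ B C] by blast
      hence "\<chi> C * fr_count m C (m + r) (block_sum m r B) =
          \<chi> C * of_nat (card {x \<in> ?G. x \<otimes>\<^bsub>GL m\<^esub> B \<otimes>\<^bsub>GL m\<^esub> inv\<^bsub>GL m\<^esub> x = C})"
        by (simp only: fr_count_block_sum [OF C B k r])
      thus "\<chi> C * fr_count m C (m + r) (block_sum m r B) =
          (\<Sum>x | x \<in> ?G \<and> x \<otimes>\<^bsub>GL m\<^esub> B \<otimes>\<^bsub>GL m\<^esub> inv\<^bsub>GL m\<^esub> x = C. \<chi> (x \<otimes>\<^bsub>GL m\<^esub> B \<otimes>\<^bsub>GL m\<^esub> inv\<^bsub>GL m\<^esub> x))"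
        by (simp add: mult.commute del: mult_GL)
    qed
    also have "\<dots> = (\<Sum>x\<in>?G. \<chi> (x \<otimes>\<^bsub>GL m\<^esub> B \<otimes>\<^bsub>GL m\<^esub> inv\<^bsub>GL m\<^esub> x))"
      by (rule sum.group [OF finite_GL finite_GL]) (use B in blast)
    also have "\<dots> = of_nat (card ?G) * \<chi> B"
      using GL.IrrChar_conjugate [OF \<chi> B] by (simp del: mult_GL)
    finally show ?thesis
      using GL.one_closed by (auto simp: circ_one_fun_eq [OF le_add1 block_sum_GL [OF B r1]])
  qed
  have "(\<Sum>\<chi>\<in>S. a \<chi> * \<chi> B) = 0" if B: "B \<in> ?G" for B
  proof -
    have "(\<Sum>\<chi>\<in>S. a \<chi> * \<chi> B) = (\<Sum>\<chi>\<in>S. a \<chi> * circ_one_fun m \<chi> (m + r) (block_sum m r B))"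
      by (intro sum.cong refl) (use value_at [OF B] S(2) in auto)
    thus ?thesis using ev [OF B] by simp
  qed
  thus ?thesis by (rule GL.IrrChar_linear_independent [OF S \<psi>])
qed

text \<open>At the block sum of \<open>B0\<close> only the member of \<open>S\<close> that is conjugate to \<open>B0\<close>, namely \<open>B0\<close>, contributes.\<close>

lemma fr_linear_independent:
  fixes S :: "'a::{finite,field} mat set"
  assumes S: "S \<subseteq> carrier (GL m)" and inj: "inj_on (fr m) S" and B0: "B0 \<in> S"
    and z: "(\<Sum>B\<in>S. scale_cf (a B) (fr m B)) = 0"
  shows "a B0 = 0"
proof -
  interpret GL: finite_group "GL m :: 'a mat monoid" by (rule finite_group_GL)
  let ?F = "\<lambda>N g. \<Sum>B\<in>S. a B * fr_count m B N g"
  have fS: "finite S" by (rule finite_subset [OF S finite_GL])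
  have rel: "cf_rel (fr_count m B) (fr_count m B)" if "B \<in> S" for B
    using S that cf_rel_fr_count carrier_GL_mat by blast
  have F: "cf_rel ?F ?F" "abs_cf ?F = 0"
    using sum_scale_abs_cf [where F = "fr_count m" and c = a, OF fS rel] z unfolding fr_def by auto
  obtain k r where k: "0 < k" and r: "r = Suc (k * card (carrier (GL m :: 'a mat monoid)))"
    and ev: "\<And>B. B \<in> carrier (GL m) \<Longrightarrow> ?F (m + r) (block_sum m r B) = 0"
    by (rule eventually_at_block_sum [OF abs_cf_eq_0D [OF F], where m = m]) (rule that)
  have B0': "B0 \<in> carrier (GL m)" using S B0 by blast
  have other: "fr_count m B (m + r) (block_sum m r B0) = 0" if B: "B \<in> S" and ne: "B \<noteq> B0" for B
  proof -
    have B': "B \<in> carrier (GL m)" using S B by blast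
    have "x * B0 \<noteq> B * x" if x: "x \<in> carrier (GL m)" for x
    proof
      assume "x * B0 = B * x"
      hence "fr m B0 = fr m B" by (rule fr_conjugate [OF B0' B' x])
      thus False using inj B B0 ne by (auto simp: inj_on_def)
    qed
    hence e: "{x \<in> carrier (GL m). x * B0 = B * x} = {}" by blast
    show ?thesis unfolding fr_count_block_sum [OF B' B0' k r] e by simp
  qed
  have "?F (m + r) (block_sum m r B0) = (\<Sum>B\<in>{B0}. a B * fr_count m B (m + r) (block_sum m r B0))"
    by (rule sum.mono_neutral_right [OF fS]) (use B0 other in auto)
  hence "a B0 * fr_count m B0 (m + r) (block_sum m r B0) = 0" using ev [OF B0'] by simp
  moreover have "fr_count m B0 (m + r) (block_sum m r B0) \<noteq> 0"
  proof -
    have "1\<^sub>m m \<in> {x \<in> carrier (GL m). x * B0 = B0 * x}"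
      using carrier_GL_mat [OF B0'] GL.one_closed by simp
    moreover have "finite {x \<in> carrier (GL m). x * B0 = B0 * x}" by simp
    ultimately have "card {x \<in> carrier (GL m). x * B0 = B0 * x} \<noteq> 0"
      by (metis card_eq_0_iff empty_iff)
    thus ?thesis unfolding fr_count_block_sum [OF B0' B0' k r] by simp
  qed
  ultimately show ?thesis by simp
qed

theorem theorem1p3:
  fixes m :: nat
  shows "(Rfr m :: 'a::{finite,field} cf set) = Pspan m
    \<and> inj_on (circ_one m) (IrrChar (GL m :: 'a mat monoid))
    \<and> cf.independent (circ_one m ` IrrChar (GL m :: 'a mat monoid))
    \<and> cf.independent (fr m ` carrier (GL m :: 'a mat monoid))
    \<and> (\<forall>\<chi>\<in>IrrChar (GL m :: 'a mat monoid).
         circ_one m \<chi> =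
           scale_cf (1 / of_nat (card (carrier (GL m :: 'a mat monoid))))
             (\<Sum>B\<in>carrier (GL m). scale_cf (\<chi> B) (fr m B)))
    \<and> (\<forall>B\<in>carrier (GL m :: 'a mat monoid).
         fr m B =
           (\<Sum>\<chi>\<in>IrrChar (GL m :: 'a mat monoid). scale_cf (cnj (\<chi> B)) (circ_one m \<chi>)))"
proof (intro conjI ballI)
  interpret GL: finite_group "GL m :: 'a mat monoid" by (rule finite_group_GL)
  let ?I = "IrrChar (GL m :: 'a mat monoid)" and ?G = "carrier (GL m :: 'a mat monoid)"
  show "(circ_one m \<chi> :: 'a cf) = scale_cf (1 / of_nat (card ?G)) (\<Sum>B\<in>carrier (GL m). scale_cf (\<chi> B) (fr m B))" for \<chi>
    by (rule circ_one_eq_sum_fr)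
  show "fr m B = (\<Sum>\<chi>\<in>?I. scale_cf (cnj (\<chi> B)) (circ_one m \<chi>))" if "B \<in> ?G" for B
    by (rule fr_eq_sum_circ_one [OF that])
  show "(Rfr m :: 'a cf set) = Pspan m"
  proof (rule antisym)
    have "fr m B \<in> cf.span (circ_one m ` ?I)" if B: "B \<in> ?G" for B
      unfolding fr_eq_sum_circ_one [OF B] by (intro cf.span_sum cf.span_scale cf.span_base) blast
    thus "Rfr m \<subseteq> (Pspan m :: 'a cf set)"
      unfolding Rfr_def Pspan_def by (intro cf.span_minimal cf.subspace_span) blast
    have "(circ_one m \<chi> :: 'a cf) \<in> cf.span (fr m ` ?G)" for \<chi>
      unfolding circ_one_eq_sum_fr by (intro cf.span_sum cf.span_scale cf.span_base) blast
    thus "Pspan m \<subseteq> (Rfr m :: 'a cf set)"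
      unfolding Rfr_def Pspan_def by (intro cf.span_minimal cf.subspace_span) blast
  qed
  show inj: "inj_on (circ_one m) ?I"
  proof (rule inj_onI, rule ccontr)
    fix \<chi> \<psi> assume \<chi>: "\<chi> \<in> ?I" and \<psi>: "\<psi> \<in> ?I" and eq: "circ_one m \<chi> = circ_one m \<psi>" and ne: "\<chi> \<noteq> \<psi>"
    have "(\<Sum>\<theta>\<in>{\<chi>, \<psi>}. scale_cf (if \<theta> = \<chi> then 1 else - 1) (circ_one m \<theta>)) = 0"
      using ne eq by simp
    from circ_one_linear_independent [OF _ _ _ this, of \<chi>] \<chi> \<psi> show False by simp
  qed
  show "cf.independent (circ_one m ` ?I)"
    unfolding cf.dependent_explicit
  proof clarify
    fix T :: "'a cf set" and u v assume T: "finite T" "T \<subseteq> circ_one m ` ?I" and v: "v \<in> T" "u v \<noteq> 0"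
      and z: "(\<Sum>v\<in>T. scale_cf (u v) v) = 0"
    obtain S where S: "S \<subseteq> ?I" "inj_on (circ_one m) S" "T = circ_one m ` S"
      using T(2) unfolding subset_image_inj by blast
    obtain \<psi> where \<psi>: "\<psi> \<in> S" "v = circ_one m \<psi>" using v S by blast
    have fS: "finite S" by (rule finite_subset [OF S(1) GL.finite_IrrChar])
    have "(\<Sum>\<chi>\<in>S. scale_cf (u (circ_one m \<chi>)) (circ_one m \<chi>)) = 0"
      using z unfolding S(3) sum.reindex [OF S(2)] by simp
    from circ_one_linear_independent [OF fS S(1) \<psi>(1) this] v \<psi> show False by simp
  qed
  show "cf.independent (fr m ` ?G)"
    unfolding cf.dependent_explicit
  proof clarify
    fix T :: "'a cf set" and u v assume T: "finite T" "T \<subseteq> fr m ` ?G" and v: "v \<in> T" "u v \<noteq> 0"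
      and z: "(\<Sum>v\<in>T. scale_cf (u v) v) = 0"
    obtain S where S: "S \<subseteq> ?G" "inj_on (fr m) S" "T = fr m ` S"
      using T(2) unfolding subset_image_inj by blast
    obtain B0 where B0: "B0 \<in> S" "v = fr m B0" using v S by blast
    have "(\<Sum>B\<in>S. scale_cf (u (fr m B)) (fr m B)) = 0"
      using z unfolding S(3) sum.reindex [OF S(2)] by simp
    from fr_linear_independent [OF S(1,2) B0(1) this] v B0 show False by simp
  qed
qed

end
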